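(* Let $K$ be an algebraically closed field of arbitrary characteristic. Let $P\subset\mathbb{R}^n_{\geq 0}$ be a $C$-polytope with a single facet $\Delta$ with weight vector $w=(w_1,\ldots,w_n)\in\mathbb{Z}_{>0}^n$ and suppose that $f\in K[[x_1,\ldots,x_n]]$ has principal part $\operatorname{in}_w(f)=\operatorname{in}_\Delta(f)$ with respect to $P$. Then $f$ is inner Newton non-degenerate (INND) with respect to $P$ if and only if $f$ is right semi-quasihomogeneous (rSQH) with respect to $w$. In particular, if $f\in K[[x_1,\ldots,x_n]]$ is rSQH with respect to $w\in\mathbb{Z}_{>0}^n$ of weighted degree $d$, then $$\mu(f)=\left(\frac{d}{w_1}-1\right)\cdots\left(\frac{d}{w_n}-1\right).$$
   Context: Write $f=\sum_\alpha a_\alpha x^\alpha$, $\operatorname{supp}(f)=\{\alpha\mid a_\alpha\neq0\}$. $\mu(f)=\dim_K K[[x_1,\ldots,x_n]]/\langle f_{x_1},\ldots,f_{x_n}\rangle$ is the Milnor number. $C$-polytope: a compact rational (piecewise linear) polytope $P$ of dimension $n-1$ in $\mathbb{R}^n_{\geq 0}$ such that the region above $P$ is convex and every ray in $\mathbb{R}^n_{\geq 0}$ emanating from the origin meets $P$ in exactly one point. If $P$ has a single facet $\Delta$ with weight vector $w$, then $P=\Delta=\{\alpha\in\mathbb{R}^n_{\geq 0}\mid w\cdot\alpha=d\}$ for some $d>0$. It is assumed that no point of $\operatorname{supp}(f)$ lies below $P$. A face is inner if it is not contained in any coordinate hyperplane. For a face $\Delta$, $\operatorname{in}_\Delta(f)=\sum_{\alpha\in\Delta}a_\alpha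 x^\alpha$. For $q\in K^n$ let $H_q=\bigcap_{i:\,q_i=0}\{x_i=0\}\subseteq\mathbb{R}^n$. $f$ is inner non-degenerate (IND) along a face $\Delta$ if for each common zero $q\in K^n$ of all partial derivatives of $\operatorname{in}_\Delta(f)$ the face $\Delta$ contains no point of $H_q$. $f$ is INND with respect to $P$ if no point of $\operatorname{supp}(f)$ lies below $P$ and $f$ is IND along each inner face of $P$. For $w\in\mathbb{Z}_{>0}^n$, the weighted degree of $x^\alpha$ is $w\cdot\alpha=\sum_i w_i\alpha_i$; $\operatorname{in}_w(f)=\sum a_\alpha x^\alpha$, summed over those $\alpha\in\operatorname{supp}(f)$ with $w\cdot\alpha$ minimal. $f$ is rSQH with respect to $w$ if $\mu(\operatorname{in}_w(f))<\infty$; its weighted degree $d$ is then the weighted degree of the monomials of $\operatorname{in}_w(f)$. *)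

theory Defs
  imports
    "HOL-Analysis.Analysis"
    "HOL-Algebra.QuotRing"
    "HOL-Algebra.Embedded_Algebras"
    "HOL-Library.Extended_Nat"
    "HOL-Library.Extended_Real"
    "HOL-Computational_Algebra.Polynomial"
begin

text \<open>
  The variables are indexed by a finite type, so \<open>('k, 'n) mfps\<close> is
  $K[[x_1,\ldots,x_n]]$ with $n = $ \<open>CARD('n)\<close> $\ge 1$.
\<close>

typedef ('k, 'n) mfps = "UNIV :: (nat ^ 'n \<Rightarrow> 'k) set"
  morphisms mcoeff Abs_mfps ..

setup_lifting type_definition_mfps

lemma mfps_eqI: "(\<And>\<alpha>. mcoeff f \<alpha> = mcoeff g \<alpha>) \<Longrightarrow> f = g"
  by (simp add: mcoeff_inject[symmetric] fun_eq_iff)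

definition decompositions :: "nat ^ 'n \<Rightarrow> ((nat ^ 'n) \<times> (nat ^ 'n)) set" where
  "decompositions \<gamma> = {(\<alpha>, \<beta>). \<alpha> + \<beta> = \<gamma>}"

lemma finite_decompositions: "finite (decompositions (\<gamma> :: nat ^ 'n))"
proof -
  let ?B = "(\<lambda>f. (\<chi> i. f i) :: nat ^ 'n) ` (PiE UNIV (\<lambda>i. {..\<gamma> $ i}))"
  have fin: "finite ?B"
    by (intro finite_imageI finite_PiE) auto
  have *: "x \<in> ?B" if "\<forall>i. x $ i \<le> \<gamma> $ i" for x :: "nat ^ 'n"
    using that by (intro image_eqI[where x = "vec_nth x"]) (auto simp: PiE_def)
  have "decompositions \<gamma> \<subseteq> ?B \<times> ?B"
  proof safe
    fix \<alpha> \<beta> assume "(\<alpha>, \<beta>) \<in> decompositions \<gamma>"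
    then have "\<gamma> = \<alpha> + \<beta>" by (simp add: decompositions_def)
    then have "\<forall>i. \<alpha> $ i \<le> \<gamma> $ i" "\<forall>i. \<beta> $ i \<le> \<gamma> $ i" by simp_all
    then show "\<alpha> \<in> ?B" "\<beta> \<in> ?B" by (blast intro: *)+
  qed
  with fin show ?thesis
    by (meson finite_SigmaI finite_subset)
qed

instantiation mfps :: (comm_ring_1, finite) comm_ring_1
begin

lift_definition zero_mfps :: "('a, 'b) mfps" is "\<lambda>_. 0" .
lift_definition one_mfps :: "('a, 'b) mfps" is "\<lambda>\<alpha>. if \<alpha> = 0 then 1 else 0" .
lift_definition plus_mfps :: "('a, 'b) mfps \<Rightarrow> ('a, 'b) mfps \<Rightarrow> ('a, 'b) mfps"
  is "\<lambda>f g \<alpha>. f \<alpha> + g \<alpha>" .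
lift_definition minus_mfps :: "('a, 'b) mfps \<Rightarrow> ('a, 'b) mfps \<Rightarrow> ('a, 'b) mfps"
  is "\<lambda>f g \<alpha>. f \<alpha> - g \<alpha>" .
lift_definition uminus_mfps :: "('a, 'b) mfps \<Rightarrow> ('a, 'b) mfps"
  is "\<lambda>f \<alpha>. - f \<alpha>" .
lift_definition times_mfps :: "('a, 'b) mfps \<Rightarrow> ('a, 'b) mfps \<Rightarrow> ('a, 'b) mfps"
  is "\<lambda>f g \<gamma>. \<Sum>(\<alpha>, \<beta>)\<in>decompositions \<gamma>. f \<alpha> * g \<beta>" .

instance
proof
  fix a b c :: "('a, 'b) mfps"
  show "a + b + c = a + (b + c)" by transfer (simp add: add.assoc)
  show "a + b = b + a" by transfer (simp add: add.commute)
  show "0 + a = a" by transfer simp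
  show "- a + a = 0" by transfer simp
  show "a - b = a + - b" by transfer simp
  show "a * b * c = a * (b * c)"
  proof (transfer, rule ext)
    fix a b c :: "nat ^ 'b \<Rightarrow> 'a" and \<gamma> :: "nat ^ 'b"
    have "(\<Sum>(\<alpha>, \<beta>)\<in>decompositions \<gamma>. (\<Sum>(\<alpha>, \<beta>)\<in>decompositions \<alpha>. a \<alpha> * b \<beta>) * c \<beta>)
        = (\<Sum>(p, q)\<in>(SIGMA p:decompositions \<gamma>. decompositions (fst p)).
             a (fst q) * b (snd q) * c (snd p))"
      by (subst sum.Sigma[symmetric])
         (auto simp: finite_decompositions sum_distrib_right case_prod_unfold)
    also have "\<dots> = (\<Sum>(p, q)\<in>(SIGMA p:decompositions \<gamma>. decompositions (snd p)).
             a (fst p) * (b (fst q) * c (snd q)))"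
      by (rule sum.reindex_bij_witness[where
            i = "\<lambda>(p, q). ((fst p + fst q, snd q), (fst p, fst q))" and
            j = "\<lambda>(p, q). ((fst q, snd q + snd p), (snd q, snd p))"])
         (auto simp: decompositions_def algebra_simps)
    also have "\<dots> = (\<Sum>(\<alpha>, \<beta>)\<in>decompositions \<gamma>. a \<alpha> * (\<Sum>(\<alpha>, \<beta>)\<in>decompositions \<beta>. b \<alpha> * c \<beta>))"
      by (subst sum.Sigma[symmetric])
         (auto simp: finite_decompositions sum_distrib_left case_prod_unfold)
    finally show "(\<Sum>(\<alpha>, \<beta>)\<in>decompositions \<gamma>.
             (\<Sum>(\<alpha>, \<beta>)\<in>decompositions \<alpha>. a \<alpha> * b \<beta>) * c \<beta>)
        = (\<Sum>(\<alpha>, \<beta>)\<in>decompositions \<gamma>. a \<alpha> * (\<Sum>(\<alpha>, \<beta>)\<in>decompositions \<beta>. b \<alpha> * c \<beta>))" .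
  qed
  show "a * b = b * a"
  proof (transfer, rule ext)
    fix a b :: "nat ^ 'b \<Rightarrow> 'a" and \<gamma> :: "nat ^ 'b"
    show "(\<Sum>(\<alpha>, \<beta>)\<in>decompositions \<gamma>. a \<alpha> * b \<beta>) = (\<Sum>(\<alpha>, \<beta>)\<in>decompositions \<gamma>. b \<alpha> * a \<beta>)"
      by (rule sum.reindex_bij_witness[where i = prod.swap and j = prod.swap])
         (auto simp: decompositions_def algebra_simps)
  qed
  show "1 * a = a"
  proof (transfer, rule ext)
    fix a :: "nat ^ 'b \<Rightarrow> 'a" and \<gamma> :: "nat ^ 'b"
    have "(\<Sum>(\<alpha>, \<beta>)\<in>decompositions \<gamma>. (if \<alpha> = 0 then 1 else 0) * a \<beta>)
        = (\<Sum>(\<alpha>, \<beta>)\<in>{(0 :: nat ^ 'b, \<gamma>)}. (if \<alpha> = 0 then 1 else 0) * a \<beta>)"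
      by (rule sum.mono_neutral_right) (auto simp: finite_decompositions, auto simp: decompositions_def split: if_splits)
    then show "(\<Sum>(\<alpha>, \<beta>)\<in>decompositions \<gamma>. (if \<alpha> = 0 then 1 else 0) * a \<beta>) = a \<gamma>"
      by simp
  qed
  show "(a + b) * c = a * c + b * c"
    by (transfer, rule ext)
       (simp add: case_prod_unfold algebra_simps sum.distrib)
  show "(0 :: ('a, 'b) mfps) \<noteq> 1"
    by (transfer, auto simp: fun_eq_iff)
qed

end

lift_definition mconst :: "'k::zero \<Rightarrow> ('k, 'n::finite) mfps"
  is "\<lambda>c \<alpha>. if \<alpha> = 0 then c else 0" .

definition msupp :: "('k::zero, 'n) mfps \<Rightarrow> (nat ^ 'n) set" where
  "msupp f = {\<alpha>. mcoeff f \<alpha> \<noteq> 0}"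

lift_definition mderiv :: "'n \<Rightarrow> ('k::semiring_1, 'n::finite) mfps \<Rightarrow> ('k, 'n) mfps"
  is "\<lambda>i f \<alpha>. of_nat (\<alpha> $ i + 1) * f (\<alpha> + axis i 1)" .

lift_definition mrestrict :: "(nat ^ 'n) set \<Rightarrow> ('k::zero, 'n) mfps \<Rightarrow> ('k, 'n) mfps"
  is "\<lambda>S f \<alpha>. if \<alpha> \<in> S then f \<alpha> else 0" .

text \<open>Evaluation at a point of $K^n$; meaningful only for finite support, i.e. for polynomials.\<close>

definition meval :: "('k::comm_semiring_1, 'n::finite) mfps \<Rightarrow> 'k ^ 'n \<Rightarrow> 'k" where
  "meval f q = (\<Sum>\<alpha>\<in>msupp f. mcoeff f \<alpha> * (\<Prod>i\<in>UNIV. q $ i ^ \<alpha> $ i))"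

definition mfps_ring :: "('k::comm_ring_1, 'n::finite) mfps ring" where
  "mfps_ring = \<lparr>carrier = UNIV, mult = (*), one = 1, zero = 0, add = (+)\<rparr>"

lemma cring_mfps_ring: "cring (mfps_ring :: ('k::comm_ring_1, 'n::finite) mfps ring)"
proof (rule cringI)
  show "abelian_group (mfps_ring :: ('k, 'n) mfps ring)"
  proof (rule abelian_groupI, goal_cases)
    case (6 x)
    have "- x + x = 0" by simp
    then show ?case unfolding mfps_ring_def by (auto intro: exI[of _ "- x"])
  qed (simp_all add: mfps_ring_def algebra_simps)
  show "comm_monoid (mfps_ring :: ('k, 'n) mfps ring)"
    by (rule comm_monoidI) (simp_all add: mfps_ring_def algebra_simps)
qed (simp add: mfps_ring_def algebra_simps)

definition jacobian_ideal :: "('k::comm_ring_1, 'n::finite) mfps \<Rightarrow> ('k, 'n) mfps set" where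
  "jacobian_ideal f = genideal mfps_ring (range (\<lambda>i. mderiv i f))"

definition milnor_algebra :: "('k::comm_ring_1, 'n::finite) mfps \<Rightarrow> ('k, 'n) mfps set ring" where
  "milnor_algebra f = mfps_ring Quot jacobian_ideal f"

text \<open>
  The image of $K$ in the quotient ring. It is a subfield unless the Jacobian ideal is the
  unit ideal; in that case the quotient is the zero ring, whose \<^const>\<open>ring.dimension\<close> is still 0.
\<close>

definition milnor_scalars :: "('k::comm_ring_1, 'n::finite) mfps \<Rightarrow> ('k, 'n) mfps set set" where
  "milnor_scalars f = (\<lambda>c. jacobian_ideal f +>\<^bsub>mfps_ring\<^esub> mconst c) ` UNIV"

definition milnor_number :: "('k::field, 'n::finite) mfps \<Rightarrow> enat" where
  "milnor_number f =
     (if ring.finite_dimension (milnor_algebra f) (milnor_scalars f) (carrier (milnor_algebra f))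
      then enat (ring.dim (milnor_algebra f) (milnor_scalars f) (carrier (milnor_algebra f)))
      else \<infinity>)"

definition orthant :: "(real ^ 'n) set" where
  "orthant = {x. \<forall>i. 0 \<le> x $ i}"

definition exponent_point :: "nat ^ 'n \<Rightarrow> real ^ 'n" where
  "exponent_point \<alpha> = (\<chi> i. real (\<alpha> $ i))"

definition rational_polytope :: "(real ^ 'n) set \<Rightarrow> bool" where
  "rational_polytope F \<longleftrightarrow>
     (\<exists>V. finite V \<and> (\<forall>v\<in>V. \<forall>i. v $ i \<in> \<rat>) \<and> F = convex hull V)"

definition region_above :: "(real ^ 'n) set \<Rightarrow> (real ^ 'n) set" where
  "region_above P = {t *\<^sub>R x | t x. 1 \<le> t \<and> x \<in> P}"

definition region_below :: "(real ^ 'n) set \<Rightarrow> (real ^ 'n) set" where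
  "region_below P = {t *\<^sub>R x | t x. 0 \<le> t \<and> t < 1 \<and> x \<in> P}"

text \<open>
  $P$ itself need not be convex: ``piecewise linear of dimension $n-1$'' means a finite union of
  (convex, rational) polytopes of that dimension. The condition \<open>0 \<notin> P\<close> follows from the others
  except for $P = \{0\}$ in dimension $n = 1$.
\<close>

definition C_polytope :: "(real ^ 'n) set \<Rightarrow> bool" where
  "C_polytope P \<longleftrightarrow>
     (\<exists>\<F>. finite \<F> \<and> P = \<Union>\<F> \<and>
        (\<forall>F\<in>\<F>. rational_polytope F \<and> aff_dim F = int CARD('n) - 1)) \<and>
     P \<subseteq> orthant \<and> 0 \<notin> P \<and>
     convex (region_above P) \<and>
     (\<forall>v\<in>orthant. v \<noteq> 0 \<longrightarrow> (\<exists>!x. x \<in> P \<and> x \<in> {t *\<^sub>R v | t. 0 \<le> t}))"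

text \<open>
  The linear pieces of $P$ are the faces of the convex region above $P$ that lie in $P$,
  equivalently its compact faces.
\<close>

definition polytope_face :: "(real ^ 'n) set \<Rightarrow> (real ^ 'n) set \<Rightarrow> bool" where
  "polytope_face P \<Delta> \<longleftrightarrow> \<Delta> \<noteq> {} \<and> \<Delta> face_of region_above P \<and> \<Delta> \<subseteq> P"

definition polytope_facets :: "(real ^ 'n) set \<Rightarrow> (real ^ 'n) set set" where
  "polytope_facets P = {\<Delta>. polytope_face P \<Delta> \<and> aff_dim \<Delta> = int CARD('n) - 1}"

definition has_weight_vector :: "(real ^ 'n) set \<Rightarrow> nat ^ 'n \<Rightarrow> bool" where
  "has_weight_vector \<Delta> w \<longleftrightarrow>
     (\<exists>d>0. \<forall>x\<in>\<Delta>. (\<Sum>i\<in>UNIV. real (w $ i) * x $ i) = d)"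

definition inner_face :: "(real ^ 'n) set \<Rightarrow> (real ^ 'n) set \<Rightarrow> bool" where
  "inner_face P \<Delta> \<longleftrightarrow> polytope_face P \<Delta> \<and> (\<forall>i. \<not> \<Delta> \<subseteq> {x. x $ i = 0})"

definition in_face :: "(real ^ 'n) set \<Rightarrow> ('k::zero, 'n) mfps \<Rightarrow> ('k, 'n) mfps" where
  "in_face \<Delta> f = mrestrict {\<alpha>. exponent_point \<alpha> \<in> \<Delta>} f"

definition coord_subspace :: "'k::zero ^ 'n \<Rightarrow> (real ^ 'n) set" where
  "coord_subspace q = {x. \<forall>i. q $ i = 0 \<longrightarrow> x $ i = 0}"

definition IND :: "(real ^ 'n) set \<Rightarrow> ('k::field, 'n::finite) mfps \<Rightarrow> bool" where
  "IND \<Delta> f \<longleftrightarrow>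
     (\<forall>q. (\<forall>i. meval (mderiv i (in_face \<Delta> f)) q = 0) \<longrightarrow> \<Delta> \<inter> coord_subspace q = {})"

definition no_point_below :: "(real ^ 'n) set \<Rightarrow> ('k::zero, 'n) mfps \<Rightarrow> bool" where
  "no_point_below P f \<longleftrightarrow> (\<forall>\<alpha>\<in>msupp f. exponent_point \<alpha> \<notin> region_below P)"

definition INND :: "(real ^ 'n) set \<Rightarrow> ('k::field, 'n::finite) mfps \<Rightarrow> bool" where
  "INND P f \<longleftrightarrow> no_point_below P f \<and> (\<forall>\<Delta>. inner_face P \<Delta> \<longrightarrow> IND \<Delta> f)"

definition weighted_degree :: "nat ^ 'n \<Rightarrow> nat ^ 'n::finite \<Rightarrow> nat" where
  "weighted_degree w \<alpha> = (\<Sum>i\<in>UNIV. w $ i * \<alpha> $ i)"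

definition in_weight :: "nat ^ 'n \<Rightarrow> ('k::zero, 'n::finite) mfps \<Rightarrow> ('k, 'n) mfps" where
  "in_weight w f =
     mrestrict {\<alpha> \<in> msupp f. \<forall>\<beta>\<in>msupp f. weighted_degree w \<alpha> \<le> weighted_degree w \<beta>} f"

definition rSQH :: "nat ^ 'n \<Rightarrow> ('k::field, 'n::finite) mfps \<Rightarrow> bool" where
  "rSQH w f \<longleftrightarrow> milnor_number (in_weight w f) < \<infinity>"

text \<open>No junk value of \<open>d\<close> arises from \<open>in_weight w f = 0\<close>, since then $\mu = \infty$.\<close>

definition rSQH_of_degree :: "nat ^ 'n \<Rightarrow> nat \<Rightarrow> ('k::field, 'n::finite) mfps \<Rightarrow> bool" where
  "rSQH_of_degree w d f \<longleftrightarrow>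
     rSQH w f \<and> (\<forall>\<alpha>\<in>msupp (in_weight w f). weighted_degree w \<alpha> = d)"

end

theory Submission
  imports Defs
begin

text \<open>
  A \<open>C\<close>-polytope with a single facet is the simplex \<open>w \<cdot> x = d\<close> in the orthant. Its only inner
  face is the simplex itself, so inner non-degeneracy says that 0 is the only possible common zero
  of the partial derivatives of the principal part; for weighted homogeneous polynomials this is
  equivalent to finite codimension by the Nullstellensatz.

  For the formula, let \<open>f\<^sub>1, \<dots>, f\<^sub>n\<close> have weighted orders at least \<open>d\<^sub>1, \<dots>, d\<^sub>n\<close>. Expanding every
  series in monomials in the \<open>f\<^sub>i\<close> over a basis of the quotient and counting exponents shows that
  the codimension of \<open>(f\<^sub>1, \<dots>, f\<^sub>n)\<close>, if finite, is at least \<open>\<Prod> d\<^sub>i / w\<^sub>i\<close>. Suppose that equality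
  holds for a homogeneous system. Then each member is a nonzerodivisor modulo the others, since
  otherwise replacing it by a high power would violate the bound. If moreover \<open>p\<close> is a member and
  \<open>u\<close> is homogeneous and has finite codimension together with the other members, then
  \<open>p\<^sup>M = u r\<close> modulo these; lengths add, and the bounds for \<open>u\<close> and \<open>r\<close> must both be attained.
  So equality survives the exchange of \<open>p\<close> for \<open>u\<close>. Starting from the variables, one exchanges
  successively for generic combinations of powers of \<open>g\<^sub>1, \<dots>, g\<^sub>n\<close> of a common degree and then for
  the \<open>g\<^sub>i\<close> themselves. Hence equality holds for the derivatives of the principal part. Higher order
  terms cannot increase the codimension, and the lower bound still applies to the derivatives of
  \<open>f\<close>.
\<close>

section \<open>Coefficients and monomials\<close>

text \<open>The derivatives enter only through their weights \<open>d - w $ i\<close>, so no integer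
  has to be invertible in \<open>K\<close> and the characteristic can be arbitrary. Multiplicity is
  never defined: the codimension is squeezed between two inequalities. The lower one holds for every
  system of finite codimension, homogeneous or not, so only the upper one has to be carried through
  the exchanges. A linear combination of the \<open>g\<^sub>i\<close> is in general weighted
  homogeneous only if their degrees agree; this is why powers of a common degree come in between.
  The variables can serve as the start because their ideal has codimension 1 and their degrees are
  the weights themselves. Series cannot be evaluated away from 0, so zeros are found inside the
  subring of polynomials, after setting a weighted homogeneous element equal to 1. A derivative of
  the principal part may be a nonzero constant; then \<open>d = w $ i\<close>, both sides of the
  formula vanish, and this case is treated apart.\<close>

lemma mcoeff_ring_simps [simp]:
  "mcoeff (0 :: ('k::comm_ring_1, 'n::finite) mfps) \<alpha> = 0"
  "mcoeff (1 :: ('k, 'n) mfps) \<alpha> = (if \<alpha> = 0 then 1 else 0)"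
  "mcoeff (f + g :: ('k, 'n) mfps) \<alpha> = mcoeff f \<alpha> + mcoeff g \<alpha>"
  "mcoeff (f - g :: ('k, 'n) mfps) \<alpha> = mcoeff f \<alpha> - mcoeff g \<alpha>"
  "mcoeff (- f :: ('k, 'n) mfps) \<alpha> = - mcoeff f \<alpha>"
  by (transfer; simp)+

lemma mcoeff_mult:
  "mcoeff (f * g :: ('k::comm_ring_1, 'n::finite) mfps) \<gamma> =
     (\<Sum>(\<alpha>, \<beta>)\<in>decompositions \<gamma>. mcoeff f \<alpha> * mcoeff g \<beta>)"
  by transfer simp

lemma mcoeff_sum [simp]:
  "mcoeff (sum f A :: ('k::comm_ring_1, 'n::finite) mfps) \<alpha> = (\<Sum>x\<in>A. mcoeff (f x) \<alpha>)"
  by (induction A rule: infinite_finite_induct) auto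

lemma mcoeff_mconst [simp]: "mcoeff (mconst c) \<alpha> = (if \<alpha> = 0 then c else 0)"
  by transfer simp

lemma mcoeff_mrestrict [simp]: "mcoeff (mrestrict S f) \<alpha> = (if \<alpha> \<in> S then mcoeff f \<alpha> else 0)"
  by transfer simp

lemma mcoeff_mderiv: "mcoeff (mderiv i f) \<alpha> = of_nat (\<alpha> $ i + 1) * mcoeff f (\<alpha> + axis i 1)"
  by transfer simp

lift_definition mmonom :: "nat ^ 'n \<Rightarrow> ('k::comm_ring_1, 'n::finite) mfps"
  is "\<lambda>\<alpha> \<beta>. if \<beta> = \<alpha> then 1 else 0" .

lemma mcoeff_mmonom [simp]: "mcoeff (mmonom \<alpha>) \<beta> = (if \<beta> = \<alpha> then 1 else 0)"
  by transfer simp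

lemma mcoeff_mmonom_mult:
  fixes h :: "('k::comm_ring_1, 'n::finite) mfps"
  shows "mcoeff (mmonom \<alpha> * h) (\<alpha> + \<gamma>) = mcoeff h \<gamma>"
proof -
  have "mcoeff (mmonom \<alpha> * h) (\<alpha> + \<gamma>) = (\<Sum>(a, b)\<in>{(\<alpha>, \<gamma>)}. mcoeff (mmonom \<alpha> :: ('k, 'n) mfps) a * mcoeff h b)"
    unfolding mcoeff_mult
    by (rule sum.mono_neutral_right) (auto simp: finite_decompositions, auto simp: decompositions_def split: if_splits)
  then show ?thesis by simp
qed

lemma mcoeff_mmonom_mult_eq_0:
  fixes h :: "('k::comm_ring_1, 'n::finite) mfps"
  assumes "\<And>\<gamma>. \<beta> \<noteq> \<alpha> + \<gamma>"
  shows "mcoeff (mmonom \<alpha> * h) \<beta> = 0"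
  unfolding mcoeff_mult
  by (rule sum.neutral) (use assms in \<open>auto simp: decompositions_def\<close>)

lemma mmonom_mult: "mmonom \<alpha> * mmonom \<beta> = (mmonom (\<alpha> + \<beta>) :: ('k::comm_ring_1, 'n::finite) mfps)"
proof (rule mfps_eqI)
  fix \<gamma>
  show "mcoeff (mmonom \<alpha> * mmonom \<beta>) \<gamma> = mcoeff (mmonom (\<alpha> + \<beta>) :: ('k, 'n) mfps) \<gamma>"
  proof (cases "\<exists>\<delta>. \<gamma> = \<alpha> + \<delta>")
    case True
    then show ?thesis by (auto simp: mcoeff_mmonom_mult)
  next
    case False
    then show ?thesis by (subst mcoeff_mmonom_mult_eq_0) auto
  qed
qed

lemma mmonom_0: "mmonom 0 = (1 :: ('k::comm_ring_1, 'n::finite) mfps)"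
  by (rule mfps_eqI) simp

lemma mcoeff_mconst_mult [simp]:
  "mcoeff (mconst c * h) \<gamma> = c * mcoeff (h :: ('k::comm_ring_1, 'n::finite) mfps) \<gamma>"
proof -
  have "mcoeff (mconst c * h) \<gamma> = (\<Sum>(a, b)\<in>{(0, \<gamma>)}. mcoeff (mconst c :: ('k, 'n) mfps) a * mcoeff h b)"
    unfolding mcoeff_mult
    by (rule sum.mono_neutral_right) (auto simp: finite_decompositions, auto simp: decompositions_def split: if_splits)
  then show ?thesis by simp
qed

lemma mconst_simps [simp]:
  "mconst 0 = (0 :: ('k::comm_ring_1, 'n::finite) mfps)"
  "mconst 1 = (1 :: ('k, 'n) mfps)"
  by (rule mfps_eqI; simp)+

lemma mconst_add: "mconst (a + b) = (mconst a + mconst b :: ('k::comm_ring_1, 'n::finite) mfps)"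
  and mconst_diff: "mconst (a - b) = (mconst a - mconst b :: ('k, 'n) mfps)"
  and mconst_uminus: "mconst (- a) = (- mconst a :: ('k, 'n) mfps)"
  and mconst_mult: "mconst (a * b) = (mconst a * mconst b :: ('k, 'n) mfps)"
  by (rule mfps_eqI; simp)+

lemma mconst_sum: "mconst (sum f A) = (\<Sum>x\<in>A. mconst (f x) :: ('k::comm_ring_1, 'n::finite) mfps)"
  by (induction A rule: infinite_finite_induct) (auto simp: mconst_add)

section \<open>Finite families modulo an ideal\<close>

text \<open>Ideals are stated with the type class operations instead of those of
  \<open>mfps_ring\<close>; \<open>ideal_mfps_ring_iff\<close> connects the two when the Milnor
  number is unfolded.\<close>

definition mideal :: "('k::comm_ring_1, 'n::finite) mfps set \<Rightarrow> bool" where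
  "mideal J \<longleftrightarrow> 0 \<in> J \<and> (\<forall>a\<in>J. \<forall>b\<in>J. a + b \<in> J) \<and> (\<forall>a\<in>J. \<forall>r. r * a \<in> J)"

lemma mideal_zero: "mideal J \<Longrightarrow> 0 \<in> J"
  and mideal_add: "mideal J \<Longrightarrow> a \<in> J \<Longrightarrow> b \<in> J \<Longrightarrow> a + b \<in> J"
  and mideal_mult: "mideal J \<Longrightarrow> a \<in> J \<Longrightarrow> r * a \<in> J"
  and mideal_mult_right: "mideal J \<Longrightarrow> a \<in> J \<Longrightarrow> a * r \<in> J"
  by (auto simp: mideal_def mult.commute)

lemma mideal_uminus: "mideal J \<Longrightarrow> a \<in> J \<Longrightarrow> - a \<in> J"
  using mideal_mult[of J a "- 1"] by simp

lemma mideal_diff: "mideal J \<Longrightarrow> a \<in> J \<Longrightarrow> b \<in> J \<Longrightarrow> a - b \<in> J"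
  using mideal_add[of J a "- b"] mideal_uminus by auto

lemma mideal_sum: "mideal J \<Longrightarrow> (\<And>x. x \<in> A \<Longrightarrow> f x \<in> J) \<Longrightarrow> sum f A \<in> J"
  by (induction A rule: infinite_finite_induct) (auto intro: mideal_zero mideal_add)

definition lincomb :: "'i set \<Rightarrow> ('i \<Rightarrow> ('k::comm_ring_1, 'n::finite) mfps) \<Rightarrow> ('i \<Rightarrow> 'k) \<Rightarrow> ('k, 'n) mfps" where
  "lincomb I b c = (\<Sum>i\<in>I. mconst (c i) * b i)"

text \<open>Statements about the quotient vector space are phrased for representatives, so that no
  quotient has to be formed. Families are indexed, hence repetitions count.\<close>

definition spans :: "('k::comm_ring_1, 'n::finite) mfps set \<Rightarrow> 'i set \<Rightarrow> ('i \<Rightarrow> ('k, 'n) mfps) \<Rightarrow> bool" where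
  "spans J I b \<longleftrightarrow> (\<forall>h. \<exists>c. h - lincomb I b c \<in> J)"

definition indep :: "('k::comm_ring_1, 'n::finite) mfps set \<Rightarrow> 'i set \<Rightarrow> ('i \<Rightarrow> ('k, 'n) mfps) \<Rightarrow> bool" where
  "indep J I b \<longleftrightarrow> (\<forall>c. lincomb I b c \<in> J \<longrightarrow> (\<forall>i\<in>I. c i = 0))"

text \<open>Gaussian elimination, one equation and one unknown per induction step.\<close>

lemma homogeneous_system_nontrivial_solution:
  fixes a :: "'i \<Rightarrow> 'l \<Rightarrow> 'k::field"
  assumes "finite L" "finite I" "card L < card I"
  shows "\<exists>c. (\<exists>i\<in>I. c i \<noteq> 0) \<and> (\<forall>j\<in>L. (\<Sum>i\<in>I. c i * a i j) = 0)"
  using assms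
proof (induction L arbitrary: I a rule: finite_induct)
  case empty
  then have "I \<noteq> {}" by auto
  then show ?case by (intro exI[of _ "\<lambda>_. 1"]) auto
next
  case (insert l L)
  show ?case
  proof (cases "\<forall>i\<in>I. a i l = 0")
    case True
    have "card L < card I" using insert.prems insert.hyps by simp
    from insert.IH[OF insert.prems(1) this, of a] True show ?thesis by auto
  next
    case False
    then obtain i0 where i0: "i0 \<in> I" "a i0 l \<noteq> 0" by auto
    let ?I = "I - {i0}"
    have "card L < card ?I" using insert.prems insert.hyps i0 by simp
    from insert.IH[OF _ this, of "\<lambda>i j. a i j - a i l / a i0 l * a i0 j"] insert.prems
    obtain c where c: "\<exists>i\<in>?I. c i \<noteq> 0"
      and ceq: "\<And>j. j \<in> L \<Longrightarrow> (\<Sum>i\<in>?I. c i * (a i j - a i l / a i0 l * a i0 j)) = 0" by auto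
    \<comment> \<open>The value at the pivot \<open>i0\<close> is chosen so that equation
      \<open>l\<close> holds; the corrected coefficients passed to the induction hypothesis then
      make the other equations hold as well.\<close>
    define e where "e = (\<lambda>i. if i = i0 then - (\<Sum>i\<in>?I. c i * a i l) / a i0 l else c i)"
    have split: "(\<Sum>i\<in>I. e i * a i j) = - (\<Sum>i\<in>?I. c i * a i l) / a i0 l * a i0 j + (\<Sum>i\<in>?I. c i * a i j)" for j
    proof -
      have "(\<Sum>i\<in>I. e i * a i j) = e i0 * a i0 j + (\<Sum>i\<in>?I. e i * a i j)"
        using insert.prems i0 by (simp add: sum.remove)
      also have "(\<Sum>i\<in>?I. e i * a i j) = (\<Sum>i\<in>?I. c i * a i j)"
        by (rule sum.cong) (auto simp: e_def)
      finally show ?thesis by (simp add: e_def)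
    qed
    have "(\<Sum>i\<in>I. e i * a i j) = 0" if "j \<in> insert l L" for j
    proof (cases "j = l")
      case True
      then show ?thesis using split[of l] i0 by simp
    next
      case False
      with that have "j \<in> L" by simp
      from ceq[OF this] have "(\<Sum>i\<in>?I. c i * a i j) = (\<Sum>i\<in>?I. c i * (a i l / a i0 l * a i0 j))"
        by (simp add: right_diff_distrib sum_subtractf)
      also have "\<dots> = (\<Sum>i\<in>?I. c i * a i l) / a i0 l * a i0 j"
        by (simp add: sum_divide_distrib sum_distrib_right mult.assoc)
      finally show ?thesis using split[of j] by simp
    qed
    moreover have "\<exists>i\<in>I. e i \<noteq> 0" using c by (auto simp: e_def)
    ultimately show ?thesis by blast
  qed
qed

lemma lincomb_add: "lincomb I b (\<lambda>i. c i + d i) = lincomb I b c + lincomb I b d"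
  by (simp add: lincomb_def mconst_add distrib_right sum.distrib)

lemma lincomb_diff: "lincomb I b (\<lambda>i. c i - d i) = lincomb I b c - lincomb I b d"
  by (simp add: lincomb_def mconst_diff left_diff_distrib sum_subtractf)

lemma lincomb_scale: "lincomb I b (\<lambda>i. r * c i) = mconst r * lincomb I b c"
  by (simp add: lincomb_def mconst_mult sum_distrib_left mult.assoc)

lemma lincomb_sum: "lincomb I b (\<lambda>i. \<Sum>j\<in>A. c j i) = (\<Sum>j\<in>A. lincomb I b (c j))"
  by (simp add: lincomb_def mconst_sum sum_distrib_right sum.swap[of _ I])

lemma lincomb_zero [simp]: "lincomb I b (\<lambda>_. 0) = 0"
  by (simp add: lincomb_def)

lemma lincomb_cong: "(\<And>i. i \<in> I \<Longrightarrow> c i = d i) \<Longrightarrow> (\<And>i. i \<in> I \<Longrightarrow> b i = b' i) \<Longrightarrow> lincomb I b c = lincomb I b' d"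
  by (simp add: lincomb_def)

text \<open>Expanding each \<open>b i\<close> in the spanning family turns the search for a relation
  among the \<open>b i\<close> into \<open>card L\<close> linear equations in \<open>card I\<close>
  unknowns.\<close>

lemma indep_card_le_spans:
  fixes J :: "('k::field, 'n::finite) mfps set"
  assumes J: "mideal J" and fin: "finite L" "finite I"
    and s: "spans J L s" and b: "indep J I b"
  shows "card I \<le> card L"
proof (rule ccontr)
  assume "\<not> card I \<le> card L"
  then have lt: "card L < card I" by simp
  from s have "\<forall>i. \<exists>a. b i - lincomb L s a \<in> J" by (auto simp: spans_def)
  then obtain a where a: "\<And>i. b i - lincomb L s (a i) \<in> J" by metis
  from homogeneous_system_nontrivial_solution[OF fin lt, of a]
  obtain c where c: "\<exists>i\<in>I. c i \<noteq> 0" and c0: "\<And>j. j \<in> L \<Longrightarrow> (\<Sum>i\<in>I. c i * a i j) = 0" by auto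
  have "(\<Sum>i\<in>I. mconst (c i) * lincomb L s (a i)) = lincomb L s (\<lambda>j. \<Sum>i\<in>I. c i * a i j)"
    by (simp add: lincomb_sum lincomb_scale)
  also have "\<dots> = lincomb L s (\<lambda>_. 0)" by (rule lincomb_cong) (auto simp: c0)
  finally have "(\<Sum>i\<in>I. mconst (c i) * (b i - lincomb L s (a i))) = lincomb I b c"
    by (simp add: right_diff_distrib sum_subtractf lincomb_def)
  moreover have "(\<Sum>i\<in>I. mconst (c i) * (b i - lincomb L s (a i))) \<in> J"
    by (intro mideal_sum[OF J] mideal_mult[OF J] a)
  ultimately have "lincomb I b c \<in> J" by simp
  with b c show False by (auto simp: indep_def)
qed

lemma not_indep_spans_remove:
  fixes J :: "('k::field, 'n::finite) mfps set"
  assumes J: "mideal J" and fin: "finite I" and s: "spans J I b" and ni: "\<not> indep J I b"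
  shows "\<exists>i\<in>I. spans J (I - {i}) b"
proof -
  from ni obtain c i where c: "lincomb I b c \<in> J" and i: "i \<in> I" "c i \<noteq> 0" by (auto simp: indep_def)
  have "spans J (I - {i}) b"
    unfolding spans_def
  proof
    fix h
    from s obtain e where e: "h - lincomb I b e \<in> J" by (auto simp: spans_def)
    let ?d = "\<lambda>j. e j - e i / c i * c j"
    have 1: "lincomb I b ?d = lincomb I b e - mconst (e i / c i) * lincomb I b c"
      by (simp only: lincomb_diff lincomb_scale)
    have 2: "lincomb I b ?d = lincomb (I - {i}) b ?d"
      unfolding lincomb_def using fin i by (simp add: sum.remove)
    have "h - lincomb (I - {i}) b ?d = (h - lincomb I b e) + mconst (e i / c i) * lincomb I b c"
      unfolding trans[OF 2[symmetric] 1] by simp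
    also have "\<dots> \<in> J" by (intro mideal_add[OF J] mideal_mult[OF J] e c)
    finally show "\<exists>c. h - lincomb (I - {i}) b c \<in> J" by blast
  qed
  with i show ?thesis by blast
qed

lemma spans_obtain_basis:
  fixes J :: "('k::field, 'n::finite) mfps set"
  assumes "mideal J" "finite I" "spans J I b"
  obtains I' where "I' \<subseteq> I" "spans J I' b" "indep J I' b"
  using assms(2,3)
proof (induction "card I" arbitrary: I thesis rule: less_induct)
  case less
  show ?case
  proof (cases "indep J I b")
    case True
    then show ?thesis using less by blast
  next
    case False
    from not_indep_spans_remove[OF assms(1) less.prems(2,3) False]
    obtain i where i: "i \<in> I" "spans J (I - {i}) b" by auto
    have "card (I - {i}) < card I" using i less.prems by (meson card_Diff1_less)
    moreover have "finite (I - {i})" using less.prems by simp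
    ultimately obtain I' where "I' \<subseteq> I - {i}" "spans J I' b" "indep J I' b"
      using less.hyps[of "I - {i}"] i by metis
    then show ?thesis using less.prems(1)[of I'] by auto
  qed
qed

section \<open>Codimension of an ideal\<close>

definition finite_codim :: "('k::comm_ring_1, 'n::finite) mfps set \<Rightarrow> bool" where
  "finite_codim J \<longleftrightarrow> (\<exists>m. \<exists>b :: nat \<Rightarrow> _. spans J {..<m} b)"

text \<open>Meaningful only under \<open>finite_codim J\<close>. Being a minimum, it comes with a
  spanning family from which nothing can be removed, that is, a basis of the quotient.\<close>

definition codim :: "('k::comm_ring_1, 'n::finite) mfps set \<Rightarrow> nat" where
  "codim J = (LEAST m. \<exists>b :: nat \<Rightarrow> _. spans J {..<m} b)"

lemma lincomb_reindex:
  assumes "bij_betw g A I"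
  shows "lincomb A (b \<circ> g) (c \<circ> g) = lincomb I b c"
  unfolding lincomb_def using sum.reindex_bij_betw[OF assms, of "\<lambda>i. mconst (c i) * b i"] by simp

lemma spans_nat:
  assumes "finite I" "spans J I b"
  obtains b' :: "nat \<Rightarrow> _" where "spans J {..<card I} b'"
proof -
  obtain g where g: "bij_betw g {..<card I} I"
    using ex_bij_betw_nat_finite[OF assms(1)] by (auto simp: atLeast0LessThan)
  have "spans J {..<card I} (b \<circ> g)"
    unfolding spans_def
  proof
    fix h
    from assms(2) obtain c where "h - lincomb I b c \<in> J" by (auto simp: spans_def)
    then show "\<exists>c. h - lincomb {..<card I} (b \<circ> g) c \<in> J"
      using lincomb_reindex[OF g, of b c] by (intro exI[of _ "c \<circ> g"]) simp
  qed
  then show ?thesis by (rule that)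
qed

lemma spans_finite_codim: "finite I \<Longrightarrow> spans J I b \<Longrightarrow> finite_codim J"
  by (metis spans_nat finite_codim_def)

lemma spans_codim_le: "finite I \<Longrightarrow> spans J I b \<Longrightarrow> codim J \<le> card I"
  unfolding codim_def by (rule spans_nat[of I J b]) (auto intro!: Least_le)

lemma finite_codim_obtain_basis:
  fixes J :: "('k::field, 'n::finite) mfps set"
  assumes "finite_codim J" "mideal J"
  obtains b :: "nat \<Rightarrow> _" where "spans J {..<codim J} b" "indep J {..<codim J} b"
proof -
  from assms(1) have "\<exists>b :: nat \<Rightarrow> _. spans J {..<codim J} b"
    unfolding finite_codim_def codim_def by (rule LeastI_ex)
  then obtain b :: "nat \<Rightarrow> _" where b: "spans J {..<codim J} b" by blast
  have "indep J {..<codim J} b"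
  proof (rule ccontr)
    assume "\<not> indep J {..<codim J} b"
    from not_indep_spans_remove[OF assms(2) _ b this]
    obtain i where i: "i < codim J" "spans J ({..<codim J} - {i}) b" by auto
    then have "codim J \<le> card ({..<codim J} - {i})" by (intro spans_codim_le) auto
    with i show False by auto
  qed
  with b show ?thesis by (rule that)
qed

lemma indep_card_le_codim:
  fixes J :: "('k::field, 'n::finite) mfps set"
  assumes "mideal J" "finite_codim J" "finite I" "indep J I b"
  shows "card I \<le> codim J"
proof -
  obtain b' :: "nat \<Rightarrow> _" where b': "spans J {..<codim J} b'" using finite_codim_obtain_basis assms by metis
  from indep_card_le_spans[OF assms(1) _ assms(3) b' assms(4)] show ?thesis by simp
qed

lemma codim_eqI:
  fixes J :: "('k::field, 'n::finite) mfps set"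
  assumes "mideal J" "finite I" "spans J I b" "indep J I b"
  shows "codim J = card I"
  using assms by (meson antisym indep_card_le_codim spans_codim_le spans_finite_codim)

lemma spans_mono: "spans J I b \<Longrightarrow> J \<subseteq> K \<Longrightarrow> spans K I b"
  unfolding spans_def by blast

lemma finite_codim_mono: "finite_codim J \<Longrightarrow> J \<subseteq> K \<Longrightarrow> finite_codim K"
  unfolding finite_codim_def using spans_mono by blast

lemma codim_mono:
  fixes J :: "('k::field, 'n::finite) mfps set"
  assumes "finite_codim J" "mideal J" "J \<subseteq> K"
  shows "codim K \<le> codim J"
proof -
  obtain b :: "nat \<Rightarrow> _" where "spans J {..<codim J} b" using finite_codim_obtain_basis assms by metis
  then show ?thesis using spans_codim_le[of "{..<codim J}" K b] spans_mono assms by auto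
qed

text \<open>A basis modulo \<open>K\<close> together with \<open>u\<close> is independent modulo
  \<open>J\<close>: reduction modulo \<open>K\<close> removes the term in \<open>u\<close> and kills
  the other coefficients, and \<open>u \<notin> J\<close> then kills the coefficient of
  \<open>u\<close>.\<close>

lemma codim_strict_mono:
  fixes J :: "('k::field, 'n::finite) mfps set"
  assumes fJ: "finite_codim J" and J: "mideal J" and K: "mideal K" and "J \<subseteq> K" "u \<in> K" "u \<notin> J"
  shows "codim K < codim J"
proof -
  have fK: "finite_codim K" using fJ \<open>J \<subseteq> K\<close> by (rule finite_codim_mono)
  obtain b :: "nat \<Rightarrow> _" where b: "spans K {..<codim K} b" "indep K {..<codim K} b"
    using finite_codim_obtain_basis[OF fK K] by metis
  define b' where "b' = b(codim K := u)"
  have lc: "lincomb {..<Suc (codim K)} b' c = mconst (c (codim K)) * u + lincomb {..<codim K} b c" for c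
    unfolding lincomb_def lessThan_Suc by (simp add: b'_def)
  have "indep J {..<Suc (codim K)} b'"
    unfolding indep_def
  proof (intro allI impI)
    fix c assume c: "lincomb {..<Suc (codim K)} b' c \<in> J"
    with \<open>J \<subseteq> K\<close> have "lincomb {..<Suc (codim K)} b' c - mconst (c (codim K)) * u \<in> K"
      by (intro mideal_diff[OF K] mideal_mult[OF K] \<open>u \<in> K\<close>) auto
    then have "lincomb {..<codim K} b c \<in> K" unfolding lc by simp
    with b(2) have c0: "\<forall>i<codim K. c i = 0" by (auto simp: indep_def)
    then have "lincomb {..<codim K} b c = 0" by (simp add: lincomb_def)
    with c lc have cu: "mconst (c (codim K)) * u \<in> J" by simp
    have "c (codim K) = 0"
    proof (rule ccontr)
      assume "c (codim K) \<noteq> 0"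
      have "mconst (inverse (c (codim K))) * (mconst (c (codim K)) * u) \<in> J"
        using cu by (rule mideal_mult[OF J])
      also have "mconst (inverse (c (codim K))) * (mconst (c (codim K)) * u) = u"
        using \<open>c (codim K) \<noteq> 0\<close> by (simp add: mult.assoc[symmetric] mconst_mult[symmetric])
      finally show False using \<open>u \<notin> J\<close> by simp
    qed
    with c0 show "\<forall>i\<in>{..<Suc (codim K)}. c i = 0" by (auto simp: less_Suc_eq)
  qed
  from indep_card_le_codim[OF J fJ _ this] show ?thesis by simp
qed

section \<open>Adjoining an element\<close>

definition adjoin :: "('k::comm_ring_1, 'n::finite) mfps set \<Rightarrow> ('k, 'n) mfps \<Rightarrow> ('k, 'n) mfps set" where
  "adjoin J u = {a + r * u | a r. a \<in> J}"

lemma adjoinI: "a \<in> J \<Longrightarrow> a + r * u \<in> adjoin J u"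
  by (auto simp: adjoin_def)

lemma adjoinI': "h - r * u \<in> J \<Longrightarrow> h \<in> adjoin J u"
  using adjoinI[of "h - r * u" J r u] by simp

lemma adjoinE:
  assumes "h \<in> adjoin J u"
  obtains r where "h - r * u \<in> J"
proof -
  from assms obtain a r where "a \<in> J" "h = a + r * u" by (auto simp: adjoin_def)
  then show ?thesis by (intro that[of r]) simp
qed

lemma mideal_adjoin:
  assumes "mideal J" shows "mideal (adjoin J u)"
  unfolding mideal_def
proof (intro conjI ballI allI)
  show "0 \<in> adjoin J u" using adjoinI[of 0 J 0 u] mideal_zero[OF assms] by simp
next
  fix a b assume "a \<in> adjoin J u" "b \<in> adjoin J u"
  then obtain a' b' r s where "a' \<in> J" "b' \<in> J" "a = a' + r * u" "b = b' + s * u" by (auto simp: adjoin_def)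
  then show "a + b \<in> adjoin J u"
    using adjoinI[of "a' + b'" J "r + s" u] mideal_add[OF assms] by (simp add: algebra_simps)
next
  fix a r assume "a \<in> adjoin J u"
  then obtain a' s where "a' \<in> J" "a = a' + s * u" by (auto simp: adjoin_def)
  then show "r * a \<in> adjoin J u"
    using adjoinI[of "r * a'" J "r * s" u] mideal_mult[OF assms] by (simp add: algebra_simps)
qed

lemma subset_adjoin: "J \<subseteq> adjoin J u"
  using adjoinI[of _ J 0 u] by auto

lemma mem_adjoin: "mideal J \<Longrightarrow> u \<in> adjoin J u"
  using adjoinI[of 0 J 1 u] mideal_zero by auto

lemma adjoin_subset: "mideal K \<Longrightarrow> J \<subseteq> K \<Longrightarrow> u \<in> K \<Longrightarrow> adjoin J u \<subseteq> K"
  by (auto simp: adjoin_def intro!: mideal_add mideal_mult)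

lemma adjoin_mult_subset: "adjoin J (u * v) \<subseteq> adjoin J v"
proof -
  have "\<exists>a' r'. a + r * (u * v) = a' + r' * v \<and> a' \<in> J" if "a \<in> J" for a r
    using that by (intro exI[of _ a] exI[of _ "r * u"]) (simp add: mult.assoc)
  then show ?thesis by (auto simp: adjoin_def)
qed

lemma adjoin_cong:
  assumes "mideal J" "u - v \<in> J"
  shows "adjoin J u = adjoin J v"
proof -
  have "adjoin J u \<subseteq> adjoin J v" if "u - v \<in> J" for u v
  proof (rule adjoin_subset[OF mideal_adjoin[OF assms(1)] subset_adjoin])
    show "u \<in> adjoin J v" by (rule adjoinI'[of _ 1]) (simp add: that)
  qed
  from this[of u v] this[of v u] mideal_uminus[OF assms(1) assms(2)] assms(2) show ?thesis by auto
qed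

text \<open>Multiplication by \<open>u\<close> maps the quotient by \<open>K\<close> to the quotient
  by \<open>L\<close>, and the cokernel is a quotient of the one by \<open>J + (u)\<close>; the two
  spanning families are put side by side. \<open>K\<close> may be larger than the ideal in the plain
  product bound; this freedom later yields a strict inequality.\<close>

lemma spans_adjoin_mult_gen:
  fixes J K :: "('k::field, 'n::finite) mfps set"
  assumes J: "mideal J" and K: "\<And>k. k \<in> K \<Longrightarrow> u * k \<in> L" and L: "mideal L" "J \<subseteq> L"
    and u: "finite_codim (adjoin J u)" and fK: "finite_codim K" "mideal K"
  shows "finite_codim L" "codim L \<le> codim (adjoin J u) + codim K"
proof -
  obtain b :: "nat \<Rightarrow> _" where b: "spans (adjoin J u) {..<codim (adjoin J u)} b"
    using finite_codim_obtain_basis[OF u mideal_adjoin[OF J]] by metis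
  obtain c :: "nat \<Rightarrow> _" where c: "spans K {..<codim K} c"
    using finite_codim_obtain_basis[OF fK] by metis
  let ?I = "Inl ` {..<codim (adjoin J u)} \<union> Inr ` {..<codim K}"
  let ?b = "case_sum b (\<lambda>i. u * c i)"
  have lc: "lincomb ?I ?b (case_sum x y) = lincomb {..<codim (adjoin J u)} b x + u * lincomb {..<codim K} c y" for x y
    unfolding lincomb_def
    by (subst sum.union_disjoint) (auto simp: sum.reindex sum_distrib_left mult.left_commute)
  have sp: "spans L ?I ?b"
    unfolding spans_def
  proof
    fix h
    from b obtain x where "h - lincomb {..<codim (adjoin J u)} b x \<in> adjoin J u" by (auto simp: spans_def)
    then obtain r where r: "h - lincomb {..<codim (adjoin J u)} b x - r * u \<in> J" by (rule adjoinE)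
    from c obtain y where y: "r - lincomb {..<codim K} c y \<in> K" by (auto simp: spans_def)
    have "h - lincomb ?I ?b (case_sum x y) =
        (h - lincomb {..<codim (adjoin J u)} b x - r * u) + u * (r - lincomb {..<codim K} c y)"
      unfolding lc by (simp add: algebra_simps)
    also have "\<dots> \<in> L" using r y K L by (intro mideal_add[OF L(1)]) auto
    finally show "\<exists>c. h - lincomb ?I ?b c \<in> L" by blast
  qed
  show "finite_codim L" by (rule spans_finite_codim[OF _ sp]) simp
  have "codim L \<le> card ?I" by (rule spans_codim_le[OF _ sp]) simp
  also have "\<dots> = codim (adjoin J u) + codim K"
    by (subst card_Un_disjoint) (auto simp: card_image)
  finally show "codim L \<le> codim (adjoin J u) + codim K" .
qed

lemma codim_adjoin_mult_le:
  fixes J :: "('k::field, 'n::finite) mfps set"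
  assumes J: "mideal J" and u: "finite_codim (adjoin J u)" and v: "finite_codim (adjoin J v)"
  shows "finite_codim (adjoin J (u * v))" "codim (adjoin J (u * v)) \<le> codim (adjoin J u) + codim (adjoin J v)"
proof -
  have "u * k \<in> adjoin J (u * v)" if "k \<in> adjoin J v" for k
  proof -
    from that obtain r where "k - r * v \<in> J" by (rule adjoinE)
    then have "u * (k - r * v) \<in> J" by (rule mideal_mult[OF J])
    then show ?thesis by (intro adjoinI'[of _ r]) (simp add: algebra_simps)
  qed
  then show "finite_codim (adjoin J (u * v))" "codim (adjoin J (u * v)) \<le> codim (adjoin J u) + codim (adjoin J v)"
    using spans_adjoin_mult_gen[of J "adjoin J v" u "adjoin J (u * v)"] assms
      mideal_adjoin[OF J] subset_adjoin[of J] by auto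
qed

lemma codim_adjoin_power_le:
  fixes J :: "('k::field, 'n::finite) mfps set"
  assumes J: "mideal J" and u: "finite_codim (adjoin J u)"
  shows "finite_codim (adjoin J (u ^ m)) \<and> codim (adjoin J (u ^ m)) \<le> m * codim (adjoin J u)"
proof (induction m)
  case 0
  have "spans (adjoin J 1) ({} :: nat set) (\<lambda>_. 0)"
    unfolding spans_def lincomb_def using adjoinI[OF mideal_zero[OF J], of _ 1] by auto
  from spans_finite_codim[OF _ this] spans_codim_le[OF _ this] show ?case by simp
next
  case (Suc m)
  then show ?case using codim_adjoin_mult_le[OF J u, of "u ^ m"] by auto
qed

text \<open>When \<open>u\<close> is a nonzerodivisor modulo \<open>J\<close>, multiplication by
  \<open>u\<close> embeds the quotient by \<open>J + (v)\<close> into the quotient by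
  \<open>J + (u * v)\<close>, with cokernel the quotient by \<open>J + (u)\<close>. Hence the two
  bases stay independent when put together.\<close>

lemma codim_adjoin_mult_ge:
  fixes J :: "('k::field, 'n::finite) mfps set"
  assumes J: "mideal J" and nzd: "\<And>h. u * h \<in> J \<Longrightarrow> h \<in> J" and uv: "finite_codim (adjoin J (u * v))"
  shows "codim (adjoin J u) + codim (adjoin J v) \<le> codim (adjoin J (u * v))"
proof -
  have fu: "finite_codim (adjoin J u)" using uv adjoin_mult_subset[of J v u] by (metis finite_codim_mono mult.commute)
  have fv: "finite_codim (adjoin J v)" using uv adjoin_mult_subset[of J u v] by (metis finite_codim_mono)
  obtain b :: "nat \<Rightarrow> _" where b: "indep (adjoin J u) {..<codim (adjoin J u)} b"
    using finite_codim_obtain_basis[OF fu mideal_adjoin[OF J]] by metis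
  obtain c :: "nat \<Rightarrow> _" where c: "indep (adjoin J v) {..<codim (adjoin J v)} c"
    using finite_codim_obtain_basis[OF fv mideal_adjoin[OF J]] by metis
  let ?I = "Inl ` {..<codim (adjoin J u)} \<union> Inr ` {..<codim (adjoin J v)}"
  let ?b = "case_sum b (\<lambda>i. u * c i)"
  have lc: "lincomb ?I ?b z = lincomb {..<codim (adjoin J u)} b (z \<circ> Inl) + u * lincomb {..<codim (adjoin J v)} c (z \<circ> Inr)" for z
    unfolding lincomb_def
    by (subst sum.union_disjoint) (auto simp: sum.reindex sum_distrib_left mult.left_commute)
  have "indep (adjoin J (u * v)) ?I ?b"
    unfolding indep_def
  proof (intro allI impI)
    fix z assume z: "lincomb ?I ?b z \<in> adjoin J (u * v)"
    then obtain r where r: "lincomb ?I ?b z - r * (u * v) \<in> J" by (rule adjoinE)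
    then have "lincomb {..<codim (adjoin J u)} b (z \<circ> Inl) - (r * v - lincomb {..<codim (adjoin J v)} c (z \<circ> Inr)) * u \<in> J"
      unfolding lc by (simp add: algebra_simps)
    then have "lincomb {..<codim (adjoin J u)} b (z \<circ> Inl) \<in> adjoin J u" by (rule adjoinI')
    with b have z1: "\<forall>i<codim (adjoin J u). z (Inl i) = 0" by (auto simp: indep_def)
    then have "lincomb {..<codim (adjoin J u)} b (z \<circ> Inl) = 0" by (simp add: lincomb_def)
    with r have "u * (lincomb {..<codim (adjoin J v)} c (z \<circ> Inr) - r * v) \<in> J"
      unfolding lc by (simp add: algebra_simps)
    from nzd[OF this] have "lincomb {..<codim (adjoin J v)} c (z \<circ> Inr) \<in> adjoin J v" by (rule adjoinI')
    with c have z2: "\<forall>i<codim (adjoin J v). z (Inr i) = 0" by (auto simp: indep_def)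
    from z1 z2 show "\<forall>i\<in>?I. z i = 0" by auto
  qed
  from indep_card_le_codim[OF mideal_adjoin[OF J] uv _ this]
  have "card ?I \<le> codim (adjoin J (u * v))" by simp
  moreover have "card ?I = codim (adjoin J u) + codim (adjoin J v)"
    by (subst card_Un_disjoint) (auto simp: card_image)
  ultimately show ?thesis by simp
qed

section \<open>Weighted homogeneous ideals\<close>

definition homog :: "nat ^ 'n \<Rightarrow> nat \<Rightarrow> ('k::comm_ring_1, 'n::finite) mfps \<Rightarrow> bool" where
  "homog w k h \<longleftrightarrow> (\<forall>\<alpha>. mcoeff h \<alpha> \<noteq> 0 \<longrightarrow> weighted_degree w \<alpha> = k)"

definition ordge :: "nat ^ 'n \<Rightarrow> nat \<Rightarrow> ('k::comm_ring_1, 'n::finite) mfps \<Rightarrow> bool" where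
  "ordge w k h \<longleftrightarrow> (\<forall>\<alpha>. mcoeff h \<alpha> \<noteq> 0 \<longrightarrow> k \<le> weighted_degree w \<alpha>)"

definition hpart :: "nat ^ 'n \<Rightarrow> nat \<Rightarrow> ('k::comm_ring_1, 'n::finite) mfps \<Rightarrow> ('k, 'n) mfps" where
  "hpart w k h = mrestrict {\<alpha>. weighted_degree w \<alpha> = k} h"

text \<open>The formally infinite sum of the weight \<open>k\<close> parts of all
  \<open>c k\<close>; each coefficient involves a single \<open>k\<close>, so no convergence is at
  stake.\<close>

definition glue :: "nat ^ 'n \<Rightarrow> (nat \<Rightarrow> ('k::comm_ring_1, 'n::finite) mfps) \<Rightarrow> ('k, 'n) mfps" where
  "glue w c = Abs_mfps (\<lambda>\<alpha>. mcoeff (c (weighted_degree w \<alpha>)) \<alpha>)"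

text \<open>The backward implication in \<open>homog_ideal\<close> is closure under infinite sums of homogeneous parts.\<close>

definition homog_ideal :: "nat ^ 'n \<Rightarrow> ('k::comm_ring_1, 'n::finite) mfps set \<Rightarrow> bool" where
  "homog_ideal w J \<longleftrightarrow> mideal J \<and> (\<forall>h. h \<in> J \<longleftrightarrow> (\<forall>k. hpart w k h \<in> J))"

definition gen :: "'i set \<Rightarrow> ('i \<Rightarrow> ('k::comm_ring_1, 'n::finite) mfps) \<Rightarrow> ('k, 'n) mfps set" where
  "gen S p = range (\<lambda>a. \<Sum>i\<in>S. a i * p i)"

lemma wd_add [simp]: "weighted_degree w (\<alpha> + \<beta>) = weighted_degree w \<alpha> + weighted_degree w \<beta>"
  by (simp add: weighted_degree_def sum.distrib distrib_left)

lemma wd_0 [simp]: "weighted_degree w 0 = 0"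
  by (simp add: weighted_degree_def)

lemma wd_axis [simp]: "weighted_degree w (axis i k) = w $ i * k"
proof -
  have "weighted_degree w (axis i k) = (\<Sum>j\<in>UNIV. if j = i then w $ i * k else 0)"
    unfolding weighted_degree_def by (rule sum.cong) (auto simp: axis_def)
  then show ?thesis by simp
qed

lemma mcoeff_hpart [simp]: "mcoeff (hpart w k h) \<alpha> = (if weighted_degree w \<alpha> = k then mcoeff h \<alpha> else 0)"
  by (simp add: hpart_def)

lemma mcoeff_glue [simp]: "mcoeff (glue w c) \<alpha> = mcoeff (c (weighted_degree w \<alpha>)) \<alpha>"
  by (simp add: glue_def Abs_mfps_inverse)

lemma homogD: "homog w k h \<Longrightarrow> mcoeff h \<alpha> \<noteq> 0 \<Longrightarrow> weighted_degree w \<alpha> = k"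
  by (simp add: homog_def)

lemma homog_hpart [simp]: "homog w k (hpart w k h)"
  by (simp add: homog_def)

lemma homog_0 [simp]: "homog w k 0"
  by (simp add: homog_def)

lemma homog_1 [simp]: "homog w 0 1"
  by (simp add: homog_def)

lemma homog_mmonom [simp]: "homog w (weighted_degree w \<alpha>) (mmonom \<alpha>)"
  by (simp add: homog_def)

lemma homog_add: "homog w k f \<Longrightarrow> homog w k g \<Longrightarrow> homog w k (f + g)"
  by (auto simp: homog_def) (metis add.right_neutral)

lemma homog_sum: "(\<And>x. x \<in> A \<Longrightarrow> homog w k (f x)) \<Longrightarrow> homog w k (sum f A)"
  by (induction A rule: infinite_finite_induct) (auto intro: homog_add)

lemma homog_mconst_mult: "homog w k f \<Longrightarrow> homog w k (mconst c * f)"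
  unfolding homog_def by (metis mcoeff_mconst_mult mult_zero_right)

lemma mcoeff_mult_nonzero:
  assumes "mcoeff (f * g) \<gamma> \<noteq> 0"
  obtains \<alpha> \<beta> where "\<gamma> = \<alpha> + \<beta>" "mcoeff f \<alpha> \<noteq> 0" "mcoeff g \<beta> \<noteq> 0"
proof -
  have "\<exists>x\<in>decompositions \<gamma>. (case x of (\<alpha>, \<beta>) \<Rightarrow> mcoeff f \<alpha> * mcoeff g \<beta>) \<noteq> 0"
    using assms unfolding mcoeff_mult by (meson sum.neutral)
  then obtain \<alpha> \<beta> where "\<gamma> = \<alpha> + \<beta>" "mcoeff f \<alpha> * mcoeff g \<beta> \<noteq> 0"
    by (auto simp: decompositions_def)
  then show ?thesis by (intro that[of \<alpha> \<beta>]) auto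
qed

lemma homog_mult: "homog w k f \<Longrightarrow> homog w l g \<Longrightarrow> homog w (k + l) (f * g)"
  unfolding homog_def by (metis mcoeff_mult_nonzero wd_add)

lemma homog_power: "homog w k f \<Longrightarrow> homog w (m * k) (f ^ m)"
  by (induction m) (auto intro: homog_mult)

lemma ordge_mult: "ordge w k f \<Longrightarrow> ordge w l g \<Longrightarrow> ordge w (k + l) (f * g)"
  unfolding ordge_def by (metis mcoeff_mult_nonzero wd_add add_mono)

lemma ordge_0 [simp]: "ordge w k 0"
  by (simp add: ordge_def)

lemma ordge_zero [simp]: "ordge w 0 h"
  by (simp add: ordge_def)

lemma ordge_add: "ordge w k f \<Longrightarrow> ordge w k g \<Longrightarrow> ordge w k (f + g)"
  by (auto simp: ordge_def) (metis add.right_neutral)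

lemma ordge_sum: "(\<And>x. x \<in> A \<Longrightarrow> ordge w k (f x)) \<Longrightarrow> ordge w k (sum f A)"
  by (induction A rule: infinite_finite_induct) (auto intro: ordge_add)

lemma ordge_mono: "ordge w k f \<Longrightarrow> l \<le> k \<Longrightarrow> ordge w l f"
  by (auto simp: ordge_def)

lemma homog_imp_ordge: "homog w k h \<Longrightarrow> ordge w k h"
  by (simp add: homog_def ordge_def)

lemma mideal_ordge: "mideal {h. ordge w k h}"
  unfolding mideal_def using ordge_mult[of w 0 _ k] by (auto intro: ordge_add)

lemma hpart_add: "hpart w k (f + g) = hpart w k f + hpart w k g"
  by (rule mfps_eqI) simp

lemma hpart_diff: "hpart w k (f - g) = hpart w k f - hpart w k g"
  by (rule mfps_eqI) simp

lemma hpart_0 [simp]: "hpart w k 0 = 0"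
  by (rule mfps_eqI) simp

lemma hpart_sum: "hpart w k (sum f A) = (\<Sum>x\<in>A. hpart w k (f x))"
  by (induction A rule: infinite_finite_induct) (auto simp: hpart_add)

lemma hpart_mconst_mult: "hpart w k (mconst c * h) = mconst c * hpart w k h"
  by (rule mfps_eqI) simp

lemma hpart_homog: "homog w l h \<Longrightarrow> hpart w k h = (if k = l then h else 0)"
  by (rule mfps_eqI) (auto simp: homog_def)

lemma hpart_hpart [simp]: "hpart w k (hpart w l h) = (if k = l then hpart w l h else 0)"
  by (simp add: hpart_homog)

lemma hpart_eq_0_ordge: "ordge w l h \<Longrightarrow> k < l \<Longrightarrow> hpart w k h = 0"
  by (rule mfps_eqI) (auto simp: ordge_def)

lemma hpart_eqI: "(\<And>k. hpart w k f = hpart w k g) \<Longrightarrow> f = g"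
  by (rule mfps_eqI) (metis mcoeff_hpart)

lemma hpart_glue: "homog w k (c k) \<Longrightarrow> hpart w k (glue w c) = c k"
  by (rule mfps_eqI) (auto simp: homog_def)

text \<open>Weights are natural numbers, so the case \<open>k < e\<close>, in which
  \<open>k - e\<close> would be truncated to 0, is split off.\<close>

lemma hpart_mult_homog:
  assumes "homog w e p"
  shows "hpart w k (a * p) = (if e \<le> k then hpart w (k - e) a * p else 0)"
proof (rule mfps_eqI)
  fix \<gamma>
  have *: "(\<Sum>(\<alpha>, \<beta>)\<in>decompositions \<gamma>. mcoeff a \<alpha> * mcoeff p \<beta>) =
      (\<Sum>(\<alpha>, \<beta>)\<in>decompositions \<gamma>. mcoeff (hpart w (k - e) a) \<alpha> * mcoeff p \<beta>)"
    if "weighted_degree w \<gamma> = k"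
  proof (rule sum.cong, rule refl, clarify)
    fix \<alpha> \<beta> assume "(\<alpha>, \<beta>) \<in> decompositions \<gamma>"
    then have "\<gamma> = \<alpha> + \<beta>" by (simp add: decompositions_def)
    with that have "weighted_degree w \<alpha> = k - e" if "mcoeff p \<beta> \<noteq> 0"
      using homogD[OF assms that] by simp
    then show "mcoeff a \<alpha> * mcoeff p \<beta> = mcoeff (hpart w (k - e) a) \<alpha> * mcoeff p \<beta>"
      by (cases "mcoeff p \<beta> = 0") auto
  qed
  show "mcoeff (hpart w k (a * p)) \<gamma> = mcoeff (if e \<le> k then hpart w (k - e) a * p else 0) \<gamma>"
  proof (cases "weighted_degree w \<gamma> = k")
    case True
    show ?thesis
    proof (cases "e \<le> k")
      case True
      then show ?thesis using * \<open>weighted_degree w \<gamma> = k\<close> by (simp add: mcoeff_mult)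
    next
      case False
      have "mcoeff (a * p) \<gamma> = 0"
      proof (rule ccontr)
        assume "mcoeff (a * p) \<gamma> \<noteq> 0"
        then obtain \<alpha> \<beta> where "\<gamma> = \<alpha> + \<beta>" "mcoeff p \<beta> \<noteq> 0" by (rule mcoeff_mult_nonzero)
        with homogD[OF assms this(2)] True False show False by simp
      qed
      with False show ?thesis by simp
    qed
  next
    case False
    moreover have "mcoeff (hpart w (k - e) a * p) \<gamma> = 0" if "e \<le> k"
      using homogD[OF homog_mult[OF homog_hpart assms], of "k - e" a \<gamma>] that False by fastforce
    ultimately show ?thesis by simp
  qed
qed

lemma homog_ideal_mideal: "homog_ideal w J \<Longrightarrow> mideal J"
  by (simp add: homog_ideal_def)

lemma homog_ideal_hpart: "homog_ideal w J \<Longrightarrow> h \<in> J \<Longrightarrow> hpart w k h \<in> J"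
  unfolding homog_ideal_def by blast

lemma homog_idealI: "homog_ideal w J \<Longrightarrow> (\<And>k. hpart w k h \<in> J) \<Longrightarrow> h \<in> J"
  unfolding homog_ideal_def by blast

lemma hpart_eq_0_iff: "(\<forall>k. hpart w k h = 0) \<longleftrightarrow> h = 0"
proof
  assume *: "\<forall>k. hpart w k h = 0"
  show "h = 0"
  proof (rule hpart_eqI)
    show "hpart w k h = hpart w k 0" for k using * by simp
  qed
qed simp

lemma homog_ideal_zero: "homog_ideal w {0}"
  by (simp add: homog_ideal_def mideal_def hpart_eq_0_iff)

text \<open>Closure under infinite sums is the point: the multipliers of \<open>u\<close>, chosen
  weight by weight, assemble to one series.\<close>

lemma homog_ideal_adjoin:
  assumes J: "homog_ideal w J" and u: "homog w e u"
  shows "homog_ideal w (adjoin J u)"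
  unfolding homog_ideal_def
proof (intro conjI allI iffI)
  note J' = homog_ideal_mideal[OF J]
  show "mideal (adjoin J u)" using J' by (rule mideal_adjoin)
next
  fix h k assume "h \<in> adjoin J u"
  then obtain r where "h - r * u \<in> J" by (rule adjoinE)
  then have *: "hpart w k h - hpart w k (r * u) \<in> J" using homog_ideal_hpart[OF J, of "h - r * u" k] by (simp add: hpart_diff)
  show "hpart w k h \<in> adjoin J u"
    by (rule adjoinI'[of _ "if e \<le> k then hpart w (k - e) r else 0"])
       (use * in \<open>simp add: hpart_mult_homog[OF u] split: if_splits\<close>)
next
  fix h assume h: "\<forall>k. hpart w k h \<in> adjoin J u"
  have "\<exists>r. homog w (k - e) r \<and> hpart w k h - r * u \<in> J \<and> (k < e \<longrightarrow> r = 0)" for k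
  proof -
    from h obtain r where "hpart w k h - r * u \<in> J" by (meson adjoinE)
    from homog_ideal_hpart[OF J this, of k] have "hpart w k h - hpart w k (r * u) \<in> J"
      by (simp add: hpart_diff)
    then show ?thesis
      by (intro exI[of _ "if e \<le> k then hpart w (k - e) r else 0"]) (auto simp: hpart_mult_homog[OF u])
  qed
  then obtain r where r: "\<And>k. homog w (k - e) (r k)" "\<And>k. hpart w k h - r k * u \<in> J" "\<And>k. k < e \<Longrightarrow> r k = 0"
    by metis
  \<comment> \<open>\<open>r k\<close> takes \<open>u\<close> into weight \<open>k\<close>, so its
    own weight is \<open>k - e\<close>; the shift by \<open>e\<close> puts it at the right place in
    \<open>s\<close>.\<close>
  define s where "s = glue w (\<lambda>k. r (k + e))"
  have "hpart w k (h - s * u) \<in> J" for k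
  proof (cases "e \<le> k")
    case True
    have "hpart w (k - e) s = r k"
      using r(1)[of k] True unfolding s_def by (subst hpart_glue) auto
    then show ?thesis using True r(2)[of k] by (simp add: hpart_diff hpart_mult_homog[OF u])
  next
    case False
    then show ?thesis using r(2)[of k] r(3)[of k] by (simp add: hpart_diff hpart_mult_homog[OF u])
  qed
  then have "h - s * u \<in> J" by (rule homog_idealI[OF J])
  then show "h \<in> adjoin J u" by (rule adjoinI')
qed

section \<open>Ideals generated by finite families\<close>

lemma gen_empty [simp]: "gen {} p = {0}"
  by (simp add: gen_def)

lemma gen_insert:
  assumes "finite S" "i \<notin> S"
  shows "gen (insert i S) p = adjoin (gen S p) (p i)"
proof (intro subset_antisym subsetI)
  fix h assume "h \<in> gen (insert i S) p"
  then obtain a where "h = (\<Sum>i\<in>insert i S. a i * p i)" by (auto simp: gen_def)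
  then have "h = (\<Sum>i\<in>S. a i * p i) + a i * p i" using assms by (simp add: add.commute)
  then show "h \<in> adjoin (gen S p) (p i)" by (auto simp: gen_def adjoin_def)
next
  fix h assume "h \<in> adjoin (gen S p) (p i)"
  then obtain a r where h: "h = (\<Sum>i\<in>S. a i * p i) + r * p i" by (auto simp: gen_def adjoin_def)
  have "(\<Sum>j\<in>S. a j * p j) = (\<Sum>j\<in>S. (a(i := r)) j * p j)" by (rule sum.cong) (use assms in auto)
  then have "h = (\<Sum>j\<in>insert i S. (a(i := r)) j * p j)" unfolding h using assms by (simp add: add.commute)
  then show "h \<in> gen (insert i S) p" unfolding gen_def by blast
qed

lemma gen_cong: "(\<And>i. i \<in> S \<Longrightarrow> p i = q i) \<Longrightarrow> gen S p = gen S q"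
  by (simp add: gen_def)

lemma gen_remove:
  fixes p :: "'i::finite \<Rightarrow> _"
  shows "gen UNIV p = adjoin (gen (UNIV - {i}) p) (p i)"
  using gen_insert[of "UNIV - {i}" i p] by (simp add: insert_UNIV)

lemma gen_fun_upd:
  fixes p :: "'i::finite \<Rightarrow> _"
  shows "gen UNIV (p(i := u)) = adjoin (gen (UNIV - {i}) p) u"
  using gen_remove[of "p(i := u)" i] gen_cong[of "UNIV - {i}" "p(i := u)" p] by simp

lemma mideal_gen: "finite S \<Longrightarrow> mideal (gen S p)"
proof (induction S rule: finite_induct)
  case empty
  then show ?case by (simp add: mideal_def)
next
  case (insert i S)
  then show ?case by (simp add: gen_insert mideal_adjoin)
qed

lemma homog_ideal_gen: "finite S \<Longrightarrow> (\<And>i. i \<in> S \<Longrightarrow> homog w (d i) (p i)) \<Longrightarrow> homog_ideal w (gen S p)"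
  by (induction S rule: finite_induct) (auto simp: gen_insert homog_ideal_zero intro: homog_ideal_adjoin)

lemma gen_memI: "finite S \<Longrightarrow> i \<in> S \<Longrightarrow> p i \<in> gen S p"
  by (metis mem_adjoin gen_insert mideal_gen finite_Diff insert_Diff DiffE singletonI)

lemma gen_subset: "mideal K \<Longrightarrow> (\<And>i. i \<in> S \<Longrightarrow> p i \<in> K) \<Longrightarrow> gen S p \<subseteq> K"
  by (auto simp: gen_def intro!: mideal_sum mideal_mult)

lemma lincomb_mem_ideal: "lincomb I b c \<in> J" if "mideal J" "\<And>i. i \<in> I \<Longrightarrow> b i \<in> J"
  unfolding lincomb_def using that by (intro mideal_sum mideal_mult)

section \<open>Monomials as independent and as spanning families\<close>

lemma indep_mmonom:
  fixes J :: "('k::comm_ring_1, 'n::finite) mfps set"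
  shows "finite I \<Longrightarrow> (\<And>\<alpha> h. \<alpha> \<in> I \<Longrightarrow> h \<in> J \<Longrightarrow> mcoeff h \<alpha> = 0) \<Longrightarrow> indep J I mmonom"
  unfolding indep_def lincomb_def
proof (intro allI impI ballI)
  fix c :: "nat ^ 'n \<Rightarrow> 'k" and \<alpha> assume *: "finite I" "\<And>\<alpha> h. \<alpha> \<in> I \<Longrightarrow> h \<in> J \<Longrightarrow> mcoeff h \<alpha> = 0"
    "(\<Sum>i\<in>I. mconst (c i) * mmonom i) \<in> J" "\<alpha> \<in> I"
  have "0 = mcoeff (\<Sum>i\<in>I. mconst (c i) * mmonom i) \<alpha>" using * by metis
  also have "\<dots> = (\<Sum>i\<in>I. if \<alpha> = i then c i else 0)" by (auto intro!: sum.cong)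
  also have "\<dots> = c \<alpha>" using * by simp
  finally show "c \<alpha> = 0" by simp
qed

lemma spans_mmonom:
  fixes J :: "('k::comm_ring_1, 'n::finite) mfps set"
  assumes "finite I" and "\<And>h. (\<And>\<alpha>. \<alpha> \<in> I \<Longrightarrow> mcoeff h \<alpha> = 0) \<Longrightarrow> h \<in> J"
  shows "spans J I mmonom"
  unfolding spans_def
proof
  fix h :: "('k, 'n) mfps"
  have "mcoeff (lincomb I mmonom (mcoeff h)) \<alpha> = (if \<alpha> \<in> I then mcoeff h \<alpha> else 0)" for \<alpha>
  proof -
    have "mcoeff (lincomb I mmonom (mcoeff h)) \<alpha> = (\<Sum>i\<in>I. if \<alpha> = i then mcoeff h \<alpha> else 0)"
      by (auto simp: lincomb_def intro!: sum.cong)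
    then show ?thesis using assms(1) by simp
  qed
  then have "h - lincomb I mmonom (mcoeff h) \<in> J" by (intro assms(2)) simp
  then show "\<exists>c. h - lincomb I mmonom c \<in> J" by blast
qed

locale pos_weights =
  fixes w :: "nat ^ 'n::finite"
  assumes w_pos: "0 < w $ i"
begin

lemma wd_ge: "w $ i * \<alpha> $ i \<le> weighted_degree w \<alpha>"
  unfolding weighted_degree_def by (rule member_le_sum) auto

lemma wd_ge': "\<alpha> $ i \<le> weighted_degree w \<alpha>"
  using wd_ge[of i \<alpha>] w_pos[of i] by (metis le_trans mult_le_mono1 nat_mult_1 Suc_leI One_nat_def)

lemma wd_eq_0_iff [simp]: "weighted_degree w \<alpha> = 0 \<longleftrightarrow> \<alpha> = 0"
proof
  assume "weighted_degree w \<alpha> = 0"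
  then have "\<alpha> $ i = 0" for i using wd_ge'[of \<alpha> i] by simp
  then show "\<alpha> = 0" by (simp add: vec_eq_iff)
qed simp

lemma finite_bounded_exponents: "finite {\<alpha> :: nat ^ 'n. \<forall>i. \<alpha> $ i \<le> b i}"
proof -
  have "{\<alpha> :: nat ^ 'n. \<forall>i. \<alpha> $ i \<le> b i} \<subseteq> vec_lambda ` (PiE UNIV (\<lambda>i. {..b i}))"
  proof
    fix \<alpha> :: "nat ^ 'n" assume "\<alpha> \<in> {\<alpha>. \<forall>i. \<alpha> $ i \<le> b i}"
    then show "\<alpha> \<in> vec_lambda ` (PiE UNIV (\<lambda>i. {..b i}))"
      by (intro image_eqI[where x = "vec_nth \<alpha>"]) (auto simp: PiE_def)
  qed
  moreover have "finite (vec_lambda ` (PiE (UNIV :: 'n set) (\<lambda>i. {..b i})))"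
    by (intro finite_imageI finite_PiE) auto
  ultimately show ?thesis by (rule finite_subset)
qed

lemma finite_wd_le: "finite {\<alpha>. weighted_degree w \<alpha> \<le> k}"
  by (rule finite_subset[OF _ finite_bounded_exponents[of "\<lambda>_. k"]]) (use wd_ge' le_trans in blast)

lemma finite_wd_less: "finite {\<alpha>. weighted_degree w \<alpha> < k}"
  by (rule finite_subset[OF _ finite_wd_le[of k]]) auto

text \<open>Homogeneous elements outside \<open>J\<close> of pairwise different weights are
  independent modulo \<open>J\<close>, so finite codimension allows only finitely many such
  weights.\<close>

lemma homog_ideal_finite_codim_iff:
  fixes J :: "('k::field, 'n) mfps set"
  assumes J: "homog_ideal w J"
  shows "finite_codim J \<longleftrightarrow> (\<exists>N. \<forall>h. ordge w N h \<longrightarrow> h \<in> J)"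
proof
  assume "\<exists>N. \<forall>h. ordge w N h \<longrightarrow> h \<in> J"
  then obtain N where N: "\<And>h. ordge w N h \<Longrightarrow> h \<in> J" by blast
  have "spans J {\<alpha>. weighted_degree w \<alpha> < N} mmonom"
    by (rule spans_mmonom[OF finite_wd_less], rule N) (use not_le in \<open>auto simp: ordge_def\<close>)
  then show "finite_codim J" using finite_wd_less by (rule spans_finite_codim[rotated])
next
  assume fJ: "finite_codim J"
  define K where "K = {k. \<exists>h. homog w k h \<and> h \<notin> J}"
  define h where "h k = (SOME h. homog w k h \<and> h \<notin> J)" for k
  have h': "homog w k (h k) \<and> h k \<notin> J" if "k \<in> K" for k
    using that unfolding h_def K_def mem_Collect_eq by (rule someI_ex)
  then have h: "\<And>k. k \<in> K \<Longrightarrow> homog w k (h k)" "\<And>k. k \<in> K \<Longrightarrow> h k \<notin> J"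
    using h' by simp_all
  have indep: "indep J A h" if "A \<subseteq> K" "finite A" for A
    unfolding indep_def
  proof (intro allI impI ballI)
    fix c k assume c: "lincomb A h c \<in> J" and k: "k \<in> A"
    have "hpart w k (lincomb A h c) = (\<Sum>j\<in>A. if k = j then mconst (c j) * h j else 0)"
      unfolding lincomb_def hpart_sum
    proof (rule sum.cong)
      fix j assume "j \<in> A"
      with that have "hpart w k (h j) = (if k = j then h j else 0)" by (intro hpart_homog h(1)) auto
      then show "hpart w k (mconst (c j) * h j) = (if k = j then mconst (c j) * h j else 0)"
        by (simp add: hpart_mconst_mult)
    qed simp
    also have "\<dots> = mconst (c k) * h k" using that k by simp
    finally have ck: "mconst (c k) * h k \<in> J" using homog_ideal_hpart[OF J c, of k] by simp
    show "c k = 0"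
    proof (rule ccontr)
      assume "c k \<noteq> 0"
      have "mconst (inverse (c k)) * (mconst (c k) * h k) \<in> J"
        using ck by (rule mideal_mult[OF homog_ideal_mideal[OF J]])
      also have "mconst (inverse (c k)) * (mconst (c k) * h k) = h k"
        using \<open>c k \<noteq> 0\<close> by (simp add: mult.assoc[symmetric] mconst_mult[symmetric])
      finally show False using h(2) that k by auto
    qed
  qed
  have "finite K"
  proof (rule ccontr)
    assume "infinite K"
    then obtain A where A: "A \<subseteq> K" "finite A" "card A = Suc (codim J)"
      using infinite_arbitrarily_large by metis
    have "card A \<le> codim J" by (rule indep_card_le_codim[OF homog_ideal_mideal[OF J] fJ A(2) indep[OF A(1,2)]])
    with A show False by simp
  qed
  then obtain N where N: "\<And>k. k \<in> K \<Longrightarrow> k < N" by (meson finite_nat_set_iff_bounded)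
  have "h \<in> J" if "ordge w N h" for h
  proof (rule homog_idealI[OF J])
    fix k
    show "hpart w k h \<in> J"
    proof (cases "k < N")
      case True
      then show ?thesis using that by (simp add: hpart_eq_0_ordge mideal_zero[OF homog_ideal_mideal[OF J]])
    next
      case False
      then have "k \<notin> K" using N by blast
      then show ?thesis unfolding K_def using homog_hpart[of w k h] by blast
    qed
  qed
  then show "\<exists>N. \<forall>h. ordge w N h \<longrightarrow> h \<in> J" by blast
qed

end

section \<open>Lower bound for the codimension\<close>

definition lspan :: "'i set \<Rightarrow> ('i \<Rightarrow> ('k::comm_ring_1, 'n::finite) mfps) \<Rightarrow> ('k, 'n) mfps set" where
  "lspan I b = range (lincomb I b)"

lemma lspan_zero: "0 \<in> lspan I b"
  unfolding lspan_def using lincomb_zero by (metis rangeI)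

lemma lspan_add: "x \<in> lspan I b \<Longrightarrow> y \<in> lspan I b \<Longrightarrow> x + y \<in> lspan I b"
  by (auto simp: lspan_def lincomb_add[symmetric])

lemma lspan_sum: "(\<And>x. x \<in> A \<Longrightarrow> f x \<in> lspan I b) \<Longrightarrow> sum f A \<in> lspan I b"
  by (induction A rule: infinite_finite_induct) (auto intro: lspan_zero lspan_add)

lemma lspan_base:
  assumes "finite I" "i \<in> I"
  shows "mconst c * b i \<in> lspan I b"
proof -
  have "lincomb I b (\<lambda>j. if j = i then c else 0) = (\<Sum>j\<in>I. if j = i then mconst c * b i else 0)"
    unfolding lincomb_def by (rule sum.cong) auto
  also have "\<dots> = mconst c * b i" using assms by simp
  finally show ?thesis unfolding lspan_def by (metis rangeI)
qed

text \<open>After taking \<open>n\<close>-th roots this is the decay of \<open>j * r ^ j\<close> for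
  \<open>r < 1\<close>.\<close>

lemma linear_power_less_exponential:
  fixes q :: real
  assumes "q > 1" "n > 0"
  shows "\<exists>j :: nat. real (j * c + 1) ^ n < q ^ j"
proof -
  define r where "r = 1 / root n q"
  have root: "root n q > 1" using assms by simp
  then have r: "0 < r" "r < 1" by (auto simp: r_def)
  have "(\<lambda>j. real c * (real j * r ^ j) + r ^ j) \<longlonglongrightarrow> real c * 0 + 0"
    using r by (intro tendsto_intros powser_times_n_limit_0 LIMSEQ_power_zero) auto
  then have "eventually (\<lambda>j. real c * (real j * r ^ j) + r ^ j < 1) sequentially"
    by (rule order_tendstoD(2)) simp
  then obtain j where j: "real c * (real j * r ^ j) + r ^ j < 1" by (auto simp: eventually_sequentially)
  have "real (j * c + 1) * r ^ j < 1" using j by (simp add: algebra_simps)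
  then have "real (j * c + 1) < root n q ^ j"
    using root by (simp add: r_def power_divide field_simps)
  then have "real (j * c + 1) ^ n < (root n q ^ j) ^ n"
    using assms(2) by (intro power_strict_mono) auto
  also have "\<dots> = (root n q ^ n) ^ j" by (simp add: power_mult[symmetric] mult.commute)
  also have "root n q ^ n = q" using assms by simp
  finally show ?thesis by blast
qed

section \<open>Counting exponents of bounded weight\<close>

context pos_weights
begin

text \<open>This is the codimension of the ideal of series of weighted order greater than
  \<open>k\<close>.\<close>

definition nwd :: "nat \<Rightarrow> nat" where
  "nwd k = card {\<alpha>. weighted_degree w \<alpha> \<le> k}"

end

text \<open>The weights of the ordinary total degree, the common scale on which the counts for
  \<open>w\<close> and for the degrees \<open>d\<close> are compared.\<close>

definition one_weights :: "nat ^ 'n" where "one_weights = (\<chi> i. 1)"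

lemma pos_weights_one: "pos_weights one_weights"
  by (simp add: pos_weights_def one_weights_def)

lemma wd_one: "weighted_degree one_weights \<alpha> = (\<Sum>i\<in>UNIV. \<alpha> $ i)"
  by (simp add: weighted_degree_def one_weights_def)

context pos_weights
begin

abbreviation wprod :: nat where "wprod \<equiv> (\<Prod>i\<in>UNIV. w $ i)"

lemma card_residues: "card (PiE (UNIV :: 'n set) (\<lambda>i. {..<w $ i})) = wprod"
  by (simp add: card_PiE)

text \<open>Componentwise division with remainder by the weights: the weight of the quotient is at
  most the total degree, and there are \<open>wprod\<close> possible residues.\<close>

lemma nwd_lower: "pos_weights.nwd (one_weights :: nat ^ 'n) k \<le> wprod * nwd k"
proof -
  let ?A = "{\<gamma> :: nat ^ 'n. weighted_degree one_weights \<gamma> \<le> k}"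
  let ?B = "{\<alpha>. weighted_degree w \<alpha> \<le> k} \<times> PiE (UNIV :: 'n set) (\<lambda>i. {..<w $ i})"
  let ?g = "\<lambda>\<gamma> :: nat ^ 'n. ((\<chi> i. \<gamma> $ i div w $ i) :: nat ^ 'n, \<lambda>i. \<gamma> $ i mod w $ i)"
  have "inj_on ?g ?A"
  proof (rule inj_onI)
    fix x y assume "?g x = ?g y"
    then have "x $ i div w $ i = y $ i div w $ i \<and> x $ i mod w $ i = y $ i mod w $ i" for i
      by (auto simp: vec_eq_iff fun_eq_iff)
    then have "x $ i = y $ i" for i by (metis div_mult_mod_eq)
    then show "x = y" by (simp add: vec_eq_iff)
  qed
  moreover have "?g ` ?A \<subseteq> ?B"
  proof
    fix z assume "z \<in> ?g ` ?A"
    then obtain \<gamma> where \<gamma>: "z = ?g \<gamma>" "(\<Sum>i\<in>UNIV. \<gamma> $ i) \<le> k" by (auto simp: wd_one)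
    have "weighted_degree w (\<chi> i. \<gamma> $ i div w $ i) \<le> (\<Sum>i\<in>UNIV. \<gamma> $ i)"
      unfolding weighted_degree_def by (rule sum_mono) (simp add: mult.commute[of "w $ _"])
    with \<gamma> w_pos show "z \<in> ?B" by auto
  qed
  ultimately have "card ?A \<le> card ?B"
    by (intro card_inj_on_le[of ?g]) (auto simp: finite_wd_le intro!: finite_PiE)
  then show ?thesis
    unfolding nwd_def pos_weights.nwd_def[OF pos_weights_one]
    by (simp add: card_cartesian_product card_residues mult.commute)
qed

text \<open>The converse assignment, from quotients and residues to exponents. The residues add at
  most the sum of the weights to the total degree, a fixed shift that \<open>nwd_ratio\<close>
  absorbs.\<close>

lemma nwd_upper: "wprod * nwd k \<le> pos_weights.nwd (one_weights :: nat ^ 'n) (k + (\<Sum>i\<in>UNIV. w $ i))"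
proof -
  let ?A = "{\<gamma> :: nat ^ 'n. weighted_degree one_weights \<gamma> \<le> k + (\<Sum>i\<in>UNIV. w $ i)}"
  let ?B = "{\<alpha>. weighted_degree w \<alpha> \<le> k} \<times> PiE (UNIV :: 'n set) (\<lambda>i. {..<w $ i})"
  let ?g = "\<lambda>(\<alpha>, r). (\<chi> i. w $ i * \<alpha> $ i + r i) :: nat ^ 'n"
  have "inj_on ?g ?B"
  proof (rule inj_onI, clarify)
    fix \<alpha> \<beta> :: "nat ^ 'n" and r s
    assume rs: "r \<in> PiE UNIV (\<lambda>i. {..<w $ i})" "s \<in> PiE UNIV (\<lambda>i. {..<w $ i})"
      and eq: "(\<chi> i. w $ i * \<alpha> $ i + r i) = ((\<chi> i. w $ i * \<beta> $ i + s i) :: nat ^ 'n)"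
    have "\<alpha> $ i = \<beta> $ i \<and> r i = s i" for i
    proof -
      have e: "w $ i * \<alpha> $ i + r i = w $ i * \<beta> $ i + s i" using eq by (simp add: vec_eq_iff)
      have l: "r i < w $ i" "s i < w $ i" using rs by (auto simp: PiE_iff)
      from e l have "(w $ i * \<alpha> $ i + r i) div w $ i = (w $ i * \<beta> $ i + s i) div w $ i" by simp
      with l have "\<alpha> $ i = \<beta> $ i" by simp
      with e show ?thesis by simp
    qed
    then show "\<alpha> = \<beta> \<and> r = s" by (auto simp: vec_eq_iff fun_eq_iff)
  qed
  moreover have "?g ` ?B \<subseteq> ?A"
  proof safe
    fix \<alpha> :: "nat ^ 'n" and r
    assume "r \<in> PiE UNIV (\<lambda>i. {..<w $ i})" and \<alpha>: "weighted_degree w \<alpha> \<le> k"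
    then have "r i \<le> w $ i" for i by (auto simp: PiE_iff less_imp_le)
    then have "(\<Sum>i\<in>UNIV. r i) \<le> (\<Sum>i\<in>UNIV. w $ i)" by (intro sum_mono) auto
    with \<alpha> show "weighted_degree one_weights (\<chi> i. w $ i * \<alpha> $ i + r i) \<le> k + (\<Sum>i\<in>UNIV. w $ i)"
      unfolding wd_one by (simp add: sum.distrib weighted_degree_def)
  qed
  ultimately have "card ?B \<le> card ?A"
    by (intro card_inj_on_le[of ?g]) (auto simp: pos_weights.finite_wd_le[OF pos_weights_one])
  then show ?thesis
    unfolding nwd_def pos_weights.nwd_def[OF pos_weights_one]
    by (simp add: card_cartesian_product card_residues mult.commute)
qed

lemma nwd_le_power: "nwd k \<le> (k + 1) ^ CARD('n)"
proof -
  have "nwd k \<le> card (PiE (UNIV :: 'n set) (\<lambda>_. {..k}))"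
    unfolding nwd_def
  proof (rule card_inj_on_le[of vec_nth])
    show "inj_on vec_nth {\<alpha>. weighted_degree w \<alpha> \<le> k}" by (auto intro!: inj_onI simp: vec_nth_inject)
    show "vec_nth ` {\<alpha>. weighted_degree w \<alpha> \<le> k} \<subseteq> PiE UNIV (\<lambda>_. {..k})"
      using wd_ge' le_trans by (fastforce simp: PiE_def)
    show "finite (PiE (UNIV :: 'n set) (\<lambda>_. {..k}))" by (intro finite_PiE) auto
  qed
  also have "\<dots> = (k + 1) ^ CARD('n)" by (simp add: card_PiE)
  finally show ?thesis .
qed

lemma nwd_pos: "nwd k > 0"
proof -
  have "0 \<in> {\<alpha>. weighted_degree w \<alpha> \<le> k}" by simp
  then show ?thesis unfolding nwd_def using finite_wd_le[of k] by (metis card_gt_0_iff empty_iff)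
qed

end

text \<open>\<open>M < D\<close> would make the number of exponents of bounded weight grow exponentially.\<close>

lemma nwd_ratio:
  fixes M D c :: nat
  assumes "\<And>k. D * pos_weights.nwd (one_weights :: nat ^ 'n::finite) k
              \<le> M * pos_weights.nwd (one_weights :: nat ^ 'n) (k + c)"
  shows "D \<le> M"
proof (rule ccontr)
  assume "\<not> D \<le> M"
  then have "M < D" by simp
  interpret pos_weights "one_weights :: nat ^ 'n" by (rule pos_weights_one)
  have M: "M > 0"
    using assms[of 0] \<open>M < D\<close> nwd_pos[of 0] by (cases "M = 0") auto
  \<comment> \<open>Iterating the hypothesis \<open>j\<close> times moves the argument only to
    \<open>j * c\<close>, where the count is bounded by a polynomial in \<open>j\<close>.\<close>
  have it: "D ^ j * nwd 0 \<le> M ^ j * nwd (j * c)" for j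
  proof (induction j)
    case (Suc j)
    have "D ^ Suc j * nwd 0 = D * (D ^ j * nwd 0)" by simp
    also have "\<dots> \<le> D * (M ^ j * nwd (j * c))" using Suc by simp
    also have "\<dots> = M ^ j * (D * nwd (j * c))" by simp
    also have "\<dots> \<le> M ^ j * (M * nwd (j * c + c))" using assms[of "j * c"] by simp
    finally show ?case by (simp add: algebra_simps)
  qed simp
  obtain j where j: "real (j * c + 1) ^ CARD('n) < (real D / real M) ^ j"
    using linear_power_less_exponential[of "real D / real M" "CARD('n)" c] M \<open>M < D\<close> by auto
  have "D ^ j \<le> D ^ j * nwd 0" using nwd_pos[of 0] by simp
  also have "\<dots> \<le> M ^ j * nwd (j * c)" by (rule it)
  also have "\<dots> \<le> M ^ j * (j * c + 1) ^ CARD('n)" using nwd_le_power[of "j * c"] by simp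
  finally have "real (D ^ j) \<le> real (M ^ j * (j * c + 1) ^ CARD('n))" by (rule of_nat_mono)
  then have "real D ^ j \<le> real M ^ j * real (j * c + 1) ^ CARD('n)" by simp
  with j M show False by (simp add: power_divide field_simps)
qed

context pos_weights
begin

text \<open>
  Modulo series of weighted order greater than \<open>k\<close>, everything is a combination of products of
  the spanning family and the monomials in the \<open>f i\<close> of weight at most \<open>k\<close>; both sides
  grow like multiples of \<open>k ^ n\<close>.
\<close>

lemma codim_lower_bound:
  fixes f :: "'n \<Rightarrow> ('k::field, 'n) mfps"
  assumes f: "\<And>i. ordge w (d i) (f i)" and fc: "finite_codim (gen UNIV f)"
  shows "(\<Prod>i\<in>UNIV. d i) \<le> codim (gen UNIV f) * wprod"
proof (cases "\<forall>i. d i > 0")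
  case False
  then have 0: "(\<Prod>i\<in>UNIV. d i) = 0" by (intro prod_zero) auto
  show ?thesis unfolding 0 by simp
next
  case True
  \<comment> \<open>The \<open>d i\<close> become weights for the exponents of monomials in
    \<open>f\<close>, since \<open>P \<beta>\<close> has weighted order at least
    \<open>weighted_degree dv \<beta>\<close>.\<close>
  define dv where "dv = (\<chi> i. d i)"
  interpret D: pos_weights dv using True by unfold_locales (simp add: dv_def)
  let ?m = "codim (gen UNIV f)"
  obtain b :: "nat \<Rightarrow> _" where b: "spans (gen UNIV f) {..<?m} b"
    using finite_codim_obtain_basis[OF fc mideal_gen] by auto
  define P where "P \<beta> = (\<Prod>i\<in>UNIV. f i ^ \<beta> $ i)" for \<beta> :: "nat ^ 'n"
  have P_axis: "P (\<beta> + axis i 1) = f i * P \<beta>" for \<beta> i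
  proof -
    have "P (\<beta> + axis i 1) = (\<Prod>j\<in>UNIV. f j ^ \<beta> $ j * (if j = i then f i else 1))"
      unfolding P_def by (rule prod.cong) (auto simp: axis_def power_add)
    then show ?thesis by (simp add: prod.distrib P_def mult.commute)
  qed
  define I where "I k = {..<?m} \<times> {\<beta>. weighted_degree dv \<beta> \<le> k}" for k
  define B where "B = (\<lambda>(j, \<beta>). b j * P \<beta>)"
  have finI: "finite (I k)" for k unfolding I_def by (intro finite_cartesian_product D.finite_wd_le) auto
  \<comment> \<open>The multipliers \<open>a i\<close> have to be expanded only up to weight
    \<open>k - d i\<close>, because multiplication by \<open>f i\<close> raises the order by
    \<open>d i > 0\<close>; so the induction hypothesis applies to them.\<close>
  have main: "\<exists>s\<in>lspan (I k) B. ordge w (Suc k) (h - s)" for h k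
  proof (induction k arbitrary: h rule: less_induct)
    case (less k)
    from b obtain c where "h - lincomb {..<?m} b c \<in> gen UNIV f" by (auto simp: spans_def)
    then obtain a where a: "h - lincomb {..<?m} b c = (\<Sum>i\<in>UNIV. a i * f i)" by (auto simp: gen_def)
    have lb: "lincomb {..<?m} b c \<in> lspan (I k) B"
      unfolding lincomb_def
    proof (rule lspan_sum)
      fix j assume "j \<in> {..<?m}"
      then have "(j, 0) \<in> I k" by (auto simp: I_def)
      from lspan_base[OF finI this, of "c j" B] show "mconst (c j) * b j \<in> lspan (I k) B"
        by (simp add: B_def P_def)
    qed
    have "\<exists>s\<in>lspan (I k) B. ordge w (Suc k) (a i * f i - s)" for i
    proof (cases "d i \<le> k")
      case False
      then have "ordge w (Suc k) (a i * f i)"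
        using ordge_mult[OF ordge_zero[of w "a i"] f[of i]] by (auto intro: ordge_mono)
      then show ?thesis using lspan_zero by (intro bexI[of _ 0]) auto
    next
      case le: True
      have "k - d i < k" using True le by (meson diff_less le_trans less_le_trans)
      from less[OF this, of "a i"] obtain s where s: "s \<in> lspan (I (k - d i)) B"
        and o: "ordge w (Suc (k - d i)) (a i - s)" by blast
      from s obtain e where e: "s = lincomb (I (k - d i)) B e" by (auto simp: lspan_def)
      have "s * f i = (\<Sum>x\<in>I (k - d i). mconst (e x) * B (fst x, snd x + axis i 1))"
        unfolding e lincomb_def sum_distrib_right
        by (rule sum.cong) (auto simp: B_def P_axis[unfolded One_nat_def] mult_ac)
      also have "\<dots> \<in> lspan (I k) B"
      proof (rule lspan_sum, rule lspan_base[OF finI])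
        fix x assume "x \<in> I (k - d i)"
        then show "(fst x, snd x + axis i 1) \<in> I k" using le by (auto simp: I_def dv_def)
      qed
      finally have "s * f i \<in> lspan (I k) B" .
      moreover have "ordge w (Suc k) (a i * f i - s * f i)"
        using ordge_mult[OF o f[of i]] le by (simp add: left_diff_distrib)
      ultimately show ?thesis by blast
    qed
    then obtain s where s: "\<And>i. s i \<in> lspan (I k) B" "\<And>i. ordge w (Suc k) (a i * f i - s i)" by metis
    have "h - (lincomb {..<?m} b c + (\<Sum>i\<in>UNIV. s i)) = (\<Sum>i\<in>UNIV. a i * f i - s i)"
      using a by (simp add: sum_subtractf algebra_simps)
    moreover have "ordge w (Suc k) (\<Sum>i\<in>UNIV. a i * f i - s i)" by (intro ordge_sum s)
    moreover have "lincomb {..<?m} b c + (\<Sum>i\<in>UNIV. s i) \<in> lspan (I k) B" by (intro lspan_add lspan_sum s lb)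
    ultimately show ?case by metis
  qed
  have count: "nwd k \<le> ?m * D.nwd k" for k
  proof -
    have "spans {h. ordge w (Suc k) h} (I k) B"
      unfolding spans_def
    proof
      fix h
      from main[of k h] obtain c where "ordge w (Suc k) (h - lincomb (I k) B c)" by (auto simp: lspan_def)
      then show "\<exists>c. h - lincomb (I k) B c \<in> {h. ordge w (Suc k) h}" by auto
    qed
    moreover have "indep {h :: ('k, 'n) mfps. ordge w (Suc k) h} {\<alpha>. weighted_degree w \<alpha> \<le> k} mmonom"
      by (rule indep_mmonom[OF finite_wd_le]) (auto simp: ordge_def)
    ultimately have "card {\<alpha>. weighted_degree w \<alpha> \<le> k} \<le> card (I k)"
      by (intro indep_card_le_spans[OF mideal_ordge finI finite_wd_le])
    then show ?thesis by (simp add: nwd_def D.nwd_def I_def card_cartesian_product)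
  qed
  \<comment> \<open>Both counts are converted to total degree: \<open>wprod\<close> comes from the
    weights \<open>w\<close>, the product of the \<open>d i\<close> from the weights
    \<open>dv\<close>.\<close>
  have "(\<Prod>i\<in>UNIV. d i) * pos_weights.nwd (one_weights :: nat ^ 'n) k
      \<le> (codim (gen UNIV f) * wprod) * pos_weights.nwd (one_weights :: nat ^ 'n) (k + (\<Sum>i\<in>UNIV. d i))" for k
  proof -
    have "(\<Prod>i\<in>UNIV. d i) * pos_weights.nwd (one_weights :: nat ^ 'n) k \<le> (\<Prod>i\<in>UNIV. d i) * (wprod * nwd k)"
      using nwd_lower by simp
    also have "\<dots> \<le> (\<Prod>i\<in>UNIV. d i) * (wprod * (?m * D.nwd k))" using count[of k] by simp
    also have "\<dots> = (?m * wprod) * ((\<Prod>i\<in>UNIV. d i) * D.nwd k)" by simp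
    also have "\<dots> \<le> (?m * wprod) * pos_weights.nwd (one_weights :: nat ^ 'n) (k + (\<Sum>i\<in>UNIV. d i))"
      using D.nwd_upper[of k] by (intro mult_le_mono2) (simp add: dv_def)
    finally show ?thesis .
  qed
  then show ?thesis by (rule nwd_ratio)
qed

end

section \<open>Systems of minimal codimension\<close>

lemma prod_fun_upd:
  fixes d :: "'i::finite \<Rightarrow> 'b::comm_monoid_mult"
  shows "(\<Prod>j\<in>UNIV. (d(i := e)) j) = e * (\<Prod>j\<in>UNIV - {i}. d j)"
proof -
  have "(\<Prod>j\<in>UNIV. (d(i := e)) j) = (d(i := e)) i * (\<Prod>j\<in>UNIV - {i}. (d(i := e)) j)"
    by (rule prod.remove) auto
  also have "(\<Prod>j\<in>UNIV - {i}. (d(i := e)) j) = (\<Prod>j\<in>UNIV - {i}. d j)" by (rule prod.cong) auto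
  finally show ?thesis by simp
qed

context pos_weights
begin

text \<open>By \<open>codim_lower_bound\<close>, the last inequality is an equality.\<close>

definition min_codim :: "('n \<Rightarrow> ('k::field, 'n) mfps) \<Rightarrow> ('n \<Rightarrow> nat) \<Rightarrow> bool" where
  "min_codim p d \<longleftrightarrow> (\<forall>i. homog w (d i) (p i)) \<and> (\<forall>i. 0 < d i) \<and> finite_codim (gen UNIV p) \<and>
     codim (gen UNIV p) * wprod \<le> (\<Prod>i\<in>UNIV. d i)"

lemma wprod_pos: "wprod > 0"
  using w_pos by (intro prod_pos) auto

lemma codim_lower_bound_upd:
  fixes p :: "'n \<Rightarrow> ('k::field, 'n) mfps"
  assumes "\<And>i. homog w (d i) (p i)" "homog w e u" "finite_codim (adjoin (gen (UNIV - {i}) p) u)"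
  shows "e * (\<Prod>j\<in>UNIV - {i}. d j) \<le> codim (adjoin (gen (UNIV - {i}) p) u) * wprod"
proof -
  have "ordge w ((d(i := e)) j) ((p(i := u)) j)" for j
    using assms(1,2) by (auto intro: homog_imp_ordge)
  from codim_lower_bound[of "d(i := e)" "p(i := u)", OF this] assms(3) show ?thesis unfolding gen_fun_upd prod_fun_upd by blast
qed

text \<open>
  If \<open>p i\<close> were a zerodivisor modulo the other elements, the codimension would drop below
  the lower bound after replacing \<open>p i\<close> by a high power.
\<close>

lemma min_codim_nonzerodivisor:
  fixes p :: "'n \<Rightarrow> ('k::field, 'n) mfps"
  assumes min_codim: "min_codim p d" and v: "p i * v \<in> gen (UNIV - {i}) p"
  shows "v \<in> gen (UNIV - {i}) p"
proof (rule ccontr)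
  define J where "J = gen (UNIV - {i}) p"
  define e where "e = d i"
  define q where "q = p i"
  have hp: "\<And>j. homog w (d j) (p j)" and e: "e > 0" and q: "homog w e q"
    and fc: "finite_codim (adjoin J q)" and c: "codim (adjoin J q) * wprod \<le> e * (\<Prod>j\<in>UNIV - {i}. d j)"
    using min_codim gen_remove[of p i] prod.remove[of UNIV i d]
    by (auto simp: min_codim_def J_def e_def q_def)
  have J: "homog_ideal w J" unfolding J_def by (rule homog_ideal_gen[where d = d]) (auto simp: hp)
  note J' = homog_ideal_mideal[OF J]
  assume "v \<notin> gen (UNIV - {i}) p"
  then obtain k where k: "hpart w k v \<notin> J" using homog_idealI[OF J] unfolding J_def by blast
  define z where "z = hpart w k v"
  have "hpart w (k + e) (v * q) \<in> J"
    using v by (intro homog_ideal_hpart[OF J]) (simp add: J_def q_def mult.commute)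
  then have zq: "z * q \<in> J" by (simp add: hpart_mult_homog[OF q] z_def)
  \<comment> \<open>A multiple of \<open>q ^ Suc k\<close> has no part of weight \<open>k\<close>,
    so \<open>z\<close>, which is homogeneous of that weight, would lie in \<open>J\<close>
    itself.\<close>
  have "z \<notin> adjoin J (q ^ Suc k)"
  proof
    assume "z \<in> adjoin J (q ^ Suc k)"
    then obtain r where "z - r * q ^ Suc k \<in> J" by (rule adjoinE)
    from homog_ideal_hpart[OF J this, of k] have "hpart w k z - hpart w k (r * q ^ Suc k) \<in> J" by (simp add: hpart_diff)
    moreover have "\<not> Suc k * e \<le> k" using e by (cases e) auto
    then have "hpart w k (r * q ^ Suc k) = 0" using hpart_mult_homog[OF homog_power[OF q, of "Suc k"]] by simp
    ultimately show False using k by (simp add: z_def)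
  qed
  then have ex: "\<exists>t. z \<notin> adjoin J (q ^ t)" by blast
  \<comment> \<open>Passing to the least such power turns \<open>z\<close> into an element
    \<open>u\<close> outside \<open>J + (q)\<close> that is annihilated by \<open>q ^ t\<close>
    modulo \<open>J\<close>.\<close>
  define t where "t = (LEAST t. z \<notin> adjoin J (q ^ t))"
  have t: "z \<notin> adjoin J (q ^ t)" unfolding t_def using ex by (rule LeastI_ex)
  have "z \<in> adjoin J (q ^ 0)" using adjoinI[OF mideal_zero[OF J'], of z "q ^ 0"] by simp
  with t obtain s where s: "t = Suc s" by (cases t) auto
  then have "z \<in> adjoin J (q ^ s)" using not_less_Least[of s "\<lambda>t. z \<notin> adjoin J (q ^ t)"] unfolding t_def by auto
  then obtain u where u: "z - u * q ^ s \<in> J" by (rule adjoinE)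
  have u_notin: "u \<notin> adjoin J q"
  proof
    assume "u \<in> adjoin J q"
    then obtain r where r: "u - r * q \<in> J" by (rule adjoinE)
    have "z - r * q ^ t = (z - u * q ^ s) + q ^ s * (u - r * q)"
      by (simp add: s algebra_simps)
    also have "\<dots> \<in> J" using u r by (intro mideal_add[OF J'] mideal_mult[OF J'])
    finally have "z \<in> adjoin J (q ^ t)" by (rule adjoinI')
    with t show False by simp
  qed
  have qu: "q ^ t * u \<in> J"
  proof -
    have "q ^ t * u = z * q - q * (z - u * q ^ s)" by (simp add: s algebra_simps)
    also have "\<dots> \<in> J" by (rule mideal_diff[OF J' zq mideal_mult[OF J' u]])
    finally show ?thesis .
  qed
  \<comment> \<open>\<open>K\<close> is strictly larger than \<open>J + (q)\<close>, but
    multiplication by \<open>q ^ t\<close> still sends it into \<open>J + (q ^ Suc t)\<close>. So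
    the last of the \<open>Suc t\<close> factors contributes less than
    \<open>codim (adjoin J q)\<close>.\<close>
  define K where "K = adjoin (adjoin J q) u"
  have K: "mideal K" "finite_codim K" unfolding K_def
    using mideal_adjoin[OF mideal_adjoin[OF J']] finite_codim_mono[OF fc subset_adjoin] by auto
  have lt: "codim K < codim (adjoin J q)"
    using fc mideal_adjoin[OF J'] K(1) subset_adjoin mem_adjoin[OF mideal_adjoin[OF J']] u_notin
    unfolding K_def by (rule codim_strict_mono)
  have qK: "q ^ t * x \<in> adjoin J (q ^ Suc t)" if "x \<in> K" for x
  proof -
    from that obtain r where "x - r * u \<in> adjoin J q" unfolding K_def by (rule adjoinE)
    then obtain r' where r': "x - r * u - r' * q \<in> J" by (rule adjoinE)
    have "q ^ t * x - r' * q ^ Suc t = q ^ t * (x - r * u - r' * q) + r * (q ^ t * u)"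
      by (simp add: algebra_simps)
    also have "\<dots> \<in> J" by (rule mideal_add[OF J' mideal_mult[OF J' r'] mideal_mult[OF J' qu]])
    finally show ?thesis by (rule adjoinI')
  qed
  from codim_adjoin_power_le[OF J' fc, of t]
  have ft: "finite_codim (adjoin J (q ^ t))" and ct: "codim (adjoin J (q ^ t)) \<le> t * codim (adjoin J q)" by auto
  have "codim (adjoin J (q ^ Suc t)) \<le> codim (adjoin J (q ^ t)) + codim K"
    using spans_adjoin_mult_gen(2)[OF J' qK mideal_adjoin[OF J'] subset_adjoin ft K(2,1)] .
  with ct lt have "codim (adjoin J (q ^ Suc t)) < Suc t * codim (adjoin J q)" by simp
  then have "codim (adjoin J (q ^ Suc t)) * wprod < Suc t * codim (adjoin J q) * wprod"
    using wprod_pos by simp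
  also have "\<dots> \<le> Suc t * (e * (\<Prod>j\<in>UNIV - {i}. d j))"
    using mult_le_mono2[OF c, of "Suc t"] by (simp only: mult.assoc)
  also have "\<dots> = (Suc t * e) * (\<Prod>j\<in>UNIV - {i}. d j)" by (simp only: mult.assoc)
  also have "\<dots> \<le> codim (adjoin J (q ^ Suc t)) * wprod"
    using codim_lower_bound_upd[where d = d and p = p, OF hp homog_power[OF q, of "Suc t"], of i]
      conjunct1[OF codim_adjoin_power_le[OF J' fc, of "Suc t"]] unfolding J_def by blast
  finally show False by simp
qed

text \<open>
  Modulo the other elements, a power of \<open>p i\<close> factors as \<open>u r\<close>; the codimensions of \<open>u\<close> and of
  \<open>r\<close> add up to the one of the power, and both satisfy the lower bound.
\<close>

lemma min_codim_exchange:
  fixes p :: "'n \<Rightarrow> ('k::field, 'n) mfps"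
  assumes min_codim: "min_codim p d" and u: "homog w e u" "e > 0" and fu: "finite_codim (gen UNIV (p(i := u)))"
  shows "min_codim (p(i := u)) (d(i := e))"
proof -
  define J where "J = gen (UNIV - {i}) p"
  define q where "q = p i"
  define c where "c = (\<Prod>j\<in>UNIV - {i}. d j)"
  have hp: "\<And>j. homog w (d j) (p j)" "\<And>j. 0 < d j" and q: "homog w (d i) q"
    and fc: "finite_codim (adjoin J q)" and E: "codim (adjoin J q) * wprod \<le> d i * c"
    using min_codim gen_remove[of p i] prod.remove[of UNIV i d]
    by (auto simp: min_codim_def J_def c_def q_def)
  have J: "homog_ideal w J" unfolding J_def by (rule homog_ideal_gen[where d = d]) (auto simp: hp)
  note J' = homog_ideal_mideal[OF J]
  have fu': "finite_codim (adjoin J u)" using fu unfolding gen_fun_upd J_def .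
  then obtain N where N: "\<And>h. ordge w N h \<Longrightarrow> h \<in> adjoin J u"
    using homog_ideal_finite_codim_iff[OF homog_ideal_adjoin[OF J u(1)]] by blast
  \<comment> \<open>\<open>M\<close> makes the weight of \<open>q ^ M\<close> at least
    \<open>N\<close>, which puts \<open>q ^ M\<close> into \<open>J + (u)\<close>, and greater than
    \<open>e\<close>, which keeps the degree \<open>M * d i - e\<close> of \<open>r\<close> from
    being truncated.\<close>
  define M where "M = Suc (N + e)"
  have M: "N \<le> M * d i" "e < M * d i" using hp(2)[of i] unfolding M_def by (cases "d i"; simp)+
  have qM: "homog w (M * d i) (q ^ M)" using q by (rule homog_power)
  have "ordge w N (q ^ M)" using homog_imp_ordge[OF qM] M(1) by (rule ordge_mono)
  then obtain r0 where "q ^ M - r0 * u \<in> J" using N by (meson adjoinE)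
  from homog_ideal_hpart[OF J this, of "M * d i"] M(2)
  have "q ^ M - hpart w (M * d i - e) r0 * u \<in> J"
    by (simp add: hpart_diff hpart_homog[OF qM] hpart_mult_homog[OF u(1)])
  then obtain r where r: "homog w (M * d i - e) r" and qr: "q ^ M - u * r \<in> J"
    using homog_hpart by (metis mult.commute)
  have nzd_q: "h \<in> J" if "q ^ m * h \<in> J" for m h
    using that
  proof (induction m)
    case (Suc m)
    then have "p i * (q ^ m * h) \<in> gen (UNIV - {i}) p" by (simp add: J_def q_def mult.assoc)
    from min_codim_nonzerodivisor[OF min_codim this] Suc.IH show ?case by (simp add: J_def)
  qed simp
  \<comment> \<open>Modulo \<open>J\<close>, \<open>u\<close> divides the nonzerodivisor
    \<open>q ^ M\<close> and hence is a nonzerodivisor itself.\<close>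
  have nzd_u: "h \<in> J" if "u * h \<in> J" for h
  proof (rule nzd_q)
    have "q ^ M * h = h * (q ^ M - u * r) + r * (u * h)" by (simp add: algebra_simps)
    also have "\<dots> \<in> J" by (rule mideal_add[OF J' mideal_mult[OF J' qr] mideal_mult[OF J' that]])
    finally show "q ^ M * h \<in> J" .
  qed
  from codim_adjoin_power_le[OF J' fc, of M] adjoin_cong[OF J' qr]
  have fM: "finite_codim (adjoin J (u * r))" and cM: "codim (adjoin J (u * r)) \<le> M * codim (adjoin J q)" by auto
  have fr: "finite_codim (adjoin J r)" using finite_codim_mono[OF fM adjoin_mult_subset] .
  \<comment> \<open>The two codimensions together are at most the sum of the two lower bounds;
    cancelling the lower bound for \<open>r\<close> leaves the upper bound for
    \<open>u\<close>.\<close>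
  have "codim (adjoin J u) * wprod + codim (adjoin J r) * wprod = (codim (adjoin J u) + codim (adjoin J r)) * wprod"
    by (simp add: distrib_right)
  also have "\<dots> \<le> (M * codim (adjoin J q)) * wprod"
    using codim_adjoin_mult_ge[OF J' nzd_u fM] cM by (intro mult_le_mono1) simp
  also have "\<dots> \<le> M * (d i * c)" using mult_le_mono2[OF E, of M] by (simp only: mult.assoc)
  also have "\<dots> = e * c + (M * d i - e) * c"
    using M(2) by (simp add: distrib_right[symmetric] mult.assoc)
  also have "\<dots> \<le> e * c + codim (adjoin J r) * wprod"
    using codim_lower_bound_upd[where d = d and p = p, OF hp(1) r, of i] fr unfolding J_def c_def by simp
  finally have "codim (adjoin J u) * wprod \<le> e * c" by simp
  then have "codim (gen UNIV (p(i := u))) * wprod \<le> (\<Prod>j\<in>UNIV. (d(i := e)) j)"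
    unfolding gen_fun_upd prod_fun_upd J_def c_def .
  then show ?thesis using hp u fu unfolding min_codim_def by auto
qed

end

section \<open>Polynomials and their zeros\<close>

text \<open>Polynomials are series of finite support, so that both rings share one type.\<close>

definition ispoly :: "('k::comm_ring_1, 'n::finite) mfps \<Rightarrow> bool" where
  "ispoly h \<longleftrightarrow> finite (msupp h)"

abbreviation mvar :: "'n \<Rightarrow> ('k::comm_ring_1, 'n::finite) mfps" where
  "mvar i \<equiv> mmonom (axis i 1)"

definition mpow :: "'k::comm_semiring_1 ^ 'n::finite \<Rightarrow> nat ^ 'n \<Rightarrow> 'k" where
  "mpow q \<alpha> = (\<Prod>i\<in>UNIV. q $ i ^ \<alpha> $ i)"

lemma mpow_add: "mpow q (\<alpha> + \<beta>) = mpow q \<alpha> * mpow q \<beta>"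
  by (simp add: mpow_def power_add prod.distrib)

lemma mpow_0 [simp]: "mpow q 0 = 1"
  by (simp add: mpow_def)

lemma mpow_axis [simp]: "mpow q (axis i m) = q $ i ^ m"
proof -
  have "mpow q (axis i m) = (\<Prod>j\<in>UNIV. if j = i then q $ i ^ m else 1)"
    unfolding mpow_def by (rule prod.cong) (auto simp: axis_def)
  then show ?thesis by simp
qed

lemma ispoly_subset: "finite A \<Longrightarrow> msupp h \<subseteq> A \<Longrightarrow> ispoly h"
  unfolding ispoly_def by (rule finite_subset)

lemma ispoly_0 [simp]: "ispoly 0"
  by (simp add: ispoly_def msupp_def)

lemma ispoly_mmonom [simp]: "ispoly (mmonom \<alpha>)"
  by (rule ispoly_subset[of "{\<alpha>}"]) (auto simp: msupp_def)

lemma ispoly_mconst [simp]: "ispoly (mconst c)"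
  by (rule ispoly_subset[of "{0}"]) (auto simp: msupp_def)

lemma ispoly_1 [simp]: "ispoly 1"
  using ispoly_mconst[of 1] by simp

lemma ispoly_add: "ispoly f \<Longrightarrow> ispoly g \<Longrightarrow> ispoly (f + g)"
  by (rule ispoly_subset[of "msupp f \<union> msupp g"]) (auto simp: msupp_def ispoly_def)

lemma ispoly_diff: "ispoly f \<Longrightarrow> ispoly g \<Longrightarrow> ispoly (f - g)"
  by (rule ispoly_subset[of "msupp f \<union> msupp g"]) (auto simp: msupp_def ispoly_def)

lemma ispoly_sum: "(\<And>x. x \<in> A \<Longrightarrow> ispoly (f x)) \<Longrightarrow> ispoly (sum f A)"
  by (induction A rule: infinite_finite_induct) (auto intro: ispoly_add)

lemma ispoly_mult:
  assumes "ispoly f" "ispoly g"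
  shows "ispoly (f * g)"
proof (rule ispoly_subset)
  show "finite ((\<lambda>(\<alpha>, \<beta>). \<alpha> + \<beta>) ` (msupp f \<times> msupp g))" using assms by (auto simp: ispoly_def)
  show "msupp (f * g) \<subseteq> (\<lambda>(\<alpha>, \<beta>). \<alpha> + \<beta>) ` (msupp f \<times> msupp g)"
  proof
    fix \<gamma> assume "\<gamma> \<in> msupp (f * g)"
    then obtain \<alpha> \<beta> where "\<gamma> = \<alpha> + \<beta>" "mcoeff f \<alpha> \<noteq> 0" "mcoeff g \<beta> \<noteq> 0"
      by (auto simp: msupp_def elim: mcoeff_mult_nonzero)
    then show "\<gamma> \<in> (\<lambda>(\<alpha>, \<beta>). \<alpha> + \<beta>) ` (msupp f \<times> msupp g)"
      by (intro image_eqI[of _ _ "(\<alpha>, \<beta>)"]) (auto simp: msupp_def)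
  qed
qed

lemma ispoly_power: "ispoly f \<Longrightarrow> ispoly (f ^ m)"
  by (induction m) (auto intro: ispoly_mult)

lemma ispoly_expand: "ispoly h \<Longrightarrow> h = lincomb (msupp h) mmonom (mcoeff h)"
proof (rule mfps_eqI)
  fix \<alpha> assume "ispoly h"
  have "mcoeff (lincomb (msupp h) mmonom (mcoeff h)) \<alpha> = (\<Sum>i\<in>msupp h. if \<alpha> = i then mcoeff h \<alpha> else 0)"
    by (auto simp: lincomb_def intro!: sum.cong)
  also have "\<dots> = mcoeff h \<alpha>" using \<open>ispoly h\<close> by (simp add: ispoly_def msupp_def)
  finally show "mcoeff h \<alpha> = mcoeff (lincomb (msupp h) mmonom (mcoeff h)) \<alpha>" by simp
qed

lemma meval_superset:
  assumes "finite A" "msupp h \<subseteq> A"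
  shows "meval h q = (\<Sum>\<alpha>\<in>A. mcoeff h \<alpha> * mpow q \<alpha>)"
  unfolding meval_def mpow_def
  by (rule sum.mono_neutral_left) (use assms in \<open>auto simp: msupp_def\<close>)

lemma meval_0 [simp]: "meval 0 q = 0"
  by (simp add: meval_def msupp_def)

lemma meval_monom: "meval (mconst (c :: 'k::comm_ring_1) * mmonom \<alpha>) q = c * mpow q \<alpha>"
  by (subst meval_superset[of "{\<alpha>}"]) (auto simp: msupp_def)

lemma meval_mmonom [simp]: "meval (mmonom \<alpha>) q = mpow q \<alpha>"
  using meval_monom[of 1 \<alpha> q] by simp

lemma meval_mconst [simp]: "meval (mconst (c :: 'k::comm_ring_1)) q = c"
  using meval_monom[of c 0 q] by (simp add: mmonom_0)

lemma meval_1 [simp]: "meval 1 q = 1"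
  using meval_mconst[of 1 q] by simp

lemma meval_add: "ispoly f \<Longrightarrow> ispoly g \<Longrightarrow> meval (f + g) q = meval f q + meval g q"
proof -
  assume *: "ispoly f" "ispoly g"
  let ?A = "msupp f \<union> msupp g"
  have "finite ?A" using * by (simp add: ispoly_def)
  moreover have "msupp (f + g) \<subseteq> ?A" by (auto simp: msupp_def)
  ultimately show ?thesis
    by (simp add: meval_superset[of ?A] distrib_right sum.distrib)
qed

lemma meval_diff: "ispoly f \<Longrightarrow> ispoly g \<Longrightarrow> meval (f - g) q = meval f q - meval g q"
  using meval_add[of "f - g" g q] by (simp add: ispoly_diff)

lemma meval_sum: "(\<And>x. x \<in> A \<Longrightarrow> ispoly (f x)) \<Longrightarrow> meval (sum f A) q = (\<Sum>x\<in>A. meval (f x) q)"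
  by (induction A rule: infinite_finite_induct) (auto simp: meval_add ispoly_sum)

lemma meval_mult:
  fixes f g :: "('k::comm_ring_1, 'n::finite) mfps"
  assumes "ispoly f" "ispoly g"
  shows "meval (f * g) q = meval f q * meval g q"
proof -
  let ?t = "\<lambda>\<alpha> \<beta>. mconst (mcoeff f \<alpha> * mcoeff g \<beta>) * mmonom (\<alpha> + \<beta>) :: ('k, 'n) mfps"
  have "f * g = lincomb (msupp f) mmonom (mcoeff f) * lincomb (msupp g) mmonom (mcoeff g)"
    using assms ispoly_expand by metis
  also have "\<dots> = (\<Sum>\<alpha>\<in>msupp f. \<Sum>\<beta>\<in>msupp g. ?t \<alpha> \<beta>)"
    unfolding lincomb_def sum_product
    by (intro sum.cong refl) (simp add: mconst_mult mmonom_mult[symmetric] mult_ac)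
  finally have "meval (f * g) q = (\<Sum>\<alpha>\<in>msupp f. \<Sum>\<beta>\<in>msupp g. mcoeff f \<alpha> * mcoeff g \<beta> * mpow q (\<alpha> + \<beta>))"
    by (simp add: meval_sum ispoly_sum ispoly_mult meval_monom)
  also have "\<dots> = meval f q * meval g q"
    unfolding meval_def mpow_def[symmetric] sum_product
    by (intro sum.cong refl) (simp add: mpow_add mult_ac)
  finally show ?thesis .
qed

lemma meval_power: "ispoly f \<Longrightarrow> meval (f ^ m) q = meval f q ^ m"
  by (induction m) (auto simp: meval_mult ispoly_power)

lemma mvar_power: "mvar i ^ m = (mmonom (axis i m) :: ('k::comm_ring_1, 'n::finite) mfps)"
proof (induction m)
  case 0
  have "axis i 0 = (0 :: nat ^ 'n)" by (simp add: vec_eq_iff axis_def)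
  then show ?case by (simp only: power_0 mmonom_0)
next
  case (Suc m)
  have "axis i 1 + axis i m = (axis i (Suc m) :: nat ^ 'n)" by (simp add: vec_eq_iff axis_def)
  with Suc show ?case by (simp add: mmonom_mult)
qed

lemma mmonom_sum: "mmonom (sum f A) = (\<Prod>x\<in>A. mmonom (f x))"
  by (induction A rule: infinite_finite_induct) (auto simp: mmonom_0 mmonom_mult[symmetric])

lemma mmonom_prod: "mmonom \<alpha> = (\<Prod>i\<in>UNIV. mvar i ^ \<alpha> $ i)"
proof -
  have "\<alpha> = (\<Sum>i\<in>UNIV. axis i (\<alpha> $ i))"
  proof (subst vec_eq_iff, intro allI)
    fix j
    have "(\<Sum>i\<in>UNIV. axis i (\<alpha> $ i)) $ j = (\<Sum>i\<in>UNIV. if i = j then \<alpha> $ j else 0)"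
      unfolding sum_component by (rule sum.cong) (auto simp: axis_def)
    then show "\<alpha> $ j = (\<Sum>i\<in>UNIV. axis i (\<alpha> $ i)) $ j" by simp
  qed
  then have "mmonom \<alpha> = mmonom (\<Sum>i\<in>UNIV. axis i (\<alpha> $ i))" by simp
  then show ?thesis unfolding mmonom_sum mvar_power .
qed

text \<open>Ideals of the polynomial subring. They are kept apart from \<open>mideal\<close> because
  an element such as \<open>mvar i - 1\<close> is a unit in the series ring.\<close>

definition pideal :: "('k::comm_ring_1, 'n::finite) mfps set \<Rightarrow> bool" where
  "pideal Q \<longleftrightarrow> 0 \<in> Q \<and> (\<forall>a\<in>Q. ispoly a) \<and> (\<forall>a\<in>Q. \<forall>b\<in>Q. a + b \<in> Q) \<and> (\<forall>a\<in>Q. \<forall>r. ispoly r \<longrightarrow> r * a \<in> Q)"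

lemma pideal_zero: "pideal Q \<Longrightarrow> 0 \<in> Q"
  and pideal_ispoly: "pideal Q \<Longrightarrow> a \<in> Q \<Longrightarrow> ispoly a"
  and pideal_add: "pideal Q \<Longrightarrow> a \<in> Q \<Longrightarrow> b \<in> Q \<Longrightarrow> a + b \<in> Q"
  and pideal_mult: "pideal Q \<Longrightarrow> a \<in> Q \<Longrightarrow> ispoly r \<Longrightarrow> r * a \<in> Q"
  by (simp_all add: pideal_def)

lemma pideal_sum: "pideal Q \<Longrightarrow> (\<And>x. x \<in> A \<Longrightarrow> f x \<in> Q) \<Longrightarrow> sum f A \<in> Q"
  by (induction A rule: infinite_finite_induct) (auto intro: pideal_zero pideal_add)

lemma pideal_diff:
  assumes "pideal Q" "a \<in> Q" "b \<in> Q"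
  shows "a - b \<in> Q"
  using pideal_add[OF assms(1,2) pideal_mult[OF assms(1,3) ispoly_mconst[of "- 1"]]]
  by (simp add: mconst_uminus)

definition padjoin :: "('k::comm_ring_1, 'n::finite) mfps set \<Rightarrow> ('k, 'n) mfps \<Rightarrow> ('k, 'n) mfps set" where
  "padjoin Q u = {a + r * u | a r. a \<in> Q \<and> ispoly r}"

lemma padjoinI: "a \<in> Q \<Longrightarrow> ispoly r \<Longrightarrow> h = a + r * u \<Longrightarrow> h \<in> padjoin Q u"
  by (auto simp: padjoin_def)

lemma padjoinE:
  assumes "h \<in> padjoin Q u"
  obtains a r where "a \<in> Q" "ispoly r" "h = a + r * u"
  using assms by (auto simp: padjoin_def)

lemma pideal_padjoin:
  fixes Q :: "('k::comm_ring_1, 'n::finite) mfps set"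
  assumes Q: "pideal Q" and u: "ispoly u"
  shows "pideal (padjoin Q u)"
  unfolding pideal_def
proof (intro conjI ballI allI impI)
  show "0 \<in> padjoin Q u" by (rule padjoinI[of 0 _ 0]) (auto simp: pideal_zero[OF Q])
next
  fix a assume "a \<in> padjoin Q u"
  then show "ispoly a"
    by (elim padjoinE) (auto intro: ispoly_add ispoly_mult u pideal_ispoly[OF Q])
next
  fix a b assume "a \<in> padjoin Q u" "b \<in> padjoin Q u"
  then obtain a' b' r s where *: "a' \<in> Q" "b' \<in> Q" "a = a' + r * u" "b = b' + s * u" "ispoly r" "ispoly s"
    by (metis padjoinE)
  show "a + b \<in> padjoin Q u"
    by (rule padjoinI[of "a' + b'" _ "r + s"])
       (use * in \<open>auto intro: pideal_add[OF Q] ispoly_add simp: algebra_simps\<close>)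
next
  fix a r :: "('k, 'n) mfps" assume "a \<in> padjoin Q u" and r: "ispoly r"
  then obtain a' s where *: "a' \<in> Q" "a = a' + s * u" "ispoly s" by (metis padjoinE)
  show "r * a \<in> padjoin Q u"
    by (rule padjoinI[of "r * a'" _ "r * s"])
       (use * r pideal_mult[OF Q *(1) r] in \<open>auto intro: ispoly_mult simp: algebra_simps\<close>)
qed

lemma subset_padjoin: "Q \<subseteq> padjoin Q u"
  using padjoinI[of _ Q 0 _ u] by auto

lemma mem_padjoin: "pideal Q \<Longrightarrow> u \<in> padjoin Q u"
  using padjoinI[of 0 Q 1 u u] pideal_zero by auto

section \<open>Substitution into univariate polynomials and zeros of affine systems\<close>

definition upoly :: "'k::comm_ring_1 poly \<Rightarrow> ('k, 'n::finite) mfps \<Rightarrow> ('k, 'n) mfps" where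
  "upoly F x = (\<Sum>i\<le>degree F. mconst (Polynomial.coeff F i) * x ^ i)"

lemma upoly_bound: "degree F \<le> m \<Longrightarrow> upoly F x = (\<Sum>i\<le>m. mconst (Polynomial.coeff F i) * x ^ i)"
  unfolding upoly_def by (rule sum.mono_neutral_left) (auto simp: coeff_eq_0)

lemma upoly_add: "upoly (F + G) x = upoly F x + upoly G x"
proof -
  let ?m = "max (degree F) (degree G)"
  have "degree (F + G) \<le> ?m" by (rule Polynomial.degree_add_le_max)
  then show ?thesis by (simp add: upoly_bound[of _ ?m] mconst_add distrib_right sum.distrib)
qed

lemma upoly_smult: "upoly (Polynomial.smult c F) x = mconst c * upoly F x"
  by (simp add: upoly_bound[of _ "degree F"] degree_smult_le mconst_mult sum_distrib_left mult.assoc)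

lemma upoly_pCons_0: "upoly (pCons 0 F) x = x * upoly F x"
proof -
  have "upoly (pCons 0 F) x = (\<Sum>i\<le>Suc (degree F). mconst (Polynomial.coeff (pCons 0 F) i) * x ^ i)"
    by (rule upoly_bound) (rule degree_pCons_le)
  also have "\<dots> = (\<Sum>i\<le>degree F. mconst (Polynomial.coeff F i) * x ^ Suc i)"
    by (subst sum.atMost_Suc_shift) simp
  finally show ?thesis by (simp add: upoly_def sum_distrib_left mult.left_commute)
qed

lemma upoly_linear_mult: "upoly ([:- c, 1:] * F) x = (x - mconst c) * upoly F x"
proof -
  have "[:- c, 1:] * F = Polynomial.smult (- c) F + pCons 0 F" by simp
  then show ?thesis by (simp only: upoly_add upoly_smult upoly_pCons_0) (simp add: mconst_uminus algebra_simps)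
qed

lemma ispoly_upoly: "ispoly x \<Longrightarrow> ispoly (upoly F x)"
  unfolding upoly_def by (intro ispoly_sum ispoly_mult ispoly_power) auto

lemma meval_upoly: "ispoly x \<Longrightarrow> meval (upoly F x) q = poly F (meval x q)"
  by (simp add: upoly_def meval_sum ispoly_mult ispoly_power meval_mult meval_power poly_altdef)

text \<open>If adjoining \<open>x - mconst c\<close> gives the unit ideal for a root
  \<open>c\<close> of \<open>F\<close>, then \<open>x - mconst c\<close> is invertible modulo
  \<open>Q\<close> and can be cancelled from \<open>upoly F x\<close>. The degree drops until some
  root works, since \<open>Q\<close> contains no nonzero constant.\<close>

lemma proper_padjoin_root:
  fixes Q :: "('k::alg_closed_field, 'n::finite) mfps set"
  assumes Q: "pideal Q" "1 \<notin> Q" and x: "ispoly x" and F: "F \<noteq> 0" "upoly F x \<in> Q"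
  shows "\<exists>c. 1 \<notin> padjoin Q (x - mconst c)"
  using F
proof (induction "degree F" arbitrary: F rule: less_induct)
  case less
  show ?case
  proof (cases "degree F = 0")
    case True
    then obtain a where a: "F = [:a:]" by (meson degree_eq_zeroE)
    then have "mconst a \<in> Q" "a \<noteq> 0" using less.prems by (auto simp: upoly_def)
    from pideal_mult[OF Q(1) this(1) ispoly_mconst[of "inverse a"]] this(2)
    have "1 \<in> Q" by (simp add: mconst_mult[symmetric])
    with Q show ?thesis by simp
  next
    case False
    then obtain c where "poly F c = 0" using alg_closed_imp_poly_has_root[of F] by auto
    then obtain G where G: "F = [:- c, 1:] * G" by (auto simp: poly_eq_0_iff_dvd elim: dvdE)
    have "G \<noteq> 0" using G less.prems by auto
    then have deg: "degree G < degree F" unfolding G by (subst degree_mult_eq) auto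
    show ?thesis
    proof (cases "1 \<in> padjoin Q (x - mconst c)")
      case True
      then obtain a r where ar: "a \<in> Q" "ispoly r" "1 = a + r * (x - mconst c)" by (rule padjoinE)
      have "upoly G x = (a + r * (x - mconst c)) * upoly G x" using ar(3) by simp
      also have "\<dots> = upoly G x * a + r * upoly F x"
        unfolding G upoly_linear_mult by (simp add: algebra_simps)
      also have "\<dots> \<in> Q"
        using ar less.prems by (intro pideal_add[OF Q(1)] pideal_mult[OF Q(1)] ispoly_upoly x)
      finally show ?thesis using less.hyps[OF deg \<open>G \<noteq> 0\<close>] by blast
    qed blast
  qed
qed

text \<open>The variables are made congruent to constants one at a time while the ideal stays
  proper; \<open>alg\<close> supplies the polynomial whose roots are the candidates.\<close>

lemma affine_zero_exists:
  fixes Q :: "('k::alg_closed_field, 'n::finite) mfps set"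
  assumes Q: "pideal Q" "1 \<notin> Q" and alg: "\<And>j. \<exists>F. F \<noteq> 0 \<and> upoly F (mvar j) \<in> Q"
  shows "\<exists>z. \<forall>h\<in>Q. meval h z = 0"
proof -
  have "\<exists>R c. pideal R \<and> Q \<subseteq> R \<and> 1 \<notin> R \<and> (\<forall>j\<in>T. mvar j - mconst (c j) \<in> R)" if "finite T" for T :: "'n set"
    using that
  proof (induction T rule: finite_induct)
    case empty
    then show ?case using Q by (intro exI[of _ Q]) auto
  next
    case (insert j T)
    then obtain R c where R: "pideal R" "Q \<subseteq> R" "1 \<notin> R" "\<forall>j\<in>T. mvar j - mconst (c j) \<in> R" by blast
    from alg[of j] obtain F where F: "F \<noteq> 0" "upoly F (mvar j) \<in> R" using R(2) by blast
    from proper_padjoin_root[OF R(1,3) ispoly_mmonom F] obtain a where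
      a: "1 \<notin> padjoin R (mvar j - mconst a)" by blast
    have "pideal (padjoin R (mvar j - mconst a))"
      by (intro pideal_padjoin R ispoly_diff) auto
    moreover have "Q \<subseteq> padjoin R (mvar j - mconst a)" using R(2) subset_padjoin by blast
    moreover have "\<forall>i\<in>insert j T. mvar i - mconst ((c(j := a)) i) \<in> padjoin R (mvar j - mconst a)"
      using R(4) insert.hyps subset_padjoin[of R] mem_padjoin[OF R(1)] by auto
    ultimately show ?case using a by blast
  qed
  from this[of UNIV] obtain R c where R: "pideal R" "Q \<subseteq> R" "1 \<notin> R"
    and c: "\<And>j. mvar j - mconst (c j) \<in> R" by auto
  define z where "z = (\<chi> j. c j)"
  \<comment> \<open>\<open>?C h\<close> says that \<open>h\<close> is congruent modulo
    \<open>R\<close> to its value at \<open>z\<close>. This passes to products, hence holds for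
    monomials, and linearity gives it for all polynomials; so a nonzero value of an element of
    \<open>Q\<close> would be a unit in \<open>R\<close>.\<close>
  let ?C = "\<lambda>h. ispoly h \<and> h - mconst (meval h z) \<in> R"
  have C_mult: "?C (f * g)" if "?C f" "?C g" for f g
  proof -
    have "f * g - mconst (meval (f * g) z) = g * (f - mconst (meval f z)) + mconst (meval f z) * (g - mconst (meval g z))"
      using that by (simp add: meval_mult mconst_mult algebra_simps)
    also have "\<dots> \<in> R" using that by (intro pideal_add[OF R(1)] pideal_mult[OF R(1)]) auto
    finally show ?thesis using that by (simp add: ispoly_mult)
  qed
  have C_1: "?C (mconst a)" for a using pideal_zero[OF R(1)] by simp
  have C_power: "?C (f ^ m)" if "?C f" for f m
    using C_1[of 1] C_mult[OF that] by (induction m) auto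
  have C_prod: "?C (prod f A)" if "\<And>x. ?C (f x)" for f and A :: "'n set"
    using C_1[of 1] C_mult[OF that] by (induction A rule: infinite_finite_induct) auto
  have "?C (mvar j)" for j using c by (simp add: z_def)
  then have "?C (\<Prod>i\<in>UNIV. mvar i ^ \<alpha> $ i)" for \<alpha>
    by (intro C_prod C_power)
  then have C_mmonom: "?C (mmonom \<alpha>)" for \<alpha>
    by (simp only: mmonom_prod[symmetric])
  have "h - mconst (meval h z) \<in> R" if "ispoly h" for h
  proof -
    have "h - mconst (meval h z) = (\<Sum>\<alpha>\<in>msupp h. mconst (mcoeff h \<alpha>) * (mmonom \<alpha> - mconst (mpow z \<alpha>)))"
      using ispoly_expand[OF that]
      by (simp add: lincomb_def meval_def mpow_def[symmetric] mconst_sum mconst_mult right_diff_distrib sum_subtractf)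
    also have "\<dots> \<in> R"
      using C_mmonom by (intro pideal_sum[OF R(1)] pideal_mult[OF R(1)]) auto
    finally show ?thesis .
  qed
  note key = this
  have "meval h z = 0" if "h \<in> Q" for h
  proof (rule ccontr)
    assume nz: "meval h z \<noteq> 0"
    have "h \<in> R" using that R(2) by blast
    from pideal_diff[OF R(1) this key[OF pideal_ispoly[OF Q(1) that]]]
    have "mconst (meval h z) \<in> R" by simp
    from pideal_mult[OF R(1) this ispoly_mconst[of "inverse (meval h z)"]] nz
    have "1 \<in> R" by (simp add: mconst_mult[symmetric])
    with R(3) show False by simp
  qed
  then show ?thesis by blast
qed

section \<open>The homogeneous Nullstellensatz\<close>

lemma pideal_polys: "mideal J \<Longrightarrow> pideal {a \<in> J. ispoly a}"
  by (auto simp: pideal_def mideal_zero intro: mideal_add mideal_mult ispoly_add ispoly_mult)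

context pos_weights
begin

lemma homog_ispoly: "homog w k h \<Longrightarrow> ispoly h"
  by (rule ispoly_subset[OF finite_wd_le[of k]]) (auto simp: homog_def msupp_def)

text \<open>Setting \<open>p\<close> to 1 lowers weights: a part of weight at least \<open>N\<close>
  is congruent to some \<open>r * p\<close> modulo \<open>J\<close>, and \<open>r * p\<close> is
  congruent to \<open>r\<close>, whose weight is smaller by \<open>e\<close>.\<close>

lemma dehomogenize_reduce:
  fixes J :: "('k::field, 'n) mfps set"
  assumes J: "homog_ideal w J" and p: "homog w e p" "0 < e" and N: "\<And>h. ordge w N h \<Longrightarrow> h \<in> adjoin J p"
    and h: "ispoly h" "\<And>\<alpha>. mcoeff h \<alpha> \<noteq> 0 \<Longrightarrow> weighted_degree w \<alpha> < k"
  shows "\<exists>g. (\<forall>\<alpha>. mcoeff g \<alpha> \<noteq> 0 \<longrightarrow> weighted_degree w \<alpha> < N) \<and>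
           h - g \<in> padjoin {a \<in> J. ispoly a} (p - 1)"
  using h
proof (induction k arbitrary: h)
  case 0
  then have "h = 0" by (intro mfps_eqI) auto
  then show ?case
    using pideal_zero[OF pideal_padjoin[OF pideal_polys[OF homog_ideal_mideal[OF J]]]] homog_ispoly[OF p(1)]
    by (intro exI[of _ 0]) (auto simp: ispoly_diff)
next
  case (Suc k)
  note Q = pideal_padjoin[OF pideal_polys[OF homog_ideal_mideal[OF J]] ispoly_diff[OF homog_ispoly[OF p(1)] ispoly_1]]
  show ?case
  proof (cases "Suc k \<le> N")
    case True
    then show ?thesis
      using Suc.prems(2) pideal_zero[OF Q] by (intro exI[of _ h]) (auto intro: less_le_trans)
  next
    case False
    then have "ordge w N (hpart w k h)"
      by (intro ordge_mono[OF homog_imp_ordge[OF homog_hpart]]) simp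
    then obtain r where "hpart w k h - r * p \<in> J" using N by (meson adjoinE)
    from homog_ideal_hpart[OF J this, of k]
    have "\<exists>r. hpart w k h - r * p \<in> J \<and> homog w (k - e) r \<and> (k < e \<longrightarrow> r = 0)"
      by (intro exI[of _ "if e \<le> k then hpart w (k - e) r else 0"])
         (auto simp: hpart_diff hpart_mult_homog[OF p(1)])
    then obtain r where r: "hpart w k h - r * p \<in> J" "homog w (k - e) r" "k < e \<Longrightarrow> r = 0" by blast
    have pr: "ispoly r" using r(2) by (rule homog_ispoly)
    let ?h = "h - hpart w k h + r"
    have "ispoly ?h" using Suc.prems(1) pr by (intro ispoly_add ispoly_diff homog_ispoly[OF homog_hpart])
    moreover have "weighted_degree w \<alpha> < k" if "mcoeff ?h \<alpha> \<noteq> 0" for \<alpha>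
    proof (cases "mcoeff r \<alpha> = 0")
      case True
      with that have "mcoeff h \<alpha> \<noteq> 0" "weighted_degree w \<alpha> \<noteq> k" by (auto split: if_splits)
      with Suc.prems(2)[of \<alpha>] show ?thesis by simp
    next
      case False
      then have "weighted_degree w \<alpha> = k - e" using homogD[OF r(2)] by blast
      moreover have "e \<le> k"
      proof (rule ccontr)
        assume "\<not> e \<le> k"
        with r(3) have "r = 0" by simp
        with False show False by simp
      qed
      ultimately show ?thesis using p(2) by simp
    qed
    ultimately obtain g where g: "\<forall>\<alpha>. mcoeff g \<alpha> \<noteq> 0 \<longrightarrow> weighted_degree w \<alpha> < N"
      "?h - g \<in> padjoin {a \<in> J. ispoly a} (p - 1)" using Suc.IH[of ?h] by blast
    have "(hpart w k h - r * p) + r * (p - 1) \<in> padjoin {a \<in> J. ispoly a} (p - 1)"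
      using r(1) pr homog_ispoly[OF p(1)]
      by (intro padjoinI[of "hpart w k h - r * p" _ r])
         (auto intro: ispoly_diff ispoly_mult homog_ispoly[OF homog_hpart])
    from pideal_add[OF Q g(2) this] have "h - g \<in> padjoin {a \<in> J. ispoly a} (p - 1)"
      by (simp add: algebra_simps)
    with g(1) show ?thesis by blast
  qed
qed

text \<open>By the reduction each power of \<open>x\<close> is congruent to a polynomial supported
  on the exponents of weight less than \<open>N\<close>. One power more than there are such
  exponents forces a linear relation, whose coefficients form \<open>F\<close>.\<close>

lemma dehomogenize_algebraic:
  fixes J :: "('k::field, 'n) mfps set"
  assumes J: "homog_ideal w J" and p: "homog w e p" "0 < e" and fc: "finite_codim (adjoin J p)" and x: "ispoly x"
  shows "\<exists>F. F \<noteq> 0 \<and> upoly F x \<in> padjoin {a \<in> J. ispoly a} (p - 1)"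
proof -
  let ?Q = "padjoin {a \<in> J. ispoly a} (p - 1)"
  have Q: "pideal ?Q"
    by (rule pideal_padjoin[OF pideal_polys[OF homog_ideal_mideal[OF J]] ispoly_diff[OF homog_ispoly[OF p(1)] ispoly_1]])
  obtain N where N: "\<And>h. ordge w N h \<Longrightarrow> h \<in> adjoin J p"
    using fc homog_ideal_finite_codim_iff[OF homog_ideal_adjoin[OF J p(1)]] by blast
  let ?L = "{\<alpha>. weighted_degree w \<alpha> < N}"
  let ?M = "card ?L"
  have "\<exists>g. (\<forall>\<alpha>. mcoeff g \<alpha> \<noteq> 0 \<longrightarrow> weighted_degree w \<alpha> < N) \<and> h - g \<in> ?Q" if h: "ispoly h" for h
  proof -
    have "finite (weighted_degree w ` msupp h)" using h by (simp add: ispoly_def)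
    then obtain k where "\<forall>d \<in> weighted_degree w ` msupp h. d < k" by (meson finite_nat_set_iff_bounded)
    then have k: "\<And>\<alpha>. mcoeff h \<alpha> \<noteq> 0 \<Longrightarrow> weighted_degree w \<alpha> < k" by (auto simp: msupp_def)
    show ?thesis by (rule dehomogenize_reduce[OF J p N h k])
  qed
  then obtain g where g: "\<And>h \<alpha>. ispoly h \<Longrightarrow> mcoeff (g h) \<alpha> \<noteq> 0 \<Longrightarrow> weighted_degree w \<alpha> < N"
    "\<And>h. ispoly h \<Longrightarrow> h - g h \<in> ?Q" by metis
  from homogeneous_system_nontrivial_solution[of ?L "{..?M}" "\<lambda>s \<alpha>. mcoeff (g (x ^ s)) \<alpha>"]
  obtain c where c: "\<exists>s\<le>?M. c s \<noteq> 0"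
    and c0: "\<And>\<alpha>. weighted_degree w \<alpha> < N \<Longrightarrow> (\<Sum>s\<le>?M. c s * mcoeff (g (x ^ s)) \<alpha>) = 0"
    using finite_wd_less[of N] by auto
  have sum0: "(\<Sum>s\<le>?M. mconst (c s) * g (x ^ s)) = 0"
  proof (rule mfps_eqI)
    fix \<alpha>
    show "mcoeff (\<Sum>s\<le>?M. mconst (c s) * g (x ^ s)) \<alpha> = mcoeff 0 \<alpha>"
    proof (cases "weighted_degree w \<alpha> < N")
      case True
      then show ?thesis using c0 by simp
    next
      case False
      then have "mcoeff (g (x ^ s)) \<alpha> = 0" for s using g(1)[OF ispoly_power[OF x]] by blast
      then show ?thesis by simp
    qed
  qed
  define F where "F = (\<Sum>s\<le>?M. Polynomial.monom (c s) s)"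
  have coF: "Polynomial.coeff F s = (if s \<le> ?M then c s else 0)" for s
    by (simp add: F_def coeff_sum)
  then have "F \<noteq> 0" using c by (metis coeff_0)
  have "degree F \<le> ?M" by (rule degree_le) (simp add: coF)
  then have "upoly F x = (\<Sum>s\<le>?M. mconst (c s) * x ^ s)" by (simp add: upoly_bound coF)
  also have "\<dots> = (\<Sum>s\<le>?M. mconst (c s) * (x ^ s - g (x ^ s)))"
    using sum0 by (simp add: right_diff_distrib sum_subtractf)
  also have "\<dots> \<in> ?Q"
    using g(2)[OF ispoly_power[OF x]] by (intro pideal_sum[OF Q] pideal_mult[OF Q]) auto
  finally show ?thesis using \<open>F \<noteq> 0\<close> by blast
qed

lemma homog_mvar: "homog w (w $ i) (mvar i)"
  using homog_mmonom[of w "axis i 1"] by simp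

text \<open>\<open>J'\<close> is \<open>J\<close> enlarged by as many variables as possible: its quotient is one-dimensional.\<close>

lemma extend_by_variables:
  fixes J :: "('k::field, 'n) mfps set"
  assumes J: "homog_ideal w J" "\<not> finite_codim J"
  obtains J' i where "homog_ideal w J'" "J \<subseteq> J'" "\<not> finite_codim J'" "finite_codim (adjoin J' (mvar i))"
proof (rule ccontr)
  assume "\<not> thesis"
  with that have no: "\<not> finite_codim (adjoin J' (mvar i))" if "homog_ideal w J'" "J \<subseteq> J'" "\<not> finite_codim J'" for J' i
    using that by blast
  have "\<exists>J'. homog_ideal w J' \<and> J \<subseteq> J' \<and> \<not> finite_codim J' \<and> (\<forall>i\<in>T. mvar i \<in> J')" if "finite T" for T :: "'n set"
    using that
  proof (induction T rule: finite_induct)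
    case empty
    then show ?case using J by blast
  next
    case (insert i T)
    then obtain J' where J': "homog_ideal w J'" "J \<subseteq> J'" "\<not> finite_codim J'" "\<forall>i\<in>T. mvar i \<in> J'" by blast
    show ?case
      using no[OF J'(1-3), of i] homog_ideal_adjoin[OF J'(1) homog_mvar] J'(2,4) subset_adjoin[of J' "mvar i"]
        mem_adjoin[OF homog_ideal_mideal[OF J'(1)], of "mvar i"]
      by (intro exI[of _ "adjoin J' (mvar i)"]) auto
  qed
  \<comment> \<open>With all variables in \<open>J'\<close>, every series without constant term lies
    in \<open>J'\<close>, against its infinite codimension.\<close>
  from this[of UNIV, OF finite] obtain J' where J': "homog_ideal w J'" "\<not> finite_codim J'" "J \<subseteq> J'" and "\<forall>i\<in>UNIV. mvar i \<in> J'" by blast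
  then have J'_mvar: "mvar i \<in> J'" for i by blast
  note I = homog_ideal_mideal[OF J'(1)]
  have mon: "mmonom \<alpha> \<in> J'" if nz: "\<alpha> \<noteq> 0" for \<alpha>
  proof -
    from nz obtain i where "\<alpha> $ i \<noteq> 0" by (auto simp: vec_eq_iff)
    then have "\<alpha> = (\<alpha> - axis i 1) + axis i 1" by (auto simp: vec_eq_iff axis_def)
    then obtain \<beta> where \<beta>: "\<alpha> = \<beta> + axis i 1" by blast
    show ?thesis unfolding \<beta> mmonom_mult[symmetric] by (rule mideal_mult[OF I J'_mvar])
  qed
  have "h \<in> J'" if "ordge w 1 h" for h
  proof (rule homog_idealI[OF J'(1)])
    fix k
    have "hpart w k h = lincomb (msupp (hpart w k h)) mmonom (mcoeff (hpart w k h))"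
      by (rule ispoly_expand[OF homog_ispoly[OF homog_hpart]])
    also have "\<dots> \<in> J'"
    proof (rule lincomb_mem_ideal[OF I], rule mon)
      fix \<alpha> assume "\<alpha> \<in> msupp (hpart w k h)"
      then have "mcoeff h \<alpha> \<noteq> 0" by (auto simp: msupp_def split: if_splits)
      with that show "\<alpha> \<noteq> 0" by (auto simp: ordge_def)
    qed
    finally show "hpart w k h \<in> J'" .
  qed
  with J' homog_ideal_finite_codim_iff[OF J'(1)] show False by blast
qed

text \<open>The ideal is enlarged until one more variable would make its codimension finite. Setting
  that variable equal to 1 leaves an affine system covered by \<open>affine_zero_exists\<close>, and
  a zero with a coordinate 1 is not the origin.\<close>

theorem homogeneous_zero_exists:
  fixes p :: "'i \<Rightarrow> ('k::alg_closed_field, 'n) mfps"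
  assumes fin: "finite S" and p: "\<And>j. j \<in> S \<Longrightarrow> homog w (d j) (p j)" and nf: "\<not> finite_codim (gen S p)"
  shows "\<exists>z. z \<noteq> 0 \<and> (\<forall>j\<in>S. meval (p j) z = 0)"
proof -
  obtain J i where J: "homog_ideal w J" "gen S p \<subseteq> J" "\<not> finite_codim J" and fc: "finite_codim (adjoin J (mvar i))"
    using extend_by_variables[OF homog_ideal_gen[where d = d and p = p, OF fin p] nf] by metis
  note J' = homog_ideal_mideal[OF J(1)]
  let ?x = "mvar i :: ('k, 'n) mfps"
  let ?Q = "padjoin {a \<in> J. ispoly a} (?x - 1)"
  have Q: "pideal ?Q" by (rule pideal_padjoin[OF pideal_polys[OF J'] ispoly_diff]) auto
  have x_notin: "?x ^ m \<notin> J" for m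
  proof
    assume m: "?x ^ m \<in> J"
    have "adjoin J (?x ^ m) \<subseteq> J" by (rule adjoin_subset[OF J' _ m]) simp
    with codim_adjoin_power_le[OF J' fc, of m] J(3) show False using finite_codim_mono by blast
  qed
  \<comment> \<open>If \<open>1 = a + b * (?x - 1)\<close> with \<open>a \<in> J\<close>, comparing
    the parts of weight \<open>m * w $ i\<close> shows that the part of \<open>b\<close> is
    congruent to \<open>- (?x ^ m)\<close> modulo \<open>J\<close> for every \<open>m\<close>. But
    \<open>b\<close> is a polynomial, and no power of \<open>?x\<close> lies in
    \<open>J\<close>.\<close>
  have "1 \<notin> ?Q"
  proof
    assume "1 \<in> ?Q"
    then obtain a b where ab: "a \<in> J" "ispoly b" "1 = a + b * (?x - 1)" by (auto elim!: padjoinE)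
    have a_eq: "a = 1 - b * ?x + b" using ab(3) by (simp add: algebra_simps)
    have step: "hpart w k a = hpart w k 1 - (if w $ i \<le> k then hpart w (k - w $ i) b * ?x else 0) + hpart w k b" for k
      unfolding a_eq hpart_add hpart_diff hpart_mult_homog[OF homog_mvar] ..
    have "hpart w (m * w $ i) b + ?x ^ m \<in> J" for m
    proof (induction m)
      case 0
      have "\<not> w $ i \<le> 0" using w_pos[of i] by simp
      then show ?case using step[of 0] homog_ideal_hpart[OF J(1) ab(1), of 0]
        by (simp add: hpart_homog[OF homog_1] add.commute)
    next
      case (Suc m)
      have "Suc m * w $ i \<noteq> 0" using w_pos[of i] by simp
      then have "hpart w (Suc m * w $ i) a = - (hpart w (m * w $ i) b * ?x) + hpart w (Suc m * w $ i) b"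
        using step[of "Suc m * w $ i"] by (simp add: hpart_homog[OF homog_1])
      then have "hpart w (Suc m * w $ i) b + ?x ^ Suc m =
          hpart w (Suc m * w $ i) a + ?x * (hpart w (m * w $ i) b + ?x ^ m)"
        by (simp add: algebra_simps)
      also have "\<dots> \<in> J" by (rule mideal_add[OF J' homog_ideal_hpart[OF J(1) ab(1)] mideal_mult[OF J' Suc]])
      finally show ?case .
    qed
    moreover have "finite (weighted_degree w ` msupp b)" using ab(2) by (simp add: ispoly_def)
    then obtain m where m: "\<forall>k \<in> weighted_degree w ` msupp b. k < m" by (meson finite_nat_set_iff_bounded)
    have "hpart w (m * w $ i) b = 0"
    proof (rule mfps_eqI)
      fix \<alpha>
      have "m \<le> m * w $ i" using w_pos[of i] by simp
      with m show "mcoeff (hpart w (m * w $ i) b) \<alpha> = mcoeff 0 \<alpha>"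
        by (force simp: msupp_def)
    qed
    ultimately have "?x ^ m \<in> J" by (metis add_0)
    with x_notin show False by simp
  qed
  moreover have "\<exists>F. F \<noteq> 0 \<and> upoly F (mvar j) \<in> ?Q" for j
    by (rule dehomogenize_algebraic[OF J(1) homog_mvar w_pos fc]) simp
  ultimately obtain z where z: "\<forall>h\<in>?Q. meval h z = 0"
    using affine_zero_exists[OF Q] by blast
  have "?x - 1 \<in> ?Q" by (rule mem_padjoin[OF pideal_polys[OF J']])
  with z have "meval (?x - 1) z = 0" by blast
  then have "z $ i = 1" by (simp add: meval_diff)
  then have "z \<noteq> 0" by auto
  moreover have "meval (p j) z = 0" if "j \<in> S" for j
  proof -
    have "p j \<in> {a \<in> J. ispoly a}" using J(2) gen_memI[OF fin that] homog_ispoly[OF p[OF that]] by auto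
    then have "p j \<in> ?Q" by (rule subsetD[OF subset_padjoin])
    then show ?thesis using z by blast
  qed
  ultimately show ?thesis by blast
qed

text \<open>The multipliers witnessing membership in \<open>gen S p\<close> are series and cannot be
  evaluated; for each homogeneous part of \<open>h\<close> they can be replaced by homogeneous
  polynomials.\<close>

lemma meval_gen_eq_0:
  fixes p :: "'i \<Rightarrow> ('k::field, 'n) mfps"
  assumes fin: "finite S" and p: "\<And>j. j \<in> S \<Longrightarrow> homog w (d j) (p j)" and z: "\<And>j. j \<in> S \<Longrightarrow> meval (p j) z = 0"
    and h: "h \<in> gen S p" "ispoly h"
  shows "meval h z = 0"
proof -
  from h(1) obtain a where a: "h = (\<Sum>j\<in>S. a j * p j)" by (auto simp: gen_def)
  have hp: "meval (hpart w k h) z = 0" for k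
  proof -
    have "hpart w k h = (\<Sum>j\<in>S. (if d j \<le> k then hpart w (k - d j) (a j) else 0) * p j)"
      unfolding a hpart_sum by (rule sum.cong) (auto simp: hpart_mult_homog[OF p])
    also have "meval \<dots> z = 0"
      by (subst meval_sum) (auto intro!: ispoly_mult homog_ispoly[OF homog_hpart] homog_ispoly[OF p]
          sum.neutral simp: meval_mult homog_ispoly[OF homog_hpart] homog_ispoly[OF p] z)
    finally show ?thesis .
  qed
  have "finite (weighted_degree w ` msupp h)" using h(2) by (simp add: ispoly_def)
  then obtain k where k: "\<forall>d \<in> weighted_degree w ` msupp h. d < k" by (meson finite_nat_set_iff_bounded)
  have "h = (\<Sum>l<k. hpart w l h)"
  proof (rule mfps_eqI)
    fix \<alpha>
    show "mcoeff h \<alpha> = mcoeff (\<Sum>l<k. hpart w l h) \<alpha>"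
      using k by (cases "mcoeff h \<alpha> = 0") (auto simp: msupp_def)
  qed
  from arg_cong[OF this, of "\<lambda>x. meval x z"]
  have "meval h z = (\<Sum>l<k. meval (hpart w l h) z)"
    by (subst (asm) meval_sum) (auto intro: homog_ispoly[OF homog_hpart])
  with hp show ?thesis by simp
qed

text \<open>In finite codimension a power of each variable lies in the ideal, so a power of each
  coordinate of a common zero vanishes.\<close>

lemma finite_codim_common_zero:
  fixes p :: "'i \<Rightarrow> ('k::field, 'n) mfps"
  assumes fin: "finite S" and p: "\<And>j. j \<in> S \<Longrightarrow> homog w (d j) (p j)" and fc: "finite_codim (gen S p)"
    and z: "\<And>j. j \<in> S \<Longrightarrow> meval (p j) z = 0"
  shows "z = 0"
proof (subst vec_eq_iff, intro allI)
  fix i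
  obtain N where N: "\<And>h. ordge w N h \<Longrightarrow> h \<in> gen S p"
    using fc homog_ideal_finite_codim_iff[OF homog_ideal_gen[where d = d and p = p, OF fin p]] by blast
  have "homog w (N * w $ i) (mvar i ^ N :: ('k, 'n) mfps)" by (rule homog_power[OF homog_mvar])
  moreover have "N \<le> N * w $ i" using w_pos[of i] by simp
  ultimately have "(mvar i ^ N :: ('k, 'n) mfps) \<in> gen S p" by (intro N ordge_mono[OF homog_imp_ordge])
  from meval_gen_eq_0[where d = d and p = p, OF fin p z this] have "z $ i ^ N = 0" by (simp add: ispoly_power meval_power)
  then show "z $ i = 0 $ i" by simp
qed

lemma finite_codim_gen_iff:
  fixes p :: "'i \<Rightarrow> ('k::alg_closed_field, 'n) mfps"
  assumes fin: "finite S" and p: "\<And>j. j \<in> S \<Longrightarrow> homog w (d j) (p j)"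
  shows "finite_codim (gen S p) \<longleftrightarrow> (\<forall>z. (\<forall>j\<in>S. meval (p j) z = 0) \<longrightarrow> z = 0)"
proof
  assume "finite_codim (gen S p)"
  then show "\<forall>z. (\<forall>j\<in>S. meval (p j) z = 0) \<longrightarrow> z = 0"
    using finite_codim_common_zero[where d = d and p = p, OF fin p] by blast
next
  assume "\<forall>z. (\<forall>j\<in>S. meval (p j) z = 0) \<longrightarrow> z = 0"
  then show "finite_codim (gen S p)" using homogeneous_zero_exists[where d = d and p = p, OF fin p] by blast
qed

end

section \<open>Upper bound for the codimension\<close>

text \<open>Over a finite field, the product of all \<open>X - a\<close>, increased by 1, has no
  root.\<close>

lemma infinite_UNIV_alg_closed: "infinite (UNIV :: 'k::alg_closed_field set)"
proof
  assume fin: "finite (UNIV :: 'k set)"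
  define G where "G = (\<Prod>a\<in>(UNIV :: 'k set). [:- a, 1:])"
  have root: "poly G a = 0" for a
    unfolding G_def poly_prod using fin by (intro prod_zero) auto
  have "degree (G + 1) = 0"
  proof (rule ccontr)
    assume "degree (G + 1) \<noteq> 0"
    then obtain x where "poly (G + 1) x = 0" using alg_closed_imp_poly_has_root[of "G + 1"] by auto
    with root[of x] show False by simp
  qed
  then obtain c where "G + 1 = [:c:]" by (meson degree_eq_zeroE)
  then have "G = [:c:] - 1" by (metis add_diff_cancel_right')
  then have "G = [:c - 1:]" by (simp add: one_pCons)
  with root[of 0] have "G = 0" by simp
  moreover have "G \<noteq> 0" unfolding G_def using fin by (subst prod_zero_iff) auto
  ultimately show False by simp
qed

context pos_weights
begin

text \<open>The scaling action belonging to the weights. It is used to normalize a value to 1 and,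
  with \<open>s = 0\<close>, to see that elements of positive degree vanish at the origin.\<close>

lemma meval_scale:
  assumes "homog w k h"
  shows "meval h (\<chi> i. s ^ (w $ i) * z $ i) = s ^ k * meval h z"
proof -
  have "mpow (\<chi> i. s ^ (w $ i) * z $ i) \<alpha> = s ^ weighted_degree w \<alpha> * mpow z \<alpha>" for \<alpha>
    by (simp add: mpow_def weighted_degree_def power_mult_distrib prod.distrib power_mult power_sum)
  then show ?thesis
    unfolding meval_def mpow_def[symmetric] sum_distrib_left
    by (intro sum.cong refl) (use assms in \<open>auto simp: homog_def msupp_def\<close>)
qed

text \<open>
  The common zeros of the \<open>p j\<close>, \<open>j \<noteq> i\<close>, with \<open>p i = 1\<close> are finite in number, and
  each of them is a zero of \<open>\<Sum>j. t ^ e' j * q j\<close> for only finitely many \<open>t\<close>.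
\<close>

lemma generic_combination:
  fixes p q :: "'n \<Rightarrow> ('k::alg_closed_field, 'n) mfps"
  assumes p: "\<And>j. homog w (d j) (p j)" "0 < d i" "finite_codim (gen UNIV p)"
    and q: "\<And>j. homog w e (q j)" "finite_codim (gen UNIV q)"
  shows "\<exists>c. finite_codim (gen UNIV (p(i := \<Sum>j\<in>UNIV. mconst (c j) * q j)))"
proof (rule ccontr)
  assume "\<nexists>c. finite_codim (gen UNIV (p(i := \<Sum>j\<in>UNIV. mconst (c j) * q j)))"
  then have no: "\<not> finite_codim (gen UNIV (p(i := \<Sum>j\<in>UNIV. mconst (c j) * q j)))" for c by simp
  define J where "J = gen (UNIV - {i}) p"
  have J: "homog_ideal w J" unfolding J_def by (rule homog_ideal_gen[where d = d]) (auto simp: p)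
  define Z where "Z = {z. (\<forall>j\<in>UNIV - {i}. meval (p j) z = 0) \<and> meval (p i) z = 1}"
  have "finite_codim (adjoin J (p i))" using p(3) unfolding gen_remove[of p i] J_def .
  from dehomogenize_algebraic[OF J p(1,2) this]
  have "\<exists>F. F \<noteq> 0 \<and> upoly F (mvar j) \<in> padjoin {a \<in> J. ispoly a} (p i - 1)" for j by simp
  then obtain F where F: "\<And>j. F j \<noteq> 0" "\<And>j. upoly (F j) (mvar j) \<in> padjoin {a \<in> J. ispoly a} (p i - 1)"
    by metis
  have root: "poly (F j) (z $ j) = 0" if z: "z \<in> Z" for z j
  proof -
    from F(2)[of j] obtain a r where ar: "a \<in> J" "ispoly a" "ispoly r" "upoly (F j) (mvar j) = a + r * (p i - 1)"
      by (auto elim: padjoinE)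
    have "meval a z = 0"
      using z by (intro meval_gen_eq_0[OF _ p(1) _ ar(1)[unfolded J_def] ar(2)]) (auto simp: Z_def)
    then have "meval (a + r * (p i - 1)) z = 0"
      using z ar homog_ispoly[OF p(1)] by (simp add: meval_add meval_mult meval_diff ispoly_mult ispoly_diff Z_def)
    then show ?thesis using meval_upoly[of "mvar j" "F j" z] ar(4) by simp
  qed
  have "Z \<subseteq> vec_lambda ` (PiE UNIV (\<lambda>j. {x. poly (F j) x = 0}))"
  proof
    fix z assume "z \<in> Z"
    then show "z \<in> vec_lambda ` (PiE UNIV (\<lambda>j. {x. poly (F j) x = 0}))"
      using root by (intro image_eqI[of _ _ "vec_nth z"]) auto
  qed
  moreover have "finite (vec_lambda ` (PiE (UNIV :: 'n set) (\<lambda>j. {x. poly (F j) x = 0})))"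
    using F(1) poly_roots_finite by (intro finite_imageI finite_PiE) auto
  ultimately have finZ: "finite Z" by (rule finite_subset)
  \<comment> \<open>Distinct exponents keep the values \<open>meval (q j) y\<close> apart as
    coefficients of one polynomial in the parameter \<open>t\<close>.\<close>
  obtain e' :: "'n \<Rightarrow> nat" where e': "inj e'"
    using ex_bij_betw_finite_nat[of "UNIV :: 'n set"] by (auto simp: bij_betw_def)
  define l where "l t = (\<Sum>j\<in>UNIV. mconst (t ^ e' j) * q j)" for t
  have hl: "homog w e (l t)" for t unfolding l_def by (intro homog_sum homog_mconst_mult q)
  have "\<exists>z\<in>Z. meval (l t) z = 0" for t
  proof -
    have "\<not> finite_codim (gen UNIV (p(i := l t)))" unfolding l_def by (rule no)
    moreover have "homog w ((d(i := e)) j) ((p(i := l t)) j)" for j using p(1) hl by simp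
    ultimately obtain x where x: "x \<noteq> 0" "\<forall>j\<in>UNIV. meval ((p(i := l t)) j) x = 0"
      using homogeneous_zero_exists[of UNIV "d(i := e)" "p(i := l t)"] by auto
    have xj: "meval (p j) x = 0" if "j \<noteq> i" for j using bspec[OF x(2), of j] that by simp
    have xl: "meval (l t) x = 0" using bspec[OF x(2), of i] by simp
    have "meval (p i) x \<noteq> 0"
    proof
      assume "meval (p i) x = 0"
      with xj have "meval (p j) x = 0" for j by (cases "j = i") auto
      with finite_codim_common_zero[of UNIV d p] p x(1) show False by auto
    qed
    \<comment> \<open>Roots exist in an algebraically closed field, so scaling moves the zero
      \<open>x\<close> to a point where \<open>p i\<close> has the value 1.\<close>
    moreover obtain s where "s ^ d i = inverse (meval (p i) x)" using nth_root_exists[OF p(2)] by metis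
    ultimately show ?thesis
      using xj xl by (intro bexI[of _ "\<chi> j. s ^ (w $ j) * x $ j"])
        (auto simp: Z_def meval_scale[OF p(1)] meval_scale[OF hl])
  qed
  then obtain z where z: "\<And>t. z t \<in> Z" "\<And>t. meval (l t) (z t) = 0" by metis
  \<comment> \<open>Infinitely many parameters share one point of the finite set \<open>Z\<close>.
    The polynomial \<open>G\<close> in the parameter then vanishes identically, so all
    \<open>q j\<close> vanish at that point; it must be the origin, where \<open>p i\<close> cannot
    be 1.\<close>
  have "\<exists>t0\<in>UNIV. infinite {t \<in> UNIV. z t = z t0}"
    by (rule pigeonhole_infinite[OF infinite_UNIV_alg_closed]) (rule finite_subset[OF _ finZ], use z in auto)
  then obtain t0 where t0: "infinite {t. z t = z t0}" by auto
  define y where "y = z t0"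
  define G where "G = (\<Sum>j\<in>UNIV. Polynomial.monom (meval (q j) y) (e' j))"
  have "poly G t = meval (l t) y" for t
    unfolding G_def l_def poly_sum poly_monom
    by (subst meval_sum) (auto intro!: ispoly_mult homog_ispoly[OF q(1)] simp: meval_mult homog_ispoly[OF q(1)] mult.commute)
  then have "{t. z t = z t0} \<subseteq> {t. poly G t = 0}" using z(2) by (auto simp: y_def) metis
  then have "G = 0" using t0 poly_roots_finite[of G] infinite_super by blast
  have "meval (q j) y = 0" for j
  proof -
    have "Polynomial.coeff G (e' j) = (\<Sum>l\<in>UNIV. if l = j then meval (q l) y else 0)"
      unfolding G_def coeff_sum by (rule sum.cong) (use e' in \<open>auto simp: inj_eq\<close>)
    then show ?thesis using \<open>G = 0\<close> by simp
  qed
  then have "y = 0" using finite_codim_common_zero[of UNIV "\<lambda>_. e" q y] q by auto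
  have "meval (p i) y = 1" using z(1)[of t0] by (simp add: Z_def y_def)
  moreover have "(\<chi> j. 0 ^ (w $ j) * y $ j) = y" unfolding \<open>y = 0\<close> by (simp add: vec_eq_iff)
  ultimately show False using meval_scale[OF p(1), of i 0 y] p(2) by (simp add: power_0_left)
qed

text \<open>The start of the exchange: 1 alone spans modulo the variables, and their degrees
  multiply to \<open>wprod\<close>.\<close>

lemma min_codim_mvar: "min_codim (mvar :: 'n \<Rightarrow> ('k::field, 'n) mfps) (vec_nth w)"
proof -
  let ?J = "gen UNIV (mvar :: 'n \<Rightarrow> ('k, 'n) mfps)"
  have J: "mideal ?J" by (rule mideal_gen) simp
  have H: "homog_ideal w ?J" by (rule homog_ideal_gen[where d = "vec_nth w", OF finite homog_mvar])
  have mon: "mmonom \<alpha> \<in> ?J" if nz: "\<alpha> \<noteq> 0" for \<alpha>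
  proof -
    from nz obtain i where "\<alpha> $ i \<noteq> 0" by (auto simp: vec_eq_iff)
    then have "\<alpha> = (\<alpha> - axis i 1) + axis i 1" by (auto simp: vec_eq_iff axis_def)
    then obtain \<beta> where \<beta>: "\<alpha> = \<beta> + axis i 1" by blast
    show ?thesis unfolding \<beta> mmonom_mult[symmetric]
      by (intro mideal_mult[OF J] gen_memI) auto
  qed
  have sp: "spans ?J {0} mmonom"
  proof (rule spans_mmonom)
    fix h :: "('k, 'n) mfps" assume h: "\<And>\<alpha>. \<alpha> \<in> {0} \<Longrightarrow> mcoeff h \<alpha> = 0"
    show "h \<in> ?J"
    proof (rule homog_idealI[OF H])
      fix k
      have "lincomb (msupp (hpart w k h)) mmonom (mcoeff (hpart w k h)) \<in> ?J"
      proof (rule lincomb_mem_ideal[OF J], rule mon)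
        fix \<alpha> assume "\<alpha> \<in> msupp (hpart w k h)"
        then show "\<alpha> \<noteq> 0" using h by (auto simp: msupp_def split: if_splits)
      qed
      then show "hpart w k h \<in> ?J"
        using ispoly_expand[OF homog_ispoly[OF homog_hpart[of w k h]]] by metis
    qed
  qed simp
  have "codim ?J \<le> 1" using spans_codim_le[OF _ sp] by simp
  then have "codim ?J * wprod \<le> wprod" using mult_le_mono1[of "codim ?J" 1 wprod] by simp
  then show ?thesis
    unfolding min_codim_def using spans_finite_codim[OF _ sp] by (intro conjI allI homog_mvar w_pos) auto
qed

text \<open>Each variable is exchanged for a combination of the \<open>q j\<close>. It suffices that
  the final system lies in \<open>gen UNIV q\<close>, since passing to a larger ideal can only lower
  the codimension.\<close>

lemma min_codim_equal_degrees:
  fixes q :: "'n \<Rightarrow> ('k::alg_closed_field, 'n) mfps"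
  assumes q: "\<And>j. homog w e (q j)" "0 < e" "finite_codim (gen UNIV q)"
  shows "min_codim q (\<lambda>_. e)"
proof -
  have "\<exists>r. min_codim r (\<lambda>j. if j \<in> T then e else w $ j) \<and> (\<forall>j\<in>T. r j \<in> gen UNIV q)" if "finite T" for T
    using that
  proof (induction T rule: finite_induct)
    case empty
    then show ?case using min_codim_mvar by (auto intro!: exI[of _ mvar])
  next
    case (insert i T)
    let ?d = "\<lambda>j. if j \<in> T then e else w $ j"
    from insert obtain r where r: "min_codim r ?d" "\<And>j. j \<in> T \<Longrightarrow> r j \<in> gen UNIV q" by blast
    have "\<And>j. homog w (?d j) (r j)" "0 < ?d i" "finite_codim (gen UNIV r)"
      using r(1) unfolding min_codim_def by blast+
    from generic_combination[OF this q(1,3)] obtain c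
      where c: "finite_codim (gen UNIV (r(i := \<Sum>j\<in>UNIV. mconst (c j) * q j)))" by blast
    let ?u = "\<Sum>j\<in>UNIV. mconst (c j) * q j"
    have "homog w e ?u" by (intro homog_sum homog_mconst_mult q)
    have d: "?d(i := e) = (\<lambda>j. if j \<in> insert i T then e else w $ j)" by auto
    have "min_codim (r(i := ?u)) (\<lambda>j. if j \<in> insert i T then e else w $ j)"
      using min_codim_exchange[OF r(1) \<open>homog w e ?u\<close> q(2) c] unfolding d .
    moreover have "?u \<in> gen UNIV q"
      unfolding gen_def by (rule range_eqI[of _ _ "\<lambda>j. mconst (c j)"]) (rule refl)
    then have "\<forall>j\<in>insert i T. (r(i := ?u)) j \<in> gen UNIV q" using r(2) by auto
    ultimately show ?case by blast
  qed
  from this[of UNIV] obtain r where r: "min_codim r (\<lambda>_. e)" "\<And>j. r j \<in> gen UNIV q" by auto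
  have "gen UNIV r \<subseteq> gen UNIV q" using r(2) by (intro gen_subset mideal_gen) auto
  then have "codim (gen UNIV q) \<le> codim (gen UNIV r)"
    using r(1) by (intro codim_mono mideal_gen) (auto simp: min_codim_def)
  then have "codim (gen UNIV q) * wprod \<le> codim (gen UNIV r) * wprod" by (rule mult_le_mono1)
  also have "\<dots> \<le> (\<Prod>i\<in>(UNIV :: 'n set). e)" using r(1) unfolding min_codim_def by blast
  finally show ?thesis using q unfolding min_codim_def by blast
qed

theorem codim_upper_bound:
  fixes p :: "'n \<Rightarrow> ('k::alg_closed_field, 'n) mfps"
  assumes p: "\<And>j. homog w (d j) (p j)" "\<And>j. 0 < d j" "finite_codim (gen UNIV p)"
  shows "codim (gen UNIV p) * wprod \<le> (\<Prod>j\<in>UNIV. d j)"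
proof -
  define e where "e = (\<Prod>j\<in>UNIV. d j)"
  \<comment> \<open>Since \<open>a j * d j = e\<close>, all powers \<open>p j ^ a j\<close> have the
    common degree \<open>e\<close>.\<close>
  define a where "a j = (\<Prod>l\<in>UNIV - {j}. d l)" for j
  define q where "q j = p j ^ a j" for j
  have a: "a j * d j = e" "0 < a j" for j
    unfolding a_def e_def using p(2) prod.remove[of UNIV j d] by (auto intro: prod_pos)
  have e: "0 < e" unfolding e_def using p(2) by (auto intro: prod_pos)
  have hq: "homog w e (q j)" for j unfolding q_def using homog_power[OF p(1), of "a j" j] a by simp
  let ?d = "\<lambda>T j. if j \<in> T then d j else e" and ?r = "\<lambda>T j. if j \<in> T then p j else q j"
  have hr: "homog w (?d T j) (?r T j)" for T j using p(1) hq by simp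
  \<comment> \<open>A positive power has the same zeros as its base, so by the Nullstellensatz every
    mixed system has finite codimension, as each exchange requires.\<close>
  have fr: "finite_codim (gen UNIV (?r T))" for T
  proof -
    have z0: "z = 0" if "\<forall>j\<in>UNIV. meval (?r T j) z = 0" for z
    proof (rule finite_codim_common_zero[where p = p and d = d and S = UNIV])
      fix j
      from that have "meval (?r T j) z = 0" by blast
      then show "meval (p j) z = 0"
        by (auto simp: q_def meval_power homog_ispoly[OF p(1)] split: if_splits)
    qed (use p in auto)
    show ?thesis
      unfolding finite_codim_gen_iff[of UNIV "?d T" "?r T", OF finite hr] by (intro allI impI z0)
  qed
  have "min_codim (?r T) (?d T)" if "finite T" for T
    using that
  proof (induction T rule: finite_induct)
    case empty
    show ?case using min_codim_equal_degrees[of e q] hq e fr[of "{}"] by simp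
  next
    case (insert i T)
    have r: "?r (insert i T) = (?r T)(i := p i)" and d: "?d (insert i T) = (?d T)(i := d i)" by auto
    show ?case unfolding r d
      using insert.IH p(1,2) fr[of "insert i T", unfolded r] by (rule min_codim_exchange)
  qed
  from this[of UNIV] show ?thesis by (simp add: min_codim_def)
qed

end

section \<open>Higher order perturbations\<close>

context pos_weights
begin

text \<open>
  A monomial basis modulo the leading forms spans modulo the perturbed elements: the
  coefficients are found degree by degree.
\<close>

lemma codim_perturbation_le:
  fixes f g :: "'i \<Rightarrow> ('k::field, 'n) mfps"
  assumes fin: "finite S" and g: "\<And>i. i \<in> S \<Longrightarrow> homog w (d i) (g i)" and fc: "finite_codim (gen S g)"
    and fg: "\<And>i. i \<in> S \<Longrightarrow> ordge w (Suc (d i)) (f i - g i)"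
  shows "finite_codim (gen S f)" "codim (gen S f) \<le> codim (gen S g)"
proof -
  let ?J = "gen S g"
  have J: "homog_ideal w ?J" by (rule homog_ideal_gen[where d = d, OF fin g])
  note J' = homog_ideal_mideal[OF J]
  obtain N where N: "\<And>h. ordge w N h \<Longrightarrow> h \<in> ?J" using fc homog_ideal_finite_codim_iff[OF J] by blast
  have "spans ?J {\<alpha>. weighted_degree w \<alpha> < N} mmonom"
    by (rule spans_mmonom[OF finite_wd_less], rule N) (use not_le in \<open>auto simp: ordge_def\<close>)
  then obtain B where B: "B \<subseteq> {\<alpha>. weighted_degree w \<alpha> < N}" "spans ?J B mmonom" "indep ?J B mmonom"
    by (rule spans_obtain_basis[OF J' finite_wd_less])
  have finB: "finite B" using B(1) finite_wd_less by (rule finite_subset)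
  \<comment> \<open>\<open>X k h ca\<close> records a decomposition of the weight \<open>k\<close>
    part of \<open>h\<close>: coefficients on the members of \<open>B\<close> of weight
    \<open>k\<close>, and homogeneous multipliers of the \<open>g i\<close>, equal to 0 where
    \<open>k - d i\<close> would be truncated.\<close>
  define X where "X k h ca \<longleftrightarrow>
      hpart w k h = (\<Sum>\<beta>\<in>B. mconst (if weighted_degree w \<beta> = k then fst ca \<beta> else 0) * mmonom \<beta>) + (\<Sum>i\<in>S. snd ca i * g i)
      \<and> (\<forall>i\<in>S. homog w (k - d i) (snd ca i)) \<and> (\<forall>i\<in>S. k < d i \<longrightarrow> snd ca i = 0)" for k h ca
  have step: "\<exists>ca. X k h ca" for k h
  proof -
    from B(2) obtain c where "hpart w k h - lincomb B mmonom c \<in> ?J" by (auto simp: spans_def)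
    then obtain a where a: "hpart w k h - lincomb B mmonom c = (\<Sum>i\<in>S. a i * g i)" by (auto simp: gen_def)
    let ?a = "\<lambda>i. if d i \<le> k then hpart w (k - d i) (a i) else 0"
    have "hpart w k (hpart w k h - lincomb B mmonom c) = hpart w k (\<Sum>i\<in>S. a i * g i)" using a by simp
    also have "hpart w k (\<Sum>i\<in>S. a i * g i) = (\<Sum>i\<in>S. ?a i * g i)"
      unfolding hpart_sum by (rule sum.cong) (auto simp: hpart_mult_homog[OF g])
    also have "hpart w k (hpart w k h - lincomb B mmonom c) =
        hpart w k h - (\<Sum>\<beta>\<in>B. mconst (if weighted_degree w \<beta> = k then c \<beta> else 0) * mmonom \<beta>)"
    proof -
      have "hpart w k (lincomb B mmonom c) =
          (\<Sum>\<beta>\<in>B. mconst (if weighted_degree w \<beta> = k then c \<beta> else 0) * mmonom \<beta>)"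
        unfolding lincomb_def hpart_sum hpart_mconst_mult
        by (rule sum.cong) (auto simp: hpart_homog[OF homog_mmonom])
      then show ?thesis by (simp add: hpart_diff)
    qed
    finally have "hpart w k h = (\<Sum>\<beta>\<in>B. mconst (if weighted_degree w \<beta> = k then c \<beta> else 0) * mmonom \<beta>) + (\<Sum>i\<in>S. ?a i * g i)"
      by (simp add: algebra_simps)
    then have "X k h (c, ?a)" unfolding X_def fst_conv snd_conv by auto
    then show ?thesis by blast
  qed
  define C where "C k h = fst (SOME ca. X k h ca)" for k h
  define A where "A k h = snd (SOME ca. X k h ca)" for k h
  have "X k h (SOME ca. X k h ca)" for k h using step by (rule someI_ex)
  then have CA: "\<And>k h. hpart w k h = (\<Sum>\<beta>\<in>B. mconst (if weighted_degree w \<beta> = k then C k h \<beta> else 0) * mmonom \<beta>) + (\<Sum>i\<in>S. A k h i * g i)"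
    "\<And>k h i. i \<in> S \<Longrightarrow> homog w (k - d i) (A k h i)" "\<And>k h i. i \<in> S \<Longrightarrow> k < d i \<Longrightarrow> A k h i = 0"
    unfolding X_def C_def A_def by blast+
  define mb where "mb k h = (\<Sum>\<beta>\<in>B. mconst (if weighted_degree w \<beta> = k then C k h \<beta> else 0) * mmonom \<beta>)" for k h
  have sp: "spans (gen S f) B mmonom"
    unfolding spans_def
  proof
    fix h :: "('k, 'n) mfps"
    \<comment> \<open>\<open>H k\<close> is the remainder after the weights below \<open>k\<close>
      have been removed. The multipliers found for the \<open>g i\<close> are applied to the
      \<open>f i\<close>; the discrepancy \<open>f i - g i\<close> has higher order and is left to
      later stages.\<close>
    define H where "H = rec_nat h (\<lambda>k x. x - mb k x - (\<Sum>i\<in>S. A k x i * f i))"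
    have H0: "H 0 = h" and HS: "H (Suc k) = H k - mb k (H k) - (\<Sum>i\<in>S. A k (H k) i * f i)" for k
      by (simp_all add: H_def)
    have ordH: "ordge w k (H k)" for k
    proof (induction k)
      case (Suc k)
      have "H (Suc k) = (H k - hpart w k (H k)) - (\<Sum>i\<in>S. A k (H k) i * (f i - g i))"
        unfolding HS using CA(1)[of k "H k"] by (simp add: mb_def algebra_simps sum_subtractf)
      moreover have "ordge w (Suc k) (H k - hpart w k (H k))"
        using Suc by (auto simp: ordge_def Suc_le_eq le_neq_implies_less split: if_splits)
      moreover have "ordge w (Suc k) (A k (H k) i * (f i - g i))" if "i \<in> S" for i
      proof (cases "k < d i")
        case False
        then show ?thesis using ordge_mult[OF homog_imp_ordge[OF CA(2)[OF that, of k "H k"]] fg[OF that]] by simp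
      qed (use CA(3)[OF that] in simp)
      then have "ordge w (Suc k) (\<Sum>i\<in>S. A k (H k) i * (f i - g i))" by (rule ordge_sum)
      ultimately show ?case using mideal_diff[OF mideal_ordge, of _ w "Suc k"] by auto
    qed simp
    define c where "c \<beta> = C (weighted_degree w \<beta>) (H (weighted_degree w \<beta>)) \<beta>" for \<beta>
    \<comment> \<open>The part of weight \<open>k\<close> in the multiplier of \<open>f i\<close>
      arises at stage \<open>k + d i\<close>; \<open>glue\<close> collects all stages.\<close>
    define a where "a i = glue w (\<lambda>k. A (k + d i) (H (k + d i)) i)" for i
    have partial: "h - H k = (\<Sum>l<k. mb l (H l)) + (\<Sum>i\<in>S. (\<Sum>l<k. A l (H l) i) * f i)" for k
      by (induction k) (simp_all add: H0 HS algebra_simps sum.distrib sum_distrib_right)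
    have mb_sum: "(\<Sum>l<k. mb l (H l)) = lincomb B mmonom (\<lambda>\<beta>. if weighted_degree w \<beta> < k then c \<beta> else 0)" for k
    proof -
      have "(\<Sum>l<k. mb l (H l)) = (\<Sum>\<beta>\<in>B. \<Sum>l<k. mconst (if weighted_degree w \<beta> = l then C l (H l) \<beta> else 0) * mmonom \<beta>)"
        unfolding mb_def by (rule sum.swap)
      also have "\<dots> = (\<Sum>\<beta>\<in>B. mconst (if weighted_degree w \<beta> < k then c \<beta> else 0) * mmonom \<beta>)"
      proof (rule sum.cong[OF refl])
        fix \<beta>
        have "(\<Sum>l<k. mconst (if weighted_degree w \<beta> = l then C l (H l) \<beta> else 0) * mmonom \<beta>) =
          (\<Sum>l<k. if weighted_degree w \<beta> = l then mconst (c \<beta>) * mmonom \<beta> else 0)"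
          by (rule sum.cong) (auto simp: c_def)
        then show "(\<Sum>l<k. mconst (if weighted_degree w \<beta> = l then C l (H l) \<beta> else 0) * mmonom \<beta>) =
          mconst (if weighted_degree w \<beta> < k then c \<beta> else 0) * mmonom \<beta>" by simp
      qed
      finally show ?thesis by (simp add: lincomb_def)
    qed
    have a_tail: "ordge w (k - d i) (a i - (\<Sum>l<k. A l (H l) i))" if i: "i \<in> S" for i k
      unfolding ordge_def
    proof (intro allI impI, rule ccontr)
      fix \<alpha> assume nz: "mcoeff (a i - (\<Sum>l<k. A l (H l) i)) \<alpha> \<noteq> 0" and "\<not> k - d i \<le> weighted_degree w \<alpha>"
      then have lt: "weighted_degree w \<alpha> + d i < k" by simp
      have A0: "mcoeff (A l (H l) i) \<alpha> = 0" if "l \<noteq> weighted_degree w \<alpha> + d i" for l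
      proof (cases "l < d i")
        case True
        then show ?thesis using CA(3)[OF i] by simp
      next
        case False
        with that have "weighted_degree w \<alpha> \<noteq> l - d i" by auto
        then show ?thesis using homogD[OF CA(2)[OF i]] by metis
      qed
      have "(\<Sum>l<k. mcoeff (A l (H l) i) \<alpha>) =
        (\<Sum>l<k. if l = weighted_degree w \<alpha> + d i then mcoeff (a i) \<alpha> else 0)"
        by (rule sum.cong) (auto simp: a_def A0)
      with nz lt show False by simp
    qed
    have "h - lincomb B mmonom c = (\<Sum>i\<in>S. a i * f i)"
    proof (rule mfps_eqI)
      fix \<alpha>
      let ?D = "\<Sum>i\<in>S. d i"
      \<comment> \<open>Enough stages to see the coefficient at \<alpha>: \<open>N\<close> exhausts
        the basis \<open>B\<close>, \<open>?D\<close> pushes the missing tails of all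
        \<open>a i\<close> beyond the weight of \<alpha>, and the remainder \<open>H ?k\<close>
        starts beyond it as well.\<close>
      let ?k = "weighted_degree w \<alpha> + ?D + N + 1"
      have all: "(\<Sum>l<?k. mb l (H l)) = lincomb B mmonom c"
        unfolding mb_sum by (rule lincomb_cong) (use B(1) in auto)
      have "h - lincomb B mmonom c - (\<Sum>i\<in>S. a i * f i) =
          H ?k - (\<Sum>i\<in>S. (a i - (\<Sum>l<?k. A l (H l) i)) * f i)"
        using partial[of ?k] unfolding all by (simp add: algebra_simps sum_subtractf)
      moreover have "ordge w (weighted_degree w \<alpha> + 1) (H ?k)" by (rule ordge_mono[OF ordH]) simp
      moreover have "ordge w (weighted_degree w \<alpha> + 1) ((a i - (\<Sum>l<?k. A l (H l) i)) * f i)" if "i \<in> S" for i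
      proof -
        have "d i \<le> ?D" using fin that by (intro member_le_sum) auto
        then have "weighted_degree w \<alpha> + 1 \<le> ?k - d i" by simp
        from ordge_mult[OF ordge_mono[OF a_tail[OF that] this] ordge_zero[of w "f i"]]
        show ?thesis by simp
      qed
      then have "ordge w (weighted_degree w \<alpha> + 1) (\<Sum>i\<in>S. (a i - (\<Sum>l<?k. A l (H l) i)) * f i)"
        by (rule ordge_sum)
      ultimately have "ordge w (weighted_degree w \<alpha> + 1) (h - lincomb B mmonom c - (\<Sum>i\<in>S. a i * f i))"
        using mideal_diff[OF mideal_ordge, of _ w "weighted_degree w \<alpha> + 1"] by auto
      then have "mcoeff (h - lincomb B mmonom c - (\<Sum>i\<in>S. a i * f i)) \<alpha> = 0"
        unfolding ordge_def by fastforce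
      then show "mcoeff (h - lincomb B mmonom c) \<alpha> = mcoeff (\<Sum>i\<in>S. a i * f i) \<alpha>" by simp
    qed
    then show "\<exists>c. h - lincomb B mmonom c \<in> gen S f" unfolding gen_def by blast
  qed
  show "finite_codim (gen S f)" by (rule spans_finite_codim[OF finB sp])
  show "codim (gen S f) \<le> codim (gen S g)"
    using spans_codim_le[OF finB sp] codim_eqI[OF J' finB B(2,3)] by simp
qed

end

section \<open>The Milnor number as a codimension\<close>

lemma mfps_ring_simps [simp]:
  "carrier mfps_ring = UNIV" "x \<otimes>\<^bsub>mfps_ring\<^esub> y = x * y" "x \<oplus>\<^bsub>mfps_ring\<^esub> y = x + y"
  "\<one>\<^bsub>mfps_ring\<^esub> = 1" "\<zero>\<^bsub>mfps_ring\<^esub> = 0"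
  by (simp_all add: mfps_ring_def)

lemma ring_mfps_ring: "ring (mfps_ring :: ('k::comm_ring_1, 'n::finite) mfps ring)"
  using cring_mfps_ring by (rule cring.axioms(1))

lemma ideal_mfps_ring_iff: "ideal I mfps_ring \<longleftrightarrow> mideal (I :: ('k::comm_ring_1, 'n::finite) mfps set)"
proof
  assume "ideal I mfps_ring"
  then interpret ideal I mfps_ring .
  show "mideal I"
    unfolding mideal_def
    using additive_subgroup.zero_closed[OF is_additive_subgroup]
      additive_subgroup.a_closed[OF is_additive_subgroup] I_l_closed by simp
next
  assume I: "mideal I"
  interpret R: ring "mfps_ring :: ('k, 'n) mfps ring" by (rule ring_mfps_ring)
  show "ideal I mfps_ring"
  proof (rule idealI[OF ring_mfps_ring])
    show "subgroup I (add_monoid mfps_ring)"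
    proof (rule R.add.subgroupI)
      show "I \<noteq> {}" using mideal_zero[OF I] by blast
    next
      fix a assume a: "a \<in> I"
      have "\<ominus>\<^bsub>mfps_ring\<^esub> a = - a" by (rule R.minus_equality) auto
      then show "\<ominus>\<^bsub>mfps_ring\<^esub> a \<in> I" using mideal_uminus[OF I a] by simp
    qed (use mideal_add[OF I] in auto)
  qed (use mideal_mult[OF I] mideal_mult_right[OF I] in auto)
qed

lemma jacobian_ideal_eq_gen: "jacobian_ideal f = gen UNIV (\<lambda>i. mderiv i f)"
proof -
  let ?J = "gen UNIV (\<lambda>i. mderiv i f)"
  have "mideal ?J" by (rule mideal_gen) simp
  moreover have "range (\<lambda>i. mderiv i f) \<subseteq> ?J"
    using gen_memI[of UNIV _ "\<lambda>i. mderiv i f"] by auto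
  moreover have "?J \<subseteq> I" if "mideal I" "range (\<lambda>i. mderiv i f) \<subseteq> I" for I
    using that by (intro gen_subset) auto
  ultimately show ?thesis
    unfolding jacobian_ideal_def genideal_def ideal_mfps_ring_iff by blast
qed

section \<open>Dimension of the Milnor algebra through representatives\<close>

definition mcoset :: "('k::comm_ring_1, 'n::finite) mfps set \<Rightarrow> ('k, 'n) mfps \<Rightarrow> ('k, 'n) mfps set" where
  "mcoset J a = J +>\<^bsub>mfps_ring\<^esub> a"

lemma mcoset_eq: "mcoset J a = (\<lambda>j. j + a) ` J"
  unfolding mcoset_def a_r_coset_def' by auto

lemma mcoset_eq_iff:
  assumes "mideal J"
  shows "mcoset J a = mcoset J b \<longleftrightarrow> a - b \<in> J"
proof
  assume eq: "mcoset J a = mcoset J b"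
  have "a \<in> mcoset J a" unfolding mcoset_eq using mideal_zero[OF assms] by (intro image_eqI[of _ _ 0]) auto
  then have "a \<in> mcoset J b" unfolding eq .
  then show "a - b \<in> J" by (auto simp: mcoset_eq)
next
  have sub: "mcoset J a \<subseteq> mcoset J b" if ab: "a - b \<in> J" for a b
  proof
    fix x assume "x \<in> mcoset J a"
    then obtain j where j: "j \<in> J" "x = j + a" by (auto simp: mcoset_eq)
    have "j + (a - b) \<in> J" using mideal_add[OF assms j(1) ab] .
    then show "x \<in> mcoset J b" unfolding mcoset_eq by (rule image_eqI[rotated]) (simp add: j)
  qed
  assume "a - b \<in> J"
  moreover from this have "b - a \<in> J" using mideal_uminus[OF assms, of "a - b"] by simp
  ultimately show "mcoset J a = mcoset J b" using sub by blast
qed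

text \<open>Mirrors \<open>line_extension\<close>, by which \<open>ring.dimension\<close> builds up
  a space one vector at a time; \<open>indep_Suc\<close> mirrors the condition that the new vector
  lies outside the old space.\<close>

lemma lspan_Suc: "lspan {..<Suc n} b = {mconst c * b n + x | c x. x \<in> lspan {..<n} b}"
proof (intro subset_antisym subsetI)
  fix h assume "h \<in> lspan {..<Suc n} b"
  then obtain c where "h = lincomb {..<Suc n} b c" by (auto simp: lspan_def)
  then have "h = mconst (c n) * b n + lincomb {..<n} b c" unfolding lincomb_def lessThan_Suc by simp
  then show "h \<in> {mconst c * b n + x | c x. x \<in> lspan {..<n} b}" by (auto simp: lspan_def)
next
  fix h assume "h \<in> {mconst c * b n + x | c x. x \<in> lspan {..<n} b}"
  then obtain a c where h: "h = mconst a * b n + lincomb {..<n} b c" by (auto simp: lspan_def)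
  have "lincomb {..<n} b (c(n := a)) = lincomb {..<n} b c" by (rule lincomb_cong) auto
  then have "h = lincomb {..<Suc n} b (c(n := a))" unfolding h by (simp add: lincomb_def lessThan_Suc)
  then show "h \<in> lspan {..<Suc n} b" by (auto simp: lspan_def)
qed

lemma indep_Suc:
  fixes J :: "('k::field, 'n::finite) mfps set"
  assumes J: "mideal J"
  shows "indep J {..<Suc n} b \<longleftrightarrow> indep J {..<n} b \<and> (\<forall>x\<in>lspan {..<n} b. b n - x \<notin> J)"
proof (intro iffI conjI ballI)
  have lc: "lincomb {..<Suc n} b c = mconst (c n) * b n + lincomb {..<n} b c" for c
    by (simp add: lincomb_def lessThan_Suc)
  {
    assume ind: "indep J {..<Suc n} b"
    show "indep J {..<n} b"
      unfolding indep_def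
    proof (intro allI impI)
      fix c assume c: "lincomb {..<n} b c \<in> J"
      have "lincomb {..<n} b (c(n := 0)) = lincomb {..<n} b c" by (rule lincomb_cong) auto
      then have "lincomb {..<Suc n} b (c(n := 0)) \<in> J" using c unfolding lc by simp
      with ind have "\<forall>i\<in>{..<Suc n}. (c(n := 0)) i = 0" unfolding indep_def by blast
      then show "\<forall>i\<in>{..<n}. c i = 0" by (auto simp: less_Suc_eq split: if_splits)
    qed
    fix x assume "x \<in> lspan {..<n} b"
    then obtain c where x: "x = lincomb {..<n} b c" by (auto simp: lspan_def)
    show "b n - x \<notin> J"
    proof
      assume bx: "b n - x \<in> J"
      let ?c = "(\<lambda>i. - c i)(n := 1)"
      have "lincomb {..<n} b ?c = lincomb {..<n} b (\<lambda>i. 0 - c i)" by (rule lincomb_cong) auto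
      also have "\<dots> = - x" unfolding lincomb_diff x by simp
      finally have "lincomb {..<Suc n} b ?c \<in> J" using bx unfolding lc by simp
      with ind have "\<forall>i\<in>{..<Suc n}. ?c i = 0" unfolding indep_def by blast
      then have "?c n = 0" by blast
      then show False by simp
    qed
  }
  assume *: "indep J {..<n} b \<and> (\<forall>x\<in>lspan {..<n} b. b n - x \<notin> J)"
  show "indep J {..<Suc n} b"
    unfolding indep_def
  proof (intro allI impI)
    fix c assume c: "lincomb {..<Suc n} b c \<in> J"
    have "c n = 0"
    proof (rule ccontr)
      assume nz: "c n \<noteq> 0"
      have "mconst (inverse (c n)) * lincomb {..<Suc n} b c \<in> J" using c by (rule mideal_mult[OF J])
      also have "mconst (inverse (c n)) * lincomb {..<Suc n} b c = b n - lincomb {..<n} b (\<lambda>i. - inverse (c n) * c i)"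
        unfolding lc lincomb_scale using nz
        by (simp add: distrib_left mult.assoc[symmetric] mconst_mult[symmetric] mconst_uminus)
      finally show False using * by (auto simp: lspan_def)
    qed
    then have "lincomb {..<n} b c \<in> J" using c unfolding lc by simp
    with * \<open>c n = 0\<close> show "\<forall>i\<in>{..<Suc n}. c i = 0" unfolding indep_def by (auto simp: less_Suc_eq)
  qed
qed

context
  fixes f :: "('k::field, 'n::finite) mfps"
begin

private abbreviation "J \<equiv> jacobian_ideal f"

private lemma mideal_J: "mideal J"
  unfolding jacobian_ideal_eq_gen by (rule mideal_gen) simp

private lemma ideal_J: "ideal J mfps_ring"
  unfolding ideal_mfps_ring_iff by (rule mideal_J)

lemma ring_milnor_algebra: "ring (milnor_algebra f)"
  unfolding milnor_algebra_def by (rule ideal.quotient_is_ring[OF ideal_J])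

lemma carrier_milnor: "carrier (milnor_algebra f) = range (mcoset J)"
  unfolding milnor_algebra_def FactRing_def A_RCOSETS_def' mcoset_def by auto

lemma milnor_algebra_simps:
  "mcoset J a \<oplus>\<^bsub>milnor_algebra f\<^esub> mcoset J b = mcoset J (a + b)"
  "mcoset J a \<otimes>\<^bsub>milnor_algebra f\<^esub> mcoset J b = mcoset J (a * b)"
  "\<zero>\<^bsub>milnor_algebra f\<^esub> = mcoset J 0"
proof -
  interpret ideal J mfps_ring by (rule ideal_J)
  show "mcoset J a \<oplus>\<^bsub>milnor_algebra f\<^esub> mcoset J b = mcoset J (a + b)"
    unfolding milnor_algebra_def FactRing_def mcoset_def using a_rcos_sum[of a b] by simp
  show "mcoset J a \<otimes>\<^bsub>milnor_algebra f\<^esub> mcoset J b = mcoset J (a * b)"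
    unfolding milnor_algebra_def FactRing_def mcoset_def using rcoset_mult_add[of a b] by simp
  show "\<zero>\<^bsub>milnor_algebra f\<^esub> = mcoset J 0"
    unfolding milnor_algebra_def FactRing_def mcoset_eq by simp
qed

lemma line_extension_milnor:
  "ring.line_extension (milnor_algebra f) (milnor_scalars f) (mcoset J v) (mcoset J ` X) =
     mcoset J ` {mconst c * v + x | c x. x \<in> X}"
proof -
  have "milnor_scalars f = range (\<lambda>c. mcoset J (mconst c))"
    by (simp add: milnor_scalars_def mcoset_def)
  then have 1: "milnor_scalars f #>\<^bsub>milnor_algebra f\<^esub> mcoset J v = range (\<lambda>c. mcoset J (mconst c * v))"
    unfolding r_coset_def by (auto simp: milnor_algebra_simps)
  show ?thesis
    unfolding ring.line_extension_def[OF ring_milnor_algebra] 1 set_add_def'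
    by (auto simp: milnor_algebra_simps)
qed

lemma mcoset_mem_iff: "mcoset J v \<in> mcoset J ` X \<longleftrightarrow> (\<exists>x\<in>X. v - x \<in> J)"
  by (auto simp: mcoset_eq_iff[OF mideal_J])

lemma dimension_milnor_iff:
  "ring.dimension (milnor_algebra f) n (milnor_scalars f) E \<longleftrightarrow>
     (\<exists>b :: nat \<Rightarrow> _. indep J {..<n} b \<and> E = mcoset J ` lspan {..<n} b)"
proof -
  interpret M: ring "milnor_algebra f" by (rule ring_milnor_algebra)
  have "\<exists>b :: nat \<Rightarrow> _. indep J {..<n} b \<and> E = mcoset J ` lspan {..<n} b"
    if "M.dimension n (milnor_scalars f) E"
    using that
  proof (induction n "milnor_scalars f" E rule: M.dimension.induct)
    case zero_dim
    show ?case by (intro exI[of _ "\<lambda>_. 0"]) (auto simp: indep_def lspan_def lincomb_def milnor_algebra_simps)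
  next
    case (Suc_dim v E n)
    from Suc_dim obtain b :: "nat \<Rightarrow> _" where b: "indep J {..<n} b" "E = mcoset J ` lspan {..<n} b" by blast
    from Suc_dim obtain a where a: "v = mcoset J a" by (auto simp: carrier_milnor)
    have lc: "lincomb {..<n} (b(n := a)) c = lincomb {..<n} b c" for c by (rule lincomb_cong) auto
    then have lb: "lspan {..<n} (b(n := a)) = lspan {..<n} b" unfolding lspan_def by simp
    have "\<forall>x\<in>lspan {..<n} b. a - x \<notin> J"
      using \<open>v \<notin> E\<close> unfolding a b(2) mcoset_mem_iff by blast
    moreover have "indep J {..<n} (b(n := a))"
      using b(1) unfolding indep_def lc .
    ultimately have "indep J {..<Suc n} (b(n := a))"
      unfolding indep_Suc[OF mideal_J] lb by simp
    moreover have "M.line_extension (milnor_scalars f) v E = mcoset J ` lspan {..<Suc n} (b(n := a))"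
      unfolding a b(2) line_extension_milnor lspan_Suc lb by simp
    ultimately show ?case by blast
  qed
  moreover have "M.dimension n (milnor_scalars f) (mcoset J ` lspan {..<n} b)" if "indep J {..<n} b" for b :: "nat \<Rightarrow> _"
    using that
  proof (induction n)
    case 0
    have "mcoset J ` lspan {..<0} b = {\<zero>\<^bsub>milnor_algebra f\<^esub>}"
      by (auto simp: lspan_def lincomb_def milnor_algebra_simps)
    then show ?case using M.zero_dim by metis
  next
    case (Suc n)
    then have b: "indep J {..<n} b" "\<forall>x\<in>lspan {..<n} b. b n - x \<notin> J"
      unfolding indep_Suc[OF mideal_J] by auto
    have "mcoset J (b n) \<notin> mcoset J ` lspan {..<n} b" using b(2) unfolding mcoset_mem_iff by blast
    then have "M.dimension (Suc n) (milnor_scalars f)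
        (M.line_extension (milnor_scalars f) (mcoset J (b n)) (mcoset J ` lspan {..<n} b))"
      using Suc.IH[OF b(1)] by (intro M.Suc_dim) (auto simp: carrier_milnor)
    then show ?case unfolding line_extension_milnor lspan_Suc .
  qed
  ultimately show ?thesis by blast
qed

text \<open>Uniqueness of the dimension comes from \<open>codim_eqI\<close>, which also covers the
  unit ideal, where the scalars do not form a subfield.\<close>

lemma milnor_number_eq: "milnor_number f = (if finite_codim J then enat (codim J) else \<infinity>)"
proof -
  interpret M: ring "milnor_algebra f" by (rule ring_milnor_algebra)
  let ?D = "\<lambda>n. M.dimension n (milnor_scalars f) (carrier (milnor_algebra f))"
  have carrier: "carrier (milnor_algebra f) = mcoset J ` lspan {..<n} b \<longleftrightarrow> spans J {..<n} b"
    for n and b :: "nat \<Rightarrow> _"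
  proof -
    have "carrier (milnor_algebra f) = mcoset J ` lspan {..<n} b \<longleftrightarrow> (\<forall>h. mcoset J h \<in> mcoset J ` lspan {..<n} b)"
      unfolding carrier_milnor by auto
    also have "\<dots> \<longleftrightarrow> spans J {..<n} b"
      unfolding mcoset_mem_iff spans_def lspan_def by blast
    finally show ?thesis .
  qed
  have D: "?D n \<longleftrightarrow> (\<exists>b :: nat \<Rightarrow> _. indep J {..<n} b \<and> spans J {..<n} b)" for n
    unfolding dimension_milnor_iff carrier ..
  have D_codim: "n = codim J" if "?D n" for n
    using that unfolding D using codim_eqI[OF mideal_J, of "{..<n}"] by auto
  show ?thesis
  proof (cases "finite_codim J")
    case True
    then have "?D (codim J)" unfolding D using finite_codim_obtain_basis[OF True mideal_J] by metis
    then have "M.finite_dimension (milnor_scalars f) (carrier (milnor_algebra f))"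
      "M.dim (milnor_scalars f) (carrier (milnor_algebra f)) = codim J"
      unfolding M.finite_dimension_def M.dim_def using D_codim by (blast, blast intro: the_equality)
    then show ?thesis using True unfolding milnor_number_def by simp
  next
    case False
    then have "\<not> ?D n" for n unfolding D using spans_finite_codim[of "{..<n}"] by blast
    then have "\<not> M.finite_dimension (milnor_scalars f) (carrier (milnor_algebra f))"
      unfolding M.finite_dimension_def by blast
    then show ?thesis using False unfolding milnor_number_def by simp
  qed
qed

end

section \<open>C-polytopes with a single facet\<close>

definition wdot :: "nat ^ 'n::finite \<Rightarrow> real ^ 'n \<Rightarrow> real" where
  "wdot w x = (\<Sum>i\<in>UNIV. real (w $ i) * x $ i)"

lemma wdot_scale: "wdot w (t *\<^sub>R x) = t * wdot w x"
  by (simp add: wdot_def sum_distrib_left algebra_simps)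

lemma wdot_add: "wdot w (x + y) = wdot w x + wdot w y"
  by (simp add: wdot_def sum.distrib algebra_simps)

lemma wdot_axis: "wdot w (axis i c) = real (w $ i) * c"
proof -
  have "wdot w (axis i c) = (\<Sum>j\<in>UNIV. if j = i then real (w $ i) * c else 0)"
    unfolding wdot_def by (rule sum.cong) (auto simp: axis_def)
  then show ?thesis by simp
qed

context
  fixes P :: "(real ^ 'n::finite) set"
  assumes C: "C_polytope P"
begin

lemma C_polytope_subset: "P \<subseteq> orthant" and C_polytope_zero: "0 \<notin> P"
  and C_polytope_convex: "convex (region_above P)"
  using C by (auto simp: C_polytope_def)

lemma C_polytope_ray:
  assumes "x \<in> P" "y \<in> P" "y = t *\<^sub>R x" "0 \<le> t"
  shows "t = 1"
proof -
  have x: "x \<in> orthant" "x \<noteq> 0" using assms C_polytope_subset C_polytope_zero by auto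
  then have "\<exists>!z. z \<in> P \<and> z \<in> {t *\<^sub>R x | t. 0 \<le> t}" using C unfolding C_polytope_def by blast
  moreover have "x = 1 *\<^sub>R x \<and> (0 :: real) \<le> 1" by simp
  then have "x \<in> {t *\<^sub>R x | t. 0 \<le> t}" by blast
  moreover have "y \<in> {t *\<^sub>R x | t. 0 \<le> t}" using assms by auto
  ultimately have "y = x" using assms by blast
  with assms(3) have "(t - 1) *\<^sub>R x = 0" by (simp add: scaleR_diff_left)
  with x show ?thesis by simp
qed

lemma C_polytope_exists_ray:
  assumes "x \<in> orthant" "x \<noteq> 0"
  obtains t where "0 \<le> t" "t *\<^sub>R x \<in> P"
  using assms C unfolding C_polytope_def by blast

lemma P_subset_region: "P \<subseteq> region_above P"
proof
  fix x assume "x \<in> P"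
  then have "x = 1 *\<^sub>R x \<and> (1 :: real) \<le> 1 \<and> x \<in> P" by simp
  then show "x \<in> region_above P" unfolding region_above_def by blast
qed

lemma double_mem_region:
  assumes "x \<in> P"
  shows "2 *\<^sub>R x \<in> region_above P"
proof -
  have "2 *\<^sub>R x = 2 *\<^sub>R x \<and> (1 :: real) \<le> 2 \<and> x \<in> P" using assms by simp
  then show ?thesis unfolding region_above_def by blast
qed

lemma region_aboveE:
  assumes "y \<in> region_above P"
  obtains t x where "1 \<le> t" "x \<in> P" "y = t *\<^sub>R x"
  using assms unfolding region_above_def by auto

text \<open>Otherwise the segment from \<open>2 *\<^sub>R x\<close> through \<open>x\<close> could
  be prolonged inside the region to \<open>(2 - e) *\<^sub>R x\<close> with \<open>e > 1\<close>,
  which lies strictly before \<open>P\<close> on its ray or outside the orthant.\<close>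

lemma not_mem_rel_interior_region:
  assumes x: "x \<in> P"
  shows "x \<notin> rel_interior (region_above P)"
proof
  assume "x \<in> rel_interior (region_above P)"
  moreover note double_mem_region[OF x]
  ultimately obtain e where e: "e > 1" "(1 - e) *\<^sub>R 2 *\<^sub>R x + e *\<^sub>R x \<in> region_above P"
    using convex_rel_interior_iff[OF C_polytope_convex] by blast
  from e(2) obtain s y where s: "1 \<le> s" "y \<in> P" "(1 - e) *\<^sub>R 2 *\<^sub>R x + e *\<^sub>R x = s *\<^sub>R y" by (rule region_aboveE)
  have "(1 - e) * 2 + e = 2 - e" by simp
  then have "(1 - e) *\<^sub>R 2 *\<^sub>R x + e *\<^sub>R x = (2 - e) *\<^sub>R x"
    by (simp only: scaleR_scaleR scaleR_add_left[symmetric])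
  then have sy: "s *\<^sub>R y = (2 - e) *\<^sub>R x" using s by simp
  then have "(1 / s) *\<^sub>R s *\<^sub>R y = (1 / s) *\<^sub>R (2 - e) *\<^sub>R x" by (rule arg_cong)
  then have y: "y = ((2 - e) / s) *\<^sub>R x" using s(1) by simp
  show False
  proof (cases "e \<le> 2")
    case True
    with s(1) have "(2 - e) / s = 1" by (intro C_polytope_ray[OF x s(2) y]) simp
    with s(1) e(1) show False by (simp add: field_simps)
  next
    case False
    \<comment> \<open>Here \<open>2 - e\<close> is negative, and a negative multiple of a point of
      the orthant lies in the orthant only if it is 0.\<close>
    have "y = 0"
    proof (subst vec_eq_iff, intro allI)
      fix i
      have "0 \<le> y $ i" "0 \<le> x $ i" using x s(2) C_polytope_subset by (auto simp: orthant_def)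
      moreover have "s * y $ i = (2 - e) * x $ i" using sy by (simp add: vec_eq_iff)
      moreover have "(2 - e) * x $ i \<le> 0" using False \<open>0 \<le> x $ i\<close> by (intro mult_nonpos_nonneg) auto
      ultimately have "0 \<le> y $ i" "s * y $ i \<le> 0" by linarith+
      then show "y $ i = 0 $ i" using s(1) by (simp add: mult_le_0_iff)
    qed
    with s(2) C_polytope_zero show False by simp
  qed
qed

text \<open>The facet is cut out by a supporting hyperplane of the region above \<open>P\<close>, which cannot contain 0.\<close>

lemma piece_subset_facet:
  assumes F: "F \<subseteq> P" "convex F" "aff_dim F = int CARD('n) - 1"
  shows "\<exists>\<Delta>\<in>polytope_facets P. F \<subseteq> \<Delta>"
proof -
  have "F \<noteq> {}" using F(3) by auto
  then obtain x where x: "x \<in> rel_interior F" using rel_interior_eq_empty[OF F(2)] by blast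
  then have xF: "x \<in> F" using rel_interior_subset by blast
  then have xP: "x \<in> P" using F(1) by blast
  obtain a where a: "a \<noteq> 0" "\<And>y. y \<in> region_above P \<Longrightarrow> a \<bullet> x \<le> a \<bullet> y"
    using supporting_hyperplane_rel_boundary[OF C_polytope_convex subsetD[OF P_subset_region xP] not_mem_rel_interior_region[OF xP]]
    by metis
  have F_eq: "a \<bullet> y = a \<bullet> x" if yF: "y \<in> F" for y
  proof -
    obtain e where e: "e > 1" "(1 - e) *\<^sub>R y + e *\<^sub>R x \<in> F"
      using bspec[OF iffD1[OF convex_rel_interior_iff[OF F(2) \<open>F \<noteq> {}\<close>] x] yF] by blast
    then have "a \<bullet> x \<le> a \<bullet> ((1 - e) *\<^sub>R y + e *\<^sub>R x)" using F(1) P_subset_region by (intro a(2)) blast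
    also have "\<dots> = a \<bullet> x + (e - 1) * (a \<bullet> x - a \<bullet> y)" by (simp add: inner_add_right algebra_simps)
    finally have "a \<bullet> y \<le> a \<bullet> x" using e(1) by (simp add: zero_le_mult_iff)
    moreover have "a \<bullet> x \<le> a \<bullet> y" using that F(1) P_subset_region by (intro a(2)) blast
    ultimately show ?thesis by simp
  qed
  \<comment> \<open>A hyperplane through 0 would be the affine hull of \<open>F\<close> and contain
    the ray through \<open>x\<close>; a piece of that ray around \<open>x\<close> would lie in
    \<open>F\<close>, although \<open>P\<close> meets each ray only once.\<close>
  have nz: "a \<bullet> x \<noteq> 0"
  proof
    assume 0: "a \<bullet> x = 0"
    have "affine hull F = {y. a \<bullet> y = 0}"
    proof (rule affine_dim_equal)
      show "affine hull F \<subseteq> {y. a \<bullet> y = 0}"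
        using F_eq 0 by (intro hull_minimal affine_hyperplane) auto
      show "aff_dim (affine hull F) = aff_dim {y. a \<bullet> y = 0}"
        using F(3) a(1) by simp
    qed (use \<open>F \<noteq> {}\<close> affine_hyperplane in auto)
    then have aff: "t *\<^sub>R x \<in> affine hull F" for t using 0 by simp
    obtain e where e: "e > 0" "ball x e \<inter> affine hull F \<subseteq> F" using x mem_rel_interior_ball by blast
    have x0: "x \<noteq> 0" using xP C_polytope_zero by auto
    define t where "t = 1 + e / (2 * norm x)"
    have "x - t *\<^sub>R x = (- (e / (2 * norm x))) *\<^sub>R x" by (simp add: t_def algebra_simps)
    then have "dist x (t *\<^sub>R x) = e / 2" using x0 e(1) by (simp add: dist_norm)
    then have "t *\<^sub>R x \<in> F" using e aff[of t] by (auto simp: dist_commute)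
    then have "t = 1" using F(1) xP e(1) x0 by (intro C_polytope_ray[OF xP _ refl]) (auto simp: t_def)
    then show False using e(1) x0 by (simp add: t_def)
  qed
  from a(2)[OF double_mem_region[OF xP]] nz have pos: "a \<bullet> x > 0" by simp
  define \<Delta> where "\<Delta> = region_above P \<inter> {y. a \<bullet> y = a \<bullet> x}"
  have F\<Delta>: "F \<subseteq> \<Delta>" using F(1) P_subset_region F_eq by (auto simp: \<Delta>_def)
  have "\<Delta> face_of region_above P"
    unfolding \<Delta>_def by (rule face_of_Int_supporting_hyperplane_ge[OF C_polytope_convex a(2)])
  \<comment> \<open>\<open>a \<bullet> x\<close> is positive and minimal on the region, so scaling a
    point of \<open>P\<close> by a factor above 1 leads off the hyperplane.\<close>
  moreover have "\<Delta> \<subseteq> P"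
  proof
    fix y assume y: "y \<in> \<Delta>"
    then obtain t z where t: "1 \<le> t" "z \<in> P" "y = t *\<^sub>R z" by (auto simp: \<Delta>_def elim: region_aboveE)
    have "a \<bullet> x \<le> a \<bullet> z" using t(2) P_subset_region by (intro a(2)) blast
    moreover have "t * (a \<bullet> z) = a \<bullet> x" using y t by (simp add: \<Delta>_def)
    ultimately have "t * (a \<bullet> x) \<le> a \<bullet> x" using t(1) mult_left_mono[of "a \<bullet> x" "a \<bullet> z" t] by simp
    with t(1) pos have "t = 1" by (simp add: mult_le_cancel_right1)
    with t show "y \<in> P" by simp
  qed
  moreover have "aff_dim \<Delta> = int CARD('n) - 1"
  proof (rule antisym)
    have "aff_dim \<Delta> \<le> aff_dim {y. a \<bullet> y = a \<bullet> x}" by (rule aff_dim_subset) (auto simp: \<Delta>_def)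
    then show "aff_dim \<Delta> \<le> int CARD('n) - 1" using a(1) by simp
    show "int CARD('n) - 1 \<le> aff_dim \<Delta>" using aff_dim_subset[OF F\<Delta>] F(3) by simp
  qed
  ultimately have "\<Delta> \<in> polytope_facets P"
    unfolding polytope_facets_def polytope_face_def using F\<Delta> \<open>F \<noteq> {}\<close> by auto
  with F\<Delta> show ?thesis by blast
qed

section \<open>The simplex cut out by a single facet\<close>

context
  fixes \<Delta> :: "(real ^ 'n) set" and w :: "nat ^ 'n"
  assumes facet: "polytope_facets P = {\<Delta>}" and w: "\<forall>i. 0 < w $ i" and weight: "has_weight_vector \<Delta> w"
begin

text \<open>\<open>P\<close> is a union of pieces of dimension \<open>n - 1\<close>, each piece lies
  in a facet, and there is only one facet.\<close>

lemma facet_eq: "P = \<Delta>"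
proof
  obtain \<F> where \<F>: "P = \<Union>\<F>" "\<And>F. F \<in> \<F> \<Longrightarrow> rational_polytope F" "\<And>F. F \<in> \<F> \<Longrightarrow> aff_dim F = int CARD('n) - 1"
    using C unfolding C_polytope_def by blast
  show "P \<subseteq> \<Delta>"
  proof
    fix x assume "x \<in> P"
    then obtain F where F: "F \<in> \<F>" "x \<in> F" using \<F>(1) by blast
    have "convex F" using \<F>(2)[OF F(1)] by (auto simp: rational_polytope_def)
    then obtain \<Delta>' where "\<Delta>' \<in> polytope_facets P" "F \<subseteq> \<Delta>'"
      using piece_subset_facet[of F] \<F>(1,3) F(1) by blast
    with facet F(2) show "x \<in> \<Delta>" by auto
  qed
  show "\<Delta> \<subseteq> P" using facet by (auto simp: polytope_facets_def polytope_face_def)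
qed

text \<open>For the inclusion of the simplex in \<open>P\<close>: the ray through a point of it
  meets \<open>P\<close>, and the value of \<open>wdot w\<close> forces the scaling factor to be
  1.\<close>

lemma obtain_simplex:
  obtains d where "0 < d" "P = {x \<in> orthant. wdot w x = d}"
proof -
  obtain d where d: "0 < d" "\<And>x. x \<in> P \<Longrightarrow> wdot w x = d"
    using weight unfolding has_weight_vector_def facet_eq wdot_def by blast
  have "P = {x \<in> orthant. wdot w x = d}"
  proof (intro subset_antisym subsetI)
    fix x assume "x \<in> P"
    then show "x \<in> {x \<in> orthant. wdot w x = d}" using d C_polytope_subset by auto
  next
    fix x assume x: "x \<in> {x \<in> orthant. wdot w x = d}"
    then have "x \<noteq> 0" using d(1) by (auto simp: wdot_def)
    with x obtain t where t: "0 \<le> t" "t *\<^sub>R x \<in> P" using C_polytope_exists_ray by blast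
    from d(2)[OF t(2)] x have "t * d = d" by (simp add: wdot_scale)
    with d(1) t(2) show "x \<in> P" by simp
  qed
  with d(1) show ?thesis by (rule that)
qed

lemma vertex_mem:
  assumes "P = {x \<in> orthant. wdot w x = d}" "0 < d"
  shows "axis i (d / real (w $ i)) \<in> P"
  using assms w by (auto simp: orthant_def axis_def wdot_axis[unfolded axis_def])

text \<open>An inner face has, for each \<open>i\<close>, a point with nonzero \<open>i\<close>-th
  coordinate. The average of these points lies in the relative interior of the simplex, and a face
  containing such a point is everything.\<close>

lemma inner_face_iff: "inner_face P G \<longleftrightarrow> G = P"
proof
  obtain d where d: "0 < d" and P: "P = {x \<in> orthant. wdot w x = d}" using obtain_simplex by blast
  {
    assume "G = P"
    have "polytope_face P P" using facet facet_eq by (auto simp: polytope_facets_def)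
    moreover have "\<not> P \<subseteq> {x. x $ i = 0}" for i
    proof
      assume "P \<subseteq> {x. x $ i = 0}"
      with vertex_mem[OF P d, of i] have "axis i (d / real (w $ i)) $ i = 0" by blast
      with d w show False by (simp add: axis_def) (metis less_irrefl)
    qed
    ultimately show "inner_face P G" unfolding inner_face_def \<open>G = P\<close> by blast
  }
  assume G: "inner_face P G"
  then have face: "G face_of region_above P" and GP: "G \<subseteq> P" by (auto simp: inner_face_def polytope_face_def)
  have "\<exists>x. x \<in> G \<and> x $ i \<noteq> 0" for i using G by (auto simp: inner_face_def)
  then obtain x where x: "\<And>i. x i \<in> G" "\<And>i. x i $ i \<noteq> 0" by metis
  define y where "y = (\<Sum>i\<in>UNIV. (1 / real CARD('n)) *\<^sub>R x i)"
  have yG: "y \<in> G" unfolding y_def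
    using x(1) face_of_imp_convex[OF face] by (intro convex_sum) auto
  have nonneg: "0 \<le> x i $ j" for i j using x(1)[of i] GP C_polytope_subset by (auto simp: orthant_def)
  have y_pos: "0 < y $ j" for j
  proof -
    have "0 < (1 / real CARD('n)) * x j $ j" using nonneg[of j j] x(2)[of j] by simp
    also have "\<dots> \<le> (\<Sum>i\<in>UNIV. (1 / real CARD('n)) * x i $ j)"
      by (rule member_le_sum) (auto simp: nonneg)
    finally show ?thesis by (simp add: y_def)
  qed
  have yP: "y \<in> P" using yG GP by blast
  show "G = P"
  proof (intro subset_antisym GP subsetI)
    fix z assume z: "z \<in> P"
    show "z \<in> G"
    proof (cases "z = y")
      case False
      \<comment> \<open>\<open>u\<close> will prolong the segment from \<open>z\<close> through
        \<open>y\<close>; \<open>e\<close> is small enough to keep \<open>u\<close> in the orthant,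
        and the added 1 keeps the denominators positive.\<close>
      define e where "e = Min (range (\<lambda>i. y $ i / (z $ i + 1)))"
      have z0: "0 \<le> z $ i" for i using z C_polytope_subset by (auto simp: orthant_def)
      have "0 < y $ i / (z $ i + 1)" for i using y_pos[of i] z0[of i] by simp
      then have e0: "0 < e" unfolding e_def by (subst Min_gr_iff) auto
      have e: "e \<le> y $ i / (z $ i + 1)" for i unfolding e_def by (rule Min_le) auto
      define u where "u = y + e *\<^sub>R (y - z)"
      have "u \<in> orthant" unfolding orthant_def
      proof (intro CollectI allI)
        fix i
        have "e * (z $ i + 1) \<le> y $ i" using e[of i] z0[of i] by (simp add: pos_le_divide_eq)
        moreover have "0 \<le> e * y $ i" using e0 y_pos[of i] by simp
        ultimately show "0 \<le> u $ i" using e0 by (simp add: u_def algebra_simps)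
      qed
      moreover have "wdot w u = d"
      proof -
        have "u = (1 + e) *\<^sub>R y + (- e) *\<^sub>R z" by (simp add: u_def algebra_simps)
        then show ?thesis using yP z unfolding P by (simp only: wdot_add wdot_scale mem_Collect_eq) (simp add: algebra_simps)
      qed
      ultimately have "u \<in> P" unfolding P by simp
      have "y \<in> open_segment z u"
      proof -
        have "y = (1 - 1 / (1 + e)) *\<^sub>R z + (1 / (1 + e)) *\<^sub>R u"
        proof (subst vec_eq_iff, intro allI)
          fix i
          have "1 - 1 / (1 + e) = e / (1 + e)" using e0 by (simp add: field_simps)
          then have "((1 - 1 / (1 + e)) *\<^sub>R z + (1 / (1 + e)) *\<^sub>R u) $ i = (e * z $ i + u $ i) / (1 + e)"
            by (simp add: add_divide_distrib)
          also have "e * z $ i + u $ i = (1 + e) * y $ i" by (simp add: u_def algebra_simps)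
          also have "(1 + e) * y $ i / (1 + e) = y $ i" using e0 by simp
          finally show "y $ i = ((1 - 1 / (1 + e)) *\<^sub>R z + (1 / (1 + e)) *\<^sub>R u) $ i" ..
        qed
        moreover have "z \<noteq> u"
        proof
          assume "z = u"
          then have "(1 + e) *\<^sub>R (y - z) = 0" by (simp add: u_def algebra_simps)
          with False e0 show False by simp
        qed
        ultimately show ?thesis unfolding in_segment using e0 by (intro conjI exI[of _ "1 / (1 + e)"]) auto
      qed
      then show ?thesis
        using face yG z \<open>u \<in> P\<close> P_subset_region unfolding face_of_def by blast
    qed (use yG in simp)
  qed
qed

text \<open>The vertex on the \<open>i\<close>-th axis lies in \<open>coord_subspace q\<close> as
  soon as \<open>q $ i \<noteq> 0\<close>, while for \<open>q = 0\<close> only the origin is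
  left.\<close>

lemma facet_meets_coord_subspace_iff:
  fixes q :: "'k::zero ^ 'n"
  shows "P \<inter> coord_subspace q = {} \<longleftrightarrow> q = 0"
proof
  obtain d where d: "0 < d" and P: "P = {x \<in> orthant. wdot w x = d}" using obtain_simplex by blast
  assume e: "P \<inter> coord_subspace q = {}"
  show "q = 0"
  proof (subst vec_eq_iff, intro allI, rule ccontr)
    fix i assume "q $ i \<noteq> 0 $ i"
    then have "axis i (d / real (w $ i)) \<in> coord_subspace q"
      by (auto simp: coord_subspace_def axis_def)
    with vertex_mem[OF P d, of i] e show False by blast
  qed
next
  assume "q = 0"
  then have "coord_subspace q = {0}" by (auto simp: coord_subspace_def vec_eq_iff)
  then show "P \<inter> coord_subspace q = {}" using C_polytope_zero by simp
qed

lemma INND_iff: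
  "INND P f \<longleftrightarrow> no_point_below P f \<and> (\<forall>q. (\<forall>i. meval (mderiv i (in_face \<Delta> f)) q = 0) \<longrightarrow> q = 0)"
  unfolding INND_def IND_def inner_face_iff facet_eq[symmetric]
  by (simp add: facet_meets_coord_subspace_iff)

end
end

section \<open>Semi-quasihomogeneous power series\<close>

text \<open>Truncation of \<open>d - w $ i\<close> does no harm: for \<open>d < w $ i\<close> the
  derivative is 0.\<close>

lemma homog_mderiv:
  assumes "homog w d h"
  shows "homog w (d - w $ i) (mderiv i h)"
  unfolding homog_def
proof (intro allI impI)
  fix \<alpha> assume "mcoeff (mderiv i h) \<alpha> \<noteq> 0"
  then have "mcoeff h (\<alpha> + axis i 1) \<noteq> 0" by (auto simp: mcoeff_mderiv)
  from homogD[OF assms this] show "weighted_degree w \<alpha> = d - w $ i" by simp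
qed

lemma homog_in_weight: "\<exists>d. homog w d (in_weight w f)"
proof (cases "msupp (in_weight w f) = {}")
  case True
  then show ?thesis by (auto simp: homog_def msupp_def)
next
  case False
  then obtain \<beta> where \<beta>: "\<beta> \<in> msupp f" "\<forall>\<gamma>\<in>msupp f. weighted_degree w \<beta> \<le> weighted_degree w \<gamma>"
    by (auto simp: in_weight_def msupp_def split: if_splits)
  have "homog w (weighted_degree w \<beta>) (in_weight w f)"
    unfolding homog_def using \<beta> by (auto simp: in_weight_def intro: antisym split: if_splits)
  then show ?thesis by blast
qed

lemma rSQH_iff: "rSQH w f \<longleftrightarrow> finite_codim (gen UNIV (\<lambda>i. mderiv i (in_weight w f)))"
  unfolding rSQH_def milnor_number_eq jacobian_ideal_eq_gen by simp

lemma ordge_mderiv_diff: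
  assumes "ordge w (Suc d) (f - g)" "w $ i \<le> d"
  shows "ordge w (Suc (d - w $ i)) (mderiv i f - mderiv i g)"
  unfolding ordge_def
proof (intro allI impI)
  fix \<alpha> assume "mcoeff (mderiv i f - mderiv i g) \<alpha> \<noteq> 0"
  then have "of_nat (\<alpha> $ i + 1) * mcoeff (f - g) (\<alpha> + axis i 1) \<noteq> 0"
    by (simp add: mcoeff_mderiv algebra_simps)
  then have "mcoeff (f - g) (\<alpha> + axis i 1) \<noteq> 0" by auto
  with assms(1) have "Suc d \<le> weighted_degree w (\<alpha> + axis i 1)" unfolding ordge_def by blast
  with assms(2) show "Suc (d - w $ i) \<le> weighted_degree w \<alpha>" by simp
qed

context pos_weights
begin

text \<open>A zero member has every weighted order. Assigning it an order \<open>M\<close> above the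
  right-hand side of \<open>codim_lower_bound\<close> gives a contradiction, as the other factors
  are at least 1.\<close>

lemma finite_codim_homog_nonzero:
  fixes p :: "'n \<Rightarrow> ('k::field, 'n) mfps"
  assumes fc: "finite_codim (gen UNIV p)" and p: "\<And>i. p i \<noteq> 0 \<Longrightarrow> homog w (d i) (p i)"
    and d: "\<And>i. p i \<noteq> 0 \<Longrightarrow> 0 < d i"
  shows "p j \<noteq> 0"
proof
  assume j: "p j = 0"
  define M where "M = Suc (codim (gen UNIV p) * wprod)"
  define d' where "d' i = (if p i = 0 then M else d i)" for i
  have "ordge w (d' i) (p i)" for i using p[of i] by (auto simp: d'_def intro: homog_imp_ordge)
  from codim_lower_bound[of d' p, OF this fc]
  have le: "(\<Prod>i\<in>UNIV. d' i) \<le> codim (gen UNIV p) * wprod" .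
  have eq: "(\<Prod>i\<in>UNIV. d' i) = M * (\<Prod>i\<in>UNIV - {j}. d' i)"
    using prod.remove[of UNIV j d'] j by (simp add: d'_def)
  have "0 < (\<Prod>i\<in>UNIV - {j}. d' i)" using d by (intro prod_pos) (auto simp: d'_def M_def)
  then have "Suc 0 \<le> (\<Prod>i\<in>UNIV - {j}. d' i)" by (rule Suc_leI)
  from mult_le_mono2[OF this, of M] have "M \<le> M * (\<Prod>i\<in>UNIV - {j}. d' i)" by (simp only: mult_Suc_right mult_0_right add_0_right)
  also have "\<dots> \<le> codim (gen UNIV p) * wprod" using le unfolding eq .
  finally show False unfolding M_def by (metis not_less_eq_eq order_refl)
qed

text \<open>If some nonzero derivative of \<open>g\<close> has degree 0, it is a constant, the ideal
  is the whole ring and the product has a zero factor. Otherwise all degrees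
  \<open>d - w $ i\<close> are positive, as \<open>codim_upper_bound\<close> requires.\<close>

lemma codim_jacobian:
  fixes f g :: "('k::alg_closed_field, 'n) mfps"
  assumes g: "homog w d g" and fc: "finite_codim (gen UNIV (\<lambda>i. mderiv i g))" and fg: "ordge w (Suc d) (f - g)"
  shows "finite_codim (gen UNIV (\<lambda>i. mderiv i f))"
    "real (codim (gen UNIV (\<lambda>i. mderiv i f))) = (\<Prod>i\<in>UNIV. real d / real (w $ i) - 1)"
proof -
  let ?f = "\<lambda>i. mderiv i f" and ?g = "\<lambda>i. mderiv i g"
  have hg: "homog w (d - w $ i) (?g i)" for i by (rule homog_mderiv[OF g])
  have le: "w $ i \<le> d" if nz: "?g i \<noteq> 0" for i
  proof -
    from nz obtain \<alpha> where "mcoeff (?g i) \<alpha> \<noteq> 0" by (metis mcoeff_ring_simps(1) mfps_eqI)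
    then have "mcoeff g (\<alpha> + axis i 1) \<noteq> 0" by (auto simp: mcoeff_mderiv)
    from homogD[OF g this] show ?thesis by simp
  qed
  have "finite_codim (gen UNIV ?f) \<and> real (codim (gen UNIV ?f)) = (\<Prod>i\<in>UNIV. real d / real (w $ i) - 1)"
  proof (cases "\<exists>i. ?g i \<noteq> 0 \<and> d = w $ i")
    case True
    then obtain i where i: "?g i \<noteq> 0" "d = w $ i" by blast
    obtain c where c: "?g i = mconst c" "c \<noteq> 0"
    proof (rule that)
      have "mcoeff (?g i) \<alpha> = 0" if "\<alpha> \<noteq> 0" for \<alpha>
        using homogD[OF hg[of i], of \<alpha>] i(2) that by auto
      then show *: "?g i = mconst (mcoeff (?g i) 0)" by (intro mfps_eqI) simp
      show "mcoeff (?g i) 0 \<noteq> 0" using i(1) * by (metis mconst_simps(1))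
    qed
    have sp: "spans (gen {i} ?g) ({} :: nat set) (\<lambda>_. 0)"
      unfolding spans_def
    proof
      fix h :: "('k, 'n) mfps"
      have "h = (h * mconst (inverse c)) * ?g i"
        unfolding c(1) using c(2) by (simp add: mult.assoc mconst_mult[symmetric])
      then have "h \<in> gen {i} ?g" unfolding gen_def by (auto intro!: image_eqI[of _ _ "\<lambda>_. h * mconst (inverse c)"])
      then show "\<exists>e. h - lincomb {} (\<lambda>_. 0) e \<in> gen {i} ?g" by (simp add: lincomb_def)
    qed
    \<comment> \<open>The perturbation bound, applied to this one derivative, shows that the
      derivative of \<open>f\<close> generates the unit ideal as well.\<close>
    have fg': "ordge w (Suc (d - w $ j)) (?f j - ?g j)" if "j \<in> {i}" for j
      using ordge_mderiv_diff[OF fg, of j] that i(2) by simp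
    from codim_perturbation_le[of "{i}" "\<lambda>j. d - w $ j" ?g ?f, OF _ hg spans_finite_codim[OF _ sp] fg']
      spans_codim_le[OF _ sp]
    have 1: "finite_codim (gen {i} ?f)" "codim (gen {i} ?f) = 0" by auto
    have sub: "gen {i} ?f \<subseteq> gen UNIV ?f"
      by (intro gen_subset mideal_gen gen_memI[of UNIV _ ?f]) auto
    have fU: "finite_codim (gen UNIV ?f)" using 1(1) sub by (rule finite_codim_mono)
    moreover have "codim (gen UNIV ?f) = 0" using codim_mono[OF 1(1) mideal_gen sub] 1(2) by simp
    moreover have "real d / real (w $ i) - 1 = 0" using i(2) w_pos[of i] by simp
    then have "(\<Prod>i\<in>UNIV. real d / real (w $ i) - 1) = 0" by (intro prod_zero) auto
    ultimately show ?thesis by simp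
  next
    case False
    then have lt: "w $ i < d" if "?g i \<noteq> 0" for i using le[OF that] that by (metis le_neq_implies_less)
    \<comment> \<open>A vanishing derivative would contradict finite codimension, so the strict
      inequality between weight and degree holds for every \<open>i\<close>.\<close>
    have nz: "?g i \<noteq> 0" for i
      by (rule finite_codim_homog_nonzero[OF fc, of "\<lambda>i. d - w $ i"]) (use hg lt in auto)
    have lt: "w $ i < d" for i using lt nz by blast
    have fg': "ordge w (Suc (d - w $ i)) (?f i - ?g i)" for i
      using ordge_mderiv_diff[OF fg, of i] lt[of i] by simp
    note pert = codim_perturbation_le[of UNIV "\<lambda>j. d - w $ j" ?g ?f, OF finite hg fc fg']
    have "ordge w (d - w $ i) (?f i)" for i
      using ordge_add[OF homog_imp_ordge[OF hg[of i]] ordge_mono[OF fg'[of i], of "d - w $ i"]] by simp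
    from codim_lower_bound[of "\<lambda>j. d - w $ j" ?f, OF this pert(1)]
    have "(\<Prod>i\<in>UNIV. d - w $ i) \<le> codim (gen UNIV ?f) * wprod" .
    moreover have "codim (gen UNIV ?f) * wprod \<le> (\<Prod>i\<in>UNIV. d - w $ i)"
    proof -
      have "codim (gen UNIV ?f) * wprod \<le> codim (gen UNIV ?g) * wprod" using pert(2) by (rule mult_le_mono1)
      also have "\<dots> \<le> (\<Prod>i\<in>UNIV. d - w $ i)"
        using codim_upper_bound[of "\<lambda>j. d - w $ j" ?g, OF hg _ fc] lt by simp
      finally show ?thesis .
    qed
    ultimately have "codim (gen UNIV ?f) * wprod = (\<Prod>i\<in>UNIV. d - w $ i)" by simp
    then have "real (codim (gen UNIV ?f) * wprod) = real (\<Prod>i\<in>UNIV. d - w $ i)" by (rule arg_cong)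
    then have "real (codim (gen UNIV ?f)) * (\<Prod>i\<in>UNIV. real (w $ i)) = (\<Prod>i\<in>UNIV. real d - real (w $ i))"
      using lt by (simp add: of_nat_diff less_imp_le)
    moreover have "(\<Prod>i\<in>UNIV. real (w $ i)) \<noteq> 0" using w_pos by (simp add: prod_zero_iff)
    ultimately have "real (codim (gen UNIV ?f)) = (\<Prod>i\<in>UNIV. real d - real (w $ i)) / (\<Prod>i\<in>UNIV. real (w $ i))"
      by (simp add: field_simps)
    also have "\<dots> = (\<Prod>i\<in>UNIV. (real d - real (w $ i)) / real (w $ i))" by (rule prod_dividef[symmetric])
    also have "\<dots> = (\<Prod>i\<in>UNIV. real d / real (w $ i) - 1)"
      by (rule prod.cong) (use w_pos in \<open>auto simp: diff_divide_distrib\<close>)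
    finally show ?thesis using pert(1) by simp
  qed
  then show "finite_codim (gen UNIV ?f)" "real (codim (gen UNIV ?f)) = (\<Prod>i\<in>UNIV. real d / real (w $ i) - 1)"
    by simp_all
qed

lemma milnor_number_rSQH:
  fixes f :: "('k::alg_closed_field, 'n) mfps"
  assumes f: "rSQH_of_degree w d f"
  shows "ereal_of_enat (milnor_number f) = ereal (\<Prod>i\<in>UNIV. real d / real (w $ i) - 1)"
proof -
  define g where "g = in_weight w f"
  have fc: "finite_codim (gen UNIV (\<lambda>i. mderiv i g))" and g: "homog w d g"
    using f unfolding rSQH_of_degree_def rSQH_iff g_def homog_def msupp_def by auto
  have "msupp g \<noteq> {}"
  proof
    assume "msupp g = {}"
    then have "g = 0" by (intro mfps_eqI) (auto simp: msupp_def)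
    then have "mderiv i g = 0" for i by (intro mfps_eqI) (simp add: mcoeff_mderiv)
    \<comment> \<open>For a vanishing principal part every point is a common zero of the
      derivatives, in particular the one with all coordinates 1.\<close>
    then have "(\<chi> i. (1 :: 'k)) = (0 :: 'k ^ 'n)"
      using fc by (intro finite_codim_common_zero[of UNIV "\<lambda>_. 0" "\<lambda>i. mderiv i g"]) auto
    then show False by (simp add: vec_eq_iff)
  qed
  then obtain \<beta> where \<beta>: "\<beta> \<in> msupp g" by blast
  have \<beta>d: "weighted_degree w \<beta> = d" using \<beta> by (intro homogD[OF g]) (simp add: msupp_def)
  have \<beta>_min: "\<forall>\<gamma>\<in>msupp f. weighted_degree w \<beta> \<le> weighted_degree w \<gamma>"
    using \<beta> by (simp add: g_def in_weight_def msupp_def split: if_splits)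
  have "ordge w (Suc d) (f - g)"
    unfolding ordge_def
  proof (intro allI impI, rule ccontr)
    fix \<alpha> assume nz: "mcoeff (f - g) \<alpha> \<noteq> 0" and "\<not> Suc d \<le> weighted_degree w \<alpha>"
    then have "weighted_degree w \<alpha> \<le> d" by simp
    then have "\<forall>\<gamma>\<in>msupp f. weighted_degree w \<alpha> \<le> weighted_degree w \<gamma>"
      using \<beta>_min \<beta>d le_trans by blast
    then have "mcoeff g \<alpha> = mcoeff f \<alpha>"
      by (simp add: g_def in_weight_def) (simp add: msupp_def)
    with nz show False by simp
  qed
  from codim_jacobian[OF g fc this] show ?thesis
    unfolding milnor_number_eq jacobian_ideal_eq_gen by (simp add: ereal_of_enat_simps)
qed

text \<open>The same condition on common zeros to which \<open>INND_iff\<close> reduces inner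
  non-degeneracy; the equivalence follows by comparing the two.\<close>

lemma rSQH_iff_common_zeros:
  fixes f :: "('k::alg_closed_field, 'n) mfps"
  shows "rSQH w f \<longleftrightarrow> (\<forall>q. (\<forall>i. meval (mderiv i (in_weight w f)) q = 0) \<longrightarrow> q = 0)"
proof -
  obtain d where "homog w d (in_weight w f)" using homog_in_weight by blast
  note h = homog_mderiv[OF this]
  show ?thesis
    unfolding rSQH_iff finite_codim_gen_iff[of UNIV "\<lambda>i. d - w $ i" "\<lambda>i. mderiv i (in_weight w f)", OF finite h] by simp
qed

end

theorem proposition3p7:
  shows "(\<forall>(P :: (real ^ 'n::finite) set) \<Delta> (w :: nat ^ 'n) (f :: ('k::alg_closed_field, 'n) mfps).
            C_polytope P \<longrightarrow> polytope_facets P = {\<Delta>} \<longrightarrow>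
            (\<forall>i. 0 < w $ i) \<longrightarrow> has_weight_vector \<Delta> w \<longrightarrow>
            no_point_below P f \<longrightarrow> in_weight w f = in_face \<Delta> f \<longrightarrow>
            (INND P f \<longleftrightarrow> rSQH w f))
       \<and> (\<forall>(w :: nat ^ 'n) (d :: nat) (f :: ('k, 'n) mfps).
            (\<forall>i. 0 < w $ i) \<longrightarrow> rSQH_of_degree w d f \<longrightarrow>
            ereal_of_enat (milnor_number f) =
              ereal (\<Prod>i\<in>UNIV. real d / real (w $ i) - 1))"
proof (intro conjI allI impI)
  fix P :: "(real ^ 'n) set" and \<Delta> and w :: "nat ^ 'n" and f :: "('k, 'n) mfps"
  assume C: "C_polytope P" and facet: "polytope_facets P = {\<Delta>}" and w: "\<forall>i. 0 < w $ i"
    and weight: "has_weight_vector \<Delta> w" and below: "no_point_below P f" and eq: "in_weight w f = in_face \<Delta> f"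
  interpret pos_weights w using w by unfold_locales blast
  show "INND P f \<longleftrightarrow> rSQH w f"
    unfolding INND_iff[OF C facet w weight] rSQH_iff_common_zeros eq using below by blast
next
  fix w :: "nat ^ 'n" and d and f :: "('k, 'n) mfps"
  assume w: "\<forall>i. 0 < w $ i" and f: "rSQH_of_degree w d f"
  interpret pos_weights w using w by unfold_locales blast
  show "ereal_of_enat (milnor_number f) = ereal (\<Prod>i\<in>UNIV. real d / real (w $ i) - 1)"
    using f by (rule milnor_number_rSQH)
qed

end
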